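(* Assume that $h_0$ satisfies either Case I with $\alpha\ge 3/2$, or Case II with $\alpha\ge 2$. Let $\eta_0>0$, $\eta_1\in\mathbb{R}$ and let $\eta$ be the solution of $\eta''=G(\eta,\eta')$, $\eta(0)=\eta_0$, $\eta'(0)=\eta_1$ on its maximal interval of existence $[0,T[$. Then $T=+\infty$, and there exist constants $0<m_0\le M_0$ and $M_1\ge0$ such that $m_0\le\eta(t)\le M_0$ and $|\eta'(t)|\le M_1$ for all $t\ge0$.
   Context: Let $\Omega\subset\mathbb{R}^2$ be a bounded open set with regular boundary and $0\in\Omega$. Let $h_0\in C^1(\bar\Omega)$ with $h_0\ge 0$ and $\min_{\Omega}h_0=h_0(0)=0$. Let $F>0$, $K=\{\varphi\in H^1_0(\Omega):\varphi\ge 0\}$. For $\beta>0$, $\gamma\in\mathbb{R}$, let $q\in K$ be the unique solution of $\int_\Omega (h_0+\beta)^3\nabla q\cdot\nabla(\varphi-q)\ge \int_\Omega h_0\,\partial_{x_1}(\varphi-q)-\gamma\int_\Omega(\varphi-q)$ for all $\varphi\in K$, and set $G(\beta,\gamma)=\int_\Omega q\,dx-F$ (a locally Lipschitz function on $]0,\infty[\times\mathbb{R}$, so the Cauchy problem has a unique maximal $C^2$ solution with $\eta>0$). Case I (line contact): $h_0(0,x_2)=0$ whenever $(0,x_2)\in\Omega$, $h_0(x_1,x_2)>0$ for $x_1\neq0$, and there exist $\alpha\ge1$, a neighborhood $W$ of $0$ and a regular function $h_1>0$ on $\bar W$ with $h_0(x_1,x_2)=|x_1|^\alpha h_1(x_1,x_2)$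 on $W$. Case II (point contact): $h_0(x)>0$ for $x\in\Omega\setminus\{0\}$, and there exist $\alpha\ge1$, a neighborhood $W$ of $0$ and a regular $h_1>0$ on $\bar W$ with $h_0(x)=|x|^\alpha h_1(x)$ on $W$. *)

theory Defs
  imports "HOL-Analysis.Analysis"
begin

definition L2_on :: "(real^2) set \<Rightarrow> (real^2 \<Rightarrow> real) \<Rightarrow> bool" where
  "L2_on \<Omega> u \<longleftrightarrow> u \<in> borel_measurable (lebesgue_on \<Omega>) \<and>
     integrable (lebesgue_on \<Omega>) (\<lambda>x. (u x)^2)"

definition Cc1 :: "(real^2) set \<Rightarrow> (real^2 \<Rightarrow> real) \<Rightarrow> (real^2 \<Rightarrow> real^2) \<Rightarrow> bool" where
  "Cc1 \<Omega> \<phi> D\<phi> \<longleftrightarrow> continuous_on UNIV D\<phi> \<and>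
     (\<forall>x. (\<phi> has_derivative (\<lambda>v. D\<phi> x \<bullet> v)) (at x)) \<and>
     (\<exists>C. compact C \<and> C \<subseteq> \<Omega> \<and> (\<forall>x. x \<notin> C \<longrightarrow> \<phi> x = 0))"

definition weak_grad :: "(real^2) set \<Rightarrow> (real^2 \<Rightarrow> real) \<Rightarrow> (real^2 \<Rightarrow> real^2) \<Rightarrow> bool" where
  "weak_grad \<Omega> u g \<longleftrightarrow> L2_on \<Omega> u \<and> (\<forall>i. L2_on \<Omega> (\<lambda>x. g x $ i)) \<and>
     (\<forall>\<phi> D\<phi>. Cc1 \<Omega> \<phi> D\<phi> \<longrightarrow> (\<forall>i.
        integral\<^sup>L (lebesgue_on \<Omega>) (\<lambda>x. u x * D\<phi> x $ i) =
        - integral\<^sup>L (lebesgue_on \<Omega>) (\<lambda>x. g x $ i * \<phi> x)))"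

definition H10 :: "(real^2) set \<Rightarrow> (real^2 \<Rightarrow> real) \<Rightarrow> (real^2 \<Rightarrow> real^2) \<Rightarrow> bool" where
  "H10 \<Omega> u g \<longleftrightarrow> weak_grad \<Omega> u g \<and>
     (\<exists>\<phi>s D\<phi>s. (\<forall>n. Cc1 \<Omega> (\<phi>s n) (D\<phi>s n)) \<and>
        (\<lambda>n. integral\<^sup>L (lebesgue_on \<Omega>)
            (\<lambda>x. (u x - \<phi>s n x)^2 + (norm (g x - D\<phi>s n x))^2)) \<longlonglongrightarrow> 0)"

definition inK :: "(real^2) set \<Rightarrow> (real^2 \<Rightarrow> real) \<Rightarrow> (real^2 \<Rightarrow> real^2) \<Rightarrow> bool" where
  "inK \<Omega> u g \<longleftrightarrow> H10 \<Omega> u g \<and> (AE x in lebesgue_on \<Omega>. 0 \<le> u x)"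

definition vi_sol :: "(real^2) set \<Rightarrow> (real^2 \<Rightarrow> real) \<Rightarrow> real \<Rightarrow> real \<Rightarrow>
    (real^2 \<Rightarrow> real) \<Rightarrow> (real^2 \<Rightarrow> real^2) \<Rightarrow> bool" where
  "vi_sol \<Omega> h0 \<beta> \<gamma> q g \<longleftrightarrow> inK \<Omega> q g \<and>
     (\<forall>\<phi> g\<phi>. inK \<Omega> \<phi> g\<phi> \<longrightarrow>
        integral\<^sup>L (lebesgue_on \<Omega>) (\<lambda>x. (h0 x + \<beta>)^3 * (g x \<bullet> (g\<phi> x - g x)))
        \<ge> integral\<^sup>L (lebesgue_on \<Omega>) (\<lambda>x. h0 x * (g\<phi> x $ 1 - g x $ 1))
          - \<gamma> * integral\<^sup>L (lebesgue_on \<Omega>) (\<lambda>x. \<phi> x - q x))"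

definition G :: "(real^2) set \<Rightarrow> (real^2 \<Rightarrow> real) \<Rightarrow> real \<Rightarrow> real \<Rightarrow> real \<Rightarrow> real" where
  "G \<Omega> h0 F \<beta> \<gamma> = (THE I. \<exists>q g. vi_sol \<Omega> h0 \<beta> \<gamma> q g \<and>
       I = integral\<^sup>L (lebesgue_on \<Omega>) q) - F"

text \<open>Regular (here: C-infinity) boundary: locally Omega is the subgraph of a smooth function
  in rotated coordinates.\<close>
definition smooth_boundary :: "(real^2) set \<Rightarrow> bool" where
  "smooth_boundary \<Omega> \<longleftrightarrow> (\<forall>p \<in> frontier \<Omega>. \<exists>r>0. \<exists>(f :: real^2 \<Rightarrow> real^2) (\<psi> :: real \<Rightarrow> real).
     orthogonal_transformation f \<and>
     (\<forall>n x. (deriv ^^ n) \<psi> differentiable (at x)) \<and>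
     \<Omega> \<inter> ball p r = {x \<in> ball p r. f (x - p) $ 2 < \<psi> (f (x - p) $ 1)})"

definition C1_closure :: "(real^2) set \<Rightarrow> (real^2 \<Rightarrow> real) \<Rightarrow> bool" where
  "C1_closure S h \<longleftrightarrow> continuous_on (closure S) h \<and>
     (\<exists>D. continuous_on (closure S) D \<and> (\<forall>x\<in>S. (h has_derivative (\<lambda>v. D x \<bullet> v)) (at x)))"

definition regular_pos :: "(real^2) set \<Rightarrow> (real^2 \<Rightarrow> real) \<Rightarrow> bool" where
  "regular_pos W h1 \<longleftrightarrow> C1_closure W h1 \<and> (\<forall>x\<in>closure W. h1 x > 0)"

definition line_contact :: "(real^2) set \<Rightarrow> (real^2 \<Rightarrow> real) \<Rightarrow> real \<Rightarrow> bool" where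
  "line_contact \<Omega> h0 \<alpha> \<longleftrightarrow> \<alpha> \<ge> 1 \<and>
     (\<forall>x\<in>\<Omega>. x $ 1 = 0 \<longrightarrow> h0 x = 0) \<and>
     (\<forall>x\<in>\<Omega>. x $ 1 \<noteq> 0 \<longrightarrow> h0 x > 0) \<and>
     (\<exists>W h1. open W \<and> 0 \<in> W \<and> regular_pos W h1 \<and>
        (\<forall>x \<in> W \<inter> closure \<Omega>. h0 x = \<bar>x $ 1\<bar> powr \<alpha> * h1 x))"

definition point_contact :: "(real^2) set \<Rightarrow> (real^2 \<Rightarrow> real) \<Rightarrow> real \<Rightarrow> bool" where
  "point_contact \<Omega> h0 \<alpha> \<longleftrightarrow> \<alpha> \<ge> 1 \<and>
     (\<forall>x\<in>\<Omega> - {0}. h0 x > 0) \<and>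
     (\<exists>W h1. open W \<and> 0 \<in> W \<and> regular_pos W h1 \<and>
        (\<forall>x \<in> W \<inter> closure \<Omega>. h0 x = norm x powr \<alpha> * h1 x))"

definition ode_sol :: "(real \<Rightarrow> real \<Rightarrow> real) \<Rightarrow> real \<Rightarrow> real \<Rightarrow> ereal \<Rightarrow>
    (real \<Rightarrow> real) \<Rightarrow> (real \<Rightarrow> real) \<Rightarrow> bool" where
  "ode_sol Gf \<eta>0 \<eta>1 T \<eta> \<eta>' \<longleftrightarrow> T > 0 \<and> \<eta> 0 = \<eta>0 \<and> \<eta>' 0 = \<eta>1 \<and>
     (\<forall>t. 0 \<le> t \<and> ereal t < T \<longrightarrow> \<eta> t > 0 \<and>
        (\<eta> has_real_derivative \<eta>' t) (at t within {s. 0 \<le> s \<and> ereal s < T}) \<and>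
        (\<eta>' has_real_derivative Gf (\<eta> t) (\<eta>' t)) (at t within {s. 0 \<le> s \<and> ereal s < T}))"

end

theory Submission
  imports Defs
begin

text \<open>Write \<open>I \<beta> \<gamma>\<close> for the integral of the solution \<open>q\<close>, so that \<open>G \<beta> \<gamma> = I \<beta> \<gamma> - F\<close>. Adding the variational
  inequalities of two solutions shows that \<open>I\<close> is nonincreasing in \<open>\<gamma>\<close>; hence \<open>\<eta>'^2 / 2 + \<Phi> \<eta>\<close> with
  \<open>\<Phi>' = - G \<cdot> 0\<close> decreases along the motion. As \<open>I \<beta> 0\<close> tends to 0 for large \<open>\<beta>\<close>, this bounds \<open>\<eta>\<close> from above and
  \<open>\<eta>'\<close> on both sides. The lower bound comes from the squeeze film damping \<open>I \<beta> \<gamma> \<ge> F + c \<bar>\<gamma>\<bar> / \<beta>\<close> for small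
  \<open>\<beta>\<close> and \<open>\<gamma> \<le> 0\<close>: while \<open>\<eta>\<close> is small and decreasing, \<open>\<eta>' + c ln \<eta>\<close> increases. Testing the variational
  inequality with a bump of width \<open>\<beta> powr (1/\<alpha>)\<close> next to the contact set gives, up to a constant factor,
  \<open>I \<beta> \<gamma> \<ge> \<beta> powr (2/\<alpha> - 2) + \<bar>\<gamma>\<bar> * \<beta> powr (3/\<alpha> - 3)\<close> for a line contact and
  \<open>I \<beta> \<gamma> \<ge> \<beta> powr (3/\<alpha> - 2) + \<bar>\<gamma>\<bar> * \<beta> powr (4/\<alpha> - 3)\<close> for a point contact, which is
  where \<open>\<alpha> \<ge> 3/2\<close> and \<open>\<alpha> \<ge> 2\<close> enter. Finally the bounds exclude a finite \<open>T\<close>, because \<open>G\<close> is locally Lipschitz.\<close>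

section \<open>Square-integrable functions\<close>

text \<open>Energy alone need not keep the gap open. The lower bound for the force at zero speed is
  of order \<open>\<beta> powr (2/\<alpha> - 2)\<close> for a line contact and
  \<open>\<beta> powr (3/\<alpha> - 2)\<close> for a point contact; for \<open>\<alpha> < 2\<close>
  and \<open>\<alpha> < 3\<close> respectively this is integrable at 0, so the potential barrier it
  provides is finite. Damping of order \<open>1 / \<beta>\<close> is what decides: the integral of
  \<open>\<bar>\<eta>'\<bar> / \<eta>\<close> along a closing gap is a logarithm and diverges at
  contact, while the speed is bounded by the energy. The thresholds for \<alpha> express
  \<open>3/\<alpha> - 3 \<le> -1\<close> and \<open>4/\<alpha> - 3 \<le> -1\<close>. The bump sits
  at negative first coordinate, where \<open>h0\<close> decreases in that direction, so that the
  wedge term raises the pressure. Since the bound concerns the integral of \<open>q\<close> and not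
  its values, it is enough that \<open>q \<ge> 0\<close> and that the divergence of the weighted
  gradient of the bump is bounded. \<open>G\<close> is a definite description over all solutions, so
  its meaning rests on existence, obtained by minimising an energy, and on uniqueness of the
  integral.\<close>

definition sqint :: "'a measure \<Rightarrow> ('a \<Rightarrow> 'b::euclidean_space) \<Rightarrow> bool" where
  "sqint M f \<longleftrightarrow> f \<in> borel_measurable M \<and> integrable M (\<lambda>x. (norm (f x))^2)"

definition ip :: "'a measure \<Rightarrow> ('a \<Rightarrow> 'b::euclidean_space) \<Rightarrow> ('a \<Rightarrow> 'b) \<Rightarrow> real" where
  "ip M f g = (\<integral>x. f x \<bullet> g x \<partial>M)"

text \<open>There is no quotient by null sets: this is a seminorm, and every limit below is stated
  as \<open>L2norm\<close> of a difference tending to 0. Values in any Euclidean space let functions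
  and gradients share one theory.\<close>

definition L2norm :: "'a measure \<Rightarrow> ('a \<Rightarrow> 'b::euclidean_space) \<Rightarrow> real" where
  "L2norm M f = sqrt (\<integral>x. (norm (f x))^2 \<partial>M)"

lemma sqint_measurable[measurable_dest]: "sqint M f \<Longrightarrow> f \<in> borel_measurable M"
  by (simp add: sqint_def)

lemma L2norm_nonneg: "0 \<le> L2norm M f"
  by (simp add: L2norm_def)

lemma L2norm_power2: "(L2norm M f)^2 = (\<integral>x. (norm (f x))^2 \<partial>M)"
  by (simp add: L2norm_def)

lemma sqint_inner_integrable:
  assumes "sqint M f" "sqint M g"
  shows "integrable M (\<lambda>x. f x \<bullet> g x)"
proof (rule Bochner_Integration.integrable_bound)
  show "integrable M (\<lambda>x. (norm (f x))^2 + (norm (g x))^2)"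
    using assms by (simp add: sqint_def)
  show "(\<lambda>x. f x \<bullet> g x) \<in> borel_measurable M" using assms by measurable
  have "\<bar>f x \<bullet> g x\<bar> \<le> (norm (f x))^2 + (norm (g x))^2" for x
  proof -
    have "\<bar>f x \<bullet> g x\<bar> \<le> norm (f x) * norm (g x)" by (rule Cauchy_Schwarz_ineq2)
    moreover have "0 \<le> norm (f x) * norm (g x)" by simp
    moreover have "2 * (norm (f x) * norm (g x)) \<le> (norm (f x))^2 + (norm (g x))^2"
      using sum_squares_bound[of "norm (f x)" "norm (g x)"] by (simp add: mult_ac)
    ultimately show ?thesis by linarith
  qed
  then show "AE x in M. norm (f x \<bullet> g x) \<le> norm ((norm (f x))^2 + (norm (g x))^2)"
    by simp
qed

lemma sqint_scaleR: "sqint M f \<Longrightarrow> sqint M (\<lambda>x. c *\<^sub>R f x)"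
  by (auto simp: sqint_def power_mult_distrib)

lemma sqint_add:
  assumes "sqint M f" "sqint M g"
  shows "sqint M (\<lambda>x. f x + g x)"
proof -
  have "(norm (f x + g x))^2 = (norm (f x))^2 + (norm (g x))^2 + 2 * (f x \<bullet> g x)" for x
    by (simp add: power2_norm_eq_inner inner_add inner_commute)
  then show ?thesis using sqint_inner_integrable[OF assms] assms
    by (auto simp: sqint_def)
qed

lemma sqint_diff:
  assumes "sqint M f" "sqint M g"
  shows "sqint M (\<lambda>x. f x - g x)"
  using sqint_add[OF assms(1) sqint_scaleR[OF assms(2), of "-1"]] by simp

lemma sqint_bounded_mult:
  assumes "sqint M f" "k \<in> borel_measurable M" "\<And>x. x \<in> space M \<Longrightarrow> \<bar>k x\<bar> \<le> C"
  shows "sqint M (\<lambda>x. k x *\<^sub>R f x)" "L2norm M (\<lambda>x. k x *\<^sub>R f x) \<le> C * L2norm M f"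
proof -
  have meas: "(\<lambda>x. k x *\<^sub>R f x) \<in> borel_measurable M" using assms by measurable
  have le: "(norm (k x *\<^sub>R f x))^2 \<le> C^2 * (norm (f x))^2" if "x \<in> space M" for x
    unfolding norm_scaleR power_mult_distrib using assms(3)[OF that]
    by (intro mult_right_mono power_mono) auto
  have int: "integrable M (\<lambda>x. C^2 * (norm (f x))^2)" using assms(1) by (simp add: sqint_def)
  have sq: "integrable M (\<lambda>x. (norm (k x *\<^sub>R f x))^2)"
    by (rule Bochner_Integration.integrable_bound[OF int])
       (use meas le in \<open>auto intro!: AE_I2 borel_measurable_power borel_measurable_norm simp del: norm_scaleR\<close>)
  then show "sqint M (\<lambda>x. k x *\<^sub>R f x)" using meas by (simp add: sqint_def)
  show "L2norm M (\<lambda>x. k x *\<^sub>R f x) \<le> C * L2norm M f"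
  \<comment> \<open>On an empty space the hypothesis on \<open>k\<close> does not force
    \<open>0 \<le> C\<close>, which the main estimate needs.\<close>
  proof (cases "space M = {}")
    case True
    then show ?thesis by (simp add: L2norm_def Bochner_Integration.integral_empty)
  next
    case False
    then have "0 \<le> C" using assms(3) abs_ge_zero order_trans by blast
    have "L2norm M (\<lambda>x. k x *\<^sub>R f x) \<le> sqrt (\<integral>x. C^2 * (norm (f x))^2 \<partial>M)"
      unfolding L2norm_def by (intro real_sqrt_le_mono integral_mono[OF sq int] le)
    then show ?thesis using \<open>0 \<le> C\<close> by (simp add: L2norm_def real_sqrt_mult)
  qed
qed

lemma ip_self: "ip M f f = (L2norm M f)^2"
  by (simp add: ip_def L2norm_power2 power2_norm_eq_inner)

lemma ip_commute: "ip M f g = ip M g f"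
  by (simp add: ip_def inner_commute)

lemma ip_add_left: "sqint M f \<Longrightarrow> sqint M g \<Longrightarrow> sqint M h \<Longrightarrow> ip M (\<lambda>x. f x + g x) h = ip M f h + ip M g h"
  by (simp add: ip_def inner_add_left sqint_inner_integrable)

lemma ip_diff_left: "sqint M f \<Longrightarrow> sqint M g \<Longrightarrow> sqint M h \<Longrightarrow> ip M (\<lambda>x. f x - g x) h = ip M f h - ip M g h"
  by (simp add: ip_def inner_diff_left sqint_inner_integrable)

lemma ip_scaleR_left: "ip M (\<lambda>x. c *\<^sub>R f x) h = c * ip M f h"
  by (simp add: ip_def)

lemma ip_add_right: "sqint M f \<Longrightarrow> sqint M g \<Longrightarrow> sqint M h \<Longrightarrow> ip M h (\<lambda>x. f x + g x) = ip M h f + ip M h g"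
  by (simp add: ip_def inner_add_right sqint_inner_integrable)

lemma ip_diff_right: "sqint M f \<Longrightarrow> sqint M g \<Longrightarrow> sqint M h \<Longrightarrow> ip M h (\<lambda>x. f x - g x) = ip M h f - ip M h g"
  by (simp add: ip_def inner_diff_right sqint_inner_integrable)

lemma ip_scaleR_right: "ip M h (\<lambda>x. c *\<^sub>R f x) = c * ip M h f"
  by (simp add: ip_def)

lemma ip_lincomb_right:
  assumes "sqint M f" "sqint M g" "sqint M h"
  shows "ip M h (\<lambda>x. a *\<^sub>R f x + b *\<^sub>R g x) = a * ip M h f + b * ip M h g"
  by (simp only: ip_add_right[OF sqint_scaleR[OF assms(1)] sqint_scaleR[OF assms(2)] assms(3)] ip_scaleR_right)

text \<open>Discriminant of the nonnegative quadratic in \<open>t\<close> given by the squared norm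
  of \<open>f + t g\<close>. If \<open>g\<close> vanishes almost everywhere, the quadratic is affine
  and must be constant, hence the case distinction.\<close>

lemma ip_Cauchy_Schwarz:
  assumes "sqint M f" "sqint M g"
  shows "\<bar>ip M f g\<bar> \<le> L2norm M f * L2norm M g"
proof -
  let ?A = "ip M f f" and ?B = "ip M f g" and ?C = "ip M g g"
  have nonneg: "0 \<le> ?A + 2 * t * ?B + t^2 * ?C" for t
  proof -
    have "0 \<le> ip M (\<lambda>x. f x + t *\<^sub>R g x) (\<lambda>x. f x + t *\<^sub>R g x)" by (simp add: ip_self)
    also have "\<dots> = ?A + 2 * t * ?B + t^2 * ?C"
      by (simp add: ip_add_left ip_add_right ip_scaleR_left ip_scaleR_right assms sqint_add sqint_scaleR
          ip_commute[of M g f] power2_eq_square algebra_simps)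
    finally show ?thesis .
  qed
  have "?B^2 \<le> ?A * ?C"
  proof (cases "?C = 0")
    case True
    have "?B = 0"
    proof (rule ccontr)
      assume "?B \<noteq> 0"
      \<comment> \<open>With \<open>?C = 0\<close> this value of \<open>t\<close> makes the
        quadratic equal to -1.\<close>
      then show False using nonneg[of "- (?A + 1) / (2 * ?B)"] True by (simp add: field_simps)
    qed
    then show ?thesis using True by simp
  next
    case False
    then have "0 < ?C" by (simp add: ip_self)
    \<comment> \<open>The quadratic at its minimiser \<open>t = - ?B / ?C\<close>.\<close>
    have "0 \<le> (?A + 2 * (- ?B / ?C) * ?B + (- ?B / ?C)^2 * ?C) * ?C"
      using nonneg[of "- ?B / ?C"] \<open>0 < ?C\<close> by (intro mult_nonneg_nonneg) auto
    also have "\<dots> = ?A * ?C - ?B^2" using \<open>0 < ?C\<close> by (simp add: field_simps power2_eq_square)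
    finally show ?thesis by simp
  qed
  then have "?B^2 \<le> (L2norm M f * L2norm M g)^2" by (simp add: ip_self power_mult_distrib)
  then show ?thesis
    by (rule abs_le_square_iff[THEN iffD2, THEN order_trans]) (simp add: L2norm_nonneg)
qed

lemma L2norm_zero[simp]: "L2norm M (\<lambda>x. 0) = 0"
  by (simp add: L2norm_def)

lemma L2norm_triangle:
  assumes "sqint M f" "sqint M g"
  shows "L2norm M (\<lambda>x. f x + g x) \<le> L2norm M f + L2norm M g"
proof (rule power2_le_imp_le)
  have "(L2norm M (\<lambda>x. f x + g x))^2 = (L2norm M f)^2 + 2 * ip M f g + (L2norm M g)^2"
    by (simp add: ip_self[symmetric] ip_add_left ip_add_right assms sqint_add ip_commute[of M g f])
  also have "\<dots> \<le> (L2norm M f + L2norm M g)^2"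
    using ip_Cauchy_Schwarz[OF assms] by (simp add: power2_sum)
  finally show "(L2norm M (\<lambda>x. f x + g x))^2 \<le> (L2norm M f + L2norm M g)^2" .
qed (simp add: L2norm_nonneg)

lemma L2norm_scaleR: "L2norm M (\<lambda>x. c *\<^sub>R f x) = \<bar>c\<bar> * L2norm M f"
  by (simp add: L2norm_def power_mult_distrib real_sqrt_mult)

lemma L2norm_triangle_diff:
  assumes "sqint M f" "sqint M g" "sqint M h"
  shows "L2norm M (\<lambda>x. f x - h x) \<le> L2norm M (\<lambda>x. f x - g x) + L2norm M (\<lambda>x. g x - h x)"
  using L2norm_triangle[OF sqint_diff[OF assms(1,2)] sqint_diff[OF assms(2,3)]] by simp

text \<open>Joint continuity of the inner product. The passages to the limit in the weak gradient
  identity, in the Poincare inequality and in the energy all rest on it.\<close>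

lemma ip_tendsto:
  assumes "\<And>n. sqint M (f n)" "sqint M F" "\<And>n. sqint M (g n)" "sqint M H"
    and "(\<lambda>n. L2norm M (\<lambda>x. f n x - F x)) \<longlonglongrightarrow> 0" "(\<lambda>n. L2norm M (\<lambda>x. g n x - H x)) \<longlonglongrightarrow> 0"
  shows "(\<lambda>n. ip M (f n) (g n)) \<longlonglongrightarrow> ip M F H"
proof -
  let ?a = "\<lambda>n. L2norm M (\<lambda>x. f n x - F x)" and ?b = "\<lambda>n. L2norm M (\<lambda>x. g n x - H x)"
  have "(\<lambda>n. ip M (f n) (g n) - ip M F H) \<longlonglongrightarrow> 0"
  proof (rule tendsto_rabs_zero_cancel, rule tendsto_sandwich[OF _ _ tendsto_const])
    show "(\<lambda>n. ?a n * ?b n + ?a n * L2norm M H + L2norm M F * ?b n) \<longlonglongrightarrow> 0"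
      using assms(5,6) by (auto intro!: tendsto_eq_intros)
    have "\<bar>ip M (f n) (g n) - ip M F H\<bar> \<le> ?a n * ?b n + ?a n * L2norm M H + L2norm M F * ?b n" for n
    proof -
      note sq = assms(1)[of n] assms(2) assms(3)[of n] assms(4)
      have "ip M (f n) (g n) - ip M F H = ip M (\<lambda>x. f n x - F x) (\<lambda>x. g n x - H x)
          + ip M (\<lambda>x. f n x - F x) H + ip M F (\<lambda>x. g n x - H x)"
        by (simp add: ip_diff_left ip_diff_right sq sqint_diff)
      moreover have "\<bar>ip M (\<lambda>x. f n x - F x) (\<lambda>x. g n x - H x)\<bar> \<le> ?a n * ?b n"
        "\<bar>ip M (\<lambda>x. f n x - F x) H\<bar> \<le> ?a n * L2norm M H" "\<bar>ip M F (\<lambda>x. g n x - H x)\<bar> \<le> L2norm M F * ?b n"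
        by (intro ip_Cauchy_Schwarz sqint_diff sq)+
      ultimately show ?thesis by linarith
    qed
    then show "\<forall>\<^sub>F n in sequentially. \<bar>ip M (f n) (g n) - ip M F H\<bar>
       \<le> ?a n * ?b n + ?a n * L2norm M H + L2norm M F * ?b n" by simp
  qed simp
  then show ?thesis by (simp add: LIM_zero_iff)
qed

section \<open>Finite measures and completeness of L2\<close>

lemma sqint_bounded:
  assumes "finite_measure M" "f \<in> borel_measurable M" "\<And>x. x \<in> space M \<Longrightarrow> norm (f x) \<le> C"
  shows "sqint M f"
proof -
  interpret finite_measure M by fact
  have "integrable M (\<lambda>x. (norm (f x))^2)"
    by (rule integrable_const_bound[of _ "C^2"]) (use assms in \<open>auto intro!: AE_I2 power_mono\<close>)
  then show ?thesis using assms(2) by (simp add: sqint_def)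
qed

lemma sqint_integrable:
  fixes f :: "'a \<Rightarrow> real"
  assumes "finite_measure M" "sqint M f"
  shows "integrable M f" "integral\<^sup>L M f = ip M (\<lambda>x. 1) f"
  using sqint_inner_integrable[OF sqint_bounded[OF assms(1), of "\<lambda>x. 1::real"] assms(2)]
  by (auto simp: ip_def)

text \<open>Riesz-Fischer: a fast subsequence converges almost everywhere, and Fatou's lemma turns
  the Cauchy bounds against that subsequence into bounds for the distance to its pointwise
  limit.\<close>

lemma L2_complete:
  fixes f :: "nat \<Rightarrow> 'a \<Rightarrow> 'b::euclidean_space"
  assumes sq: "\<And>n. sqint M (f n)"
    and Cauchy: "\<And>e. 0 < e \<Longrightarrow> \<exists>N. \<forall>m\<ge>N. \<forall>n\<ge>N. L2norm M (\<lambda>x. f m x - f n x) < e"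
  obtains F where "sqint M F" "(\<lambda>n. L2norm M (\<lambda>x. f n x - F x)) \<longlonglongrightarrow> 0"
proof -
  have "\<exists>N. \<forall>m\<ge>N. \<forall>n\<ge>N. L2norm M (\<lambda>x. f m x - f n x) < (1/2)^k" for k
    by (rule Cauchy) simp
  then obtain r0 where r0: "\<And>k m n. r0 k \<le> m \<Longrightarrow> r0 k \<le> n \<Longrightarrow> L2norm M (\<lambda>x. f m x - f n x) < (1/2)^k"
    by metis
  \<comment> \<open>The maximum makes \<open>r\<close> monotone, so that \<open>r j\<close> passes
    every threshold \<open>r0 k\<close> with \<open>k \<le> j\<close>.\<close>
  define r where "r k = Max (r0 ` {..k})" for k
  have r_ge: "r0 k \<le> r j" if "k \<le> j" for k j using that by (auto simp: r_def)
  define d where "d k x = f (r (Suc k)) x - f (r k) x" for k x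
  have d_sq: "sqint M (d k)" for k unfolding d_def by (intro sqint_diff sq)
  have meas[measurable]: "f n \<in> borel_measurable M" "d n \<in> borel_measurable M" for n
    using sq d_sq by (auto simp: sqint_def)
  have nn: "(\<integral>\<^sup>+x. ennreal ((norm (g x))^2) \<partial>M) = ennreal ((L2norm M g)^2)" if "sqint M g" for g :: "'a \<Rightarrow> 'b"
    unfolding L2norm_power2 by (rule nn_integral_eq_integral) (use that in \<open>auto simp: sqint_def\<close>)
  have d_le: "(L2norm M (d k))^2 \<le> (1/4)^k" for k
  proof -
    have "L2norm M (d k) \<le> (1/2)^k"
      unfolding d_def by (rule less_imp_le, rule r0) (auto intro: r_ge)
    then have "(L2norm M (d k))^2 \<le> ((1/2)^k)^2" by (intro power_mono L2norm_nonneg)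
    then show ?thesis by (simp add: power2_eq_square flip: power_mult_distrib)
  qed
  \<comment> \<open>The weight \<open>2^k\<close> still leaves a convergent geometric series of
    integrals, and almost everywhere finiteness of the weighted sum forces
    \<open>norm (d k x)\<close> to decay geometrically with ratio \<open>sqrt (1/2)\<close>.\<close>
  have "(\<integral>\<^sup>+x. (\<Sum>k. ennreal (2^k * (norm (d k x))^2)) \<partial>M) = (\<Sum>k. \<integral>\<^sup>+x. ennreal (2^k * (norm (d k x))^2) \<partial>M)"
    by (rule nn_integral_suminf) measurable
  also have "\<dots> = (\<Sum>k. ennreal (2^k * (L2norm M (d k))^2))"
    by (simp add: ennreal_mult nn_integral_cmult nn[OF d_sq])
  also have "\<dots> \<le> (\<Sum>k. ennreal ((1/2)^k))"
  proof (intro suminf_le ennreal_leI)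
    fix k
    have "2^k * (L2norm M (d k))^2 \<le> 2^k * (1/4)^k" by (intro mult_left_mono d_le) auto
    then show "2^k * (L2norm M (d k))^2 \<le> (1/2)^k" by (simp flip: power_mult_distrib)
  qed auto
  also have "\<dots> = ennreal (\<Sum>k. (1/2)^k)" by (rule suminf_ennreal2) auto
  finally have "(\<integral>\<^sup>+x. (\<Sum>k. ennreal (2^k * (norm (d k x))^2)) \<partial>M) \<noteq> \<infinity>"
    by (auto simp: top_unique)
  then have "AE x in M. (\<Sum>k. ennreal (2^k * (norm (d k x))^2)) \<noteq> \<infinity>"
    by (intro nn_integral_noteq_infinite) auto
  then have conv: "AE x in M. convergent (\<lambda>k. f (r k) x)"
  proof eventually_elim
    fix x assume "(\<Sum>k. ennreal (2^k * (norm (d k x))^2)) \<noteq> \<infinity>"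
    then have "summable (\<lambda>k. 2^k * (norm (d k x))^2)" by (intro summable_suminf_not_top) auto
    then have "bounded (range (\<lambda>k. 2^k * (norm (d k x))^2))"
      using summable_LIMSEQ_zero convergentI convergent_imp_bounded by metis
    then obtain C where "\<forall>y\<in>range (\<lambda>k. 2^k * (norm (d k x))^2). norm y \<le> C"
      unfolding bounded_iff by blast
    then have C: "2^k * (norm (d k x))^2 \<le> C" for k by auto
    have "summable (\<lambda>k. d k x)"
    proof (rule summable_comparison_test'[where N = 0])
      show "summable (\<lambda>k. sqrt C * (sqrt (1/2))^k)"
        by (intro summable_mult summable_geometric) simp
      fix k
      have "(norm (d k x))^2 \<le> C * (1/2)^k" using C[of k] by (simp add: field_simps power_one_over)
      then have "norm (d k x) \<le> sqrt (C * (1/2)^k)" by (rule real_le_rsqrt)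
      then show "norm (d k x) \<le> sqrt C * (sqrt (1/2))^k" by (simp only: real_sqrt_mult real_sqrt_power)
    qed
    then have "convergent (\<lambda>n. \<Sum>k<n. d k x)" by (simp add: summable_iff_convergent)
    moreover have "(\<Sum>k<n. d k x) = f (r n) x - f (r 0) x" for n
      unfolding d_def by (rule sum_lessThan_telescope)
    ultimately have "convergent (\<lambda>n. f (r n) x - f (r 0) x)" by simp
    then show "convergent (\<lambda>n. f (r n) x)"
      using convergent_add[OF _ convergent_const[of "f (r 0) x"]] by fastforce
  qed
  define F where "F x = lim (\<lambda>k. f (r k) x)" for x
  have F_meas[measurable]: "F \<in> borel_measurable M" unfolding F_def by measurable
  have est: "(\<integral>\<^sup>+x. ennreal ((norm (f n x - F x))^2) \<partial>M) \<le> ennreal (((1/2)^k)^2)" if "r0 k \<le> n" for n k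
  proof -
    have "AE x in M. ennreal ((norm (f n x - F x))^2) = liminf (\<lambda>j. ennreal ((norm (f n x - f (r j) x))^2))"
      using conv
    proof eventually_elim
      fix x assume "convergent (\<lambda>k. f (r k) x)"
      then have "(\<lambda>k. f (r k) x) \<longlonglongrightarrow> F x" by (simp add: F_def convergent_LIMSEQ_iff)
      then have "(\<lambda>j. ennreal ((norm (f n x - f (r j) x))^2)) \<longlonglongrightarrow> ennreal ((norm (f n x - F x))^2)"
        by (intro tendsto_intros)
      then show "ennreal ((norm (f n x - F x))^2) = liminf (\<lambda>j. ennreal ((norm (f n x - f (r j) x))^2))"
        by (intro lim_imp_Liminf[symmetric]) auto
    qed
    then have "(\<integral>\<^sup>+x. ennreal ((norm (f n x - F x))^2) \<partial>M) = (\<integral>\<^sup>+x. liminf (\<lambda>j. ennreal ((norm (f n x - f (r j) x))^2)) \<partial>M)"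
      by (rule nn_integral_cong_AE)
    also have "\<dots> \<le> liminf (\<lambda>j. \<integral>\<^sup>+x. ennreal ((norm (f n x - f (r j) x))^2) \<partial>M)"
      by (rule nn_integral_liminf) measurable
    also have "\<dots> \<le> ennreal (((1/2)^k)^2)"
    proof (rule Liminf_le, simp, rule eventually_sequentiallyI[of k])
      fix j assume "k \<le> j"
      then show "(\<integral>\<^sup>+x. ennreal ((norm (f n x - f (r j) x))^2) \<partial>M) \<le> ennreal (((1/2)^k)^2)"
        unfolding nn[OF sqint_diff[OF sq sq]]
        using r0[OF that, of "r j"] r_ge[of k j] by (intro ennreal_leI power_mono L2norm_nonneg) auto
    qed
    finally show ?thesis .
  qed
  have sqdiff: "sqint M (\<lambda>x. f n x - F x)" if "r0 k \<le> n" for n k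
    unfolding sqint_def
  proof
    show "integrable M (\<lambda>x. (norm (f n x - F x))^2)"
      by (rule integrableI_bounded)
         (use le_less_trans[OF est[OF that]] in auto)
  qed measurable
  have "sqint M F"
    using sqint_diff[OF sq[of "r0 0"] sqdiff[of 0 "r0 0"]] by simp
  moreover have "(\<lambda>n. L2norm M (\<lambda>x. f n x - F x)) \<longlonglongrightarrow> 0"
  proof (rule LIMSEQ_I)
    fix e :: real assume "0 < e"
    then obtain k where k: "(1/2)^k < e" using real_arch_pow_inv[of e "1/2"] by auto
    have "L2norm M (\<lambda>x. f n x - F x) \<le> (1/2)^k" if "r0 k \<le> n" for n
    proof (rule power2_le_imp_le)
      show "(L2norm M (\<lambda>x. f n x - F x))^2 \<le> ((1/2)^k)^2"
        using est[OF that] unfolding nn[OF sqdiff[OF that]] by (subst (asm) ennreal_le_iff) auto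
    qed simp
    then show "\<exists>N. \<forall>n\<ge>N. norm (L2norm M (\<lambda>x. f n x - F x) - 0) < e"
      using k by (intro exI[of _ "r0 k"]) (auto simp: L2norm_nonneg intro: le_less_trans)
  qed
  ultimately show thesis by (rule that)
qed

section \<open>Test functions\<close>

lemma norm_vec2_power2: "(norm (x :: real^2))^2 = (x $ 1)^2 + (x $ 2)^2"
  unfolding power2_norm_eq_inner by (simp add: inner_vec_def sum_2 power2_eq_square)

lemma vec_nth_eq_inner: "(x :: real^2) $ i = x \<bullet> axis i 1"
  by (simp add: inner_axis)

lemma sqint_vec:
  "sqint M g \<longleftrightarrow> (\<forall>i. sqint M (\<lambda>x. g x $ i))" for g :: "'a \<Rightarrow> real^2"
proof
  assume g: "sqint M g"
  then have [measurable]: "g \<in> borel_measurable M" by (simp add: sqint_def)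
  show "\<forall>i. sqint M (\<lambda>x. g x $ i)"
  proof
    fix i
    have "integrable M (\<lambda>x. (norm (g x $ i))^2)"
    proof (rule Bochner_Integration.integrable_bound)
      show "integrable M (\<lambda>x. (norm (g x))^2)" using g by (simp add: sqint_def)
      show "(\<lambda>x. (norm (g x $ i))^2) \<in> borel_measurable M"
        unfolding vec_nth_eq_inner by measurable
      show "AE x in M. norm ((norm (g x $ i))^2) \<le> norm ((norm (g x))^2)"
        using component_le_norm_cart[of _ i] by (intro AE_I2) (simp add: abs_le_square_iff[symmetric])
    qed
    then show "sqint M (\<lambda>x. g x $ i)" unfolding sqint_def vec_nth_eq_inner by auto
  qed
next
  assume g: "\<forall>i. sqint M (\<lambda>x. g x $ i)"
  have "g \<in> borel_measurable M"
    by (rule borel_measurable_euclidean_space[THEN iffD2])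
       (use g in \<open>auto simp: Basis_vec_def cart_eq_inner_axis[symmetric] sqint_def\<close>)
  then show "sqint M g" using g by (auto simp: sqint_def norm_vec2_power2)
qed

lemma L2_on_iff_sqint: "L2_on \<Omega> u \<longleftrightarrow> sqint (lebesgue_on \<Omega>) u"
  by (simp add: L2_on_def sqint_def)

text \<open>Outside the closed set \<open>C\<close> the function vanishes on a whole neighbourhood,
  hence so does its gradient; \<open>\<phi>\<close> and \<open>D\<phi>\<close> thus share one
  compact support.\<close>

lemma Cc1_deriv_zero:
  assumes "Cc1 \<Omega> \<phi> D\<phi>" "compact C" "\<And>y. y \<notin> C \<Longrightarrow> \<phi> y = 0" "x \<notin> C"
  shows "D\<phi> x = 0"
proof -
  have "(\<phi> has_derivative (\<lambda>v. D\<phi> x \<bullet> v)) (at x)" using assms(1) by (simp add: Cc1_def)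
  moreover have "(\<phi> has_derivative (\<lambda>v. 0)) (at x)"
  proof (rule has_derivative_transform_within_open)
    show "((\<lambda>y. 0) has_derivative (\<lambda>v. 0)) (at x)" by simp
    show "open (- C)" using assms(2) by (simp add: compact_imp_closed open_Compl)
  qed (use assms in auto)
  ultimately have "(\<lambda>v. D\<phi> x \<bullet> v) = (\<lambda>v. 0)" by (rule has_derivative_unique)
  then have "D\<phi> x \<bullet> D\<phi> x = 0" by meson
  then show ?thesis by simp
qed

lemma Cc1_support:
  assumes "Cc1 \<Omega> \<phi> D\<phi>"
  shows "\<exists>C. compact C \<and> C \<subseteq> \<Omega> \<and> (\<forall>x. x \<notin> C \<longrightarrow> \<phi> x = 0 \<and> D\<phi> x = 0)"
  using assms Cc1_deriv_zero unfolding Cc1_def by metis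

lemma Cc1_continuous:
  assumes "Cc1 \<Omega> \<phi> D\<phi>"
  shows "continuous_on S \<phi>" "continuous_on S D\<phi>" "continuous_on S (\<lambda>x. D\<phi> x $ i)"
proof -
  show "continuous_on S \<phi>"
    using assms unfolding Cc1_def
    by (meson continuous_at_imp_continuous_on has_derivative_continuous)
  show "continuous_on S D\<phi>"
    using assms unfolding Cc1_def by (meson continuous_on_subset subset_UNIV)
  then show "continuous_on S (\<lambda>x. D\<phi> x $ i)" by (intro continuous_intros)
qed

text \<open>Differentiate the translation-invariant integral \<open>\<integral> \<phi> (x + t e) dx\<close> at \<open>t = 0\<close>.\<close>

lemma integral_Cc1_deriv_eq_0:
  assumes \<phi>: "Cc1 \<Omega> \<phi> D\<phi>" and "open \<Omega>"
  shows "integral\<^sup>L (lebesgue_on \<Omega>) (\<lambda>x. D\<phi> x $ i) = 0"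
proof -
  obtain C where C: "compact C" "C \<subseteq> \<Omega>" "\<And>x. x \<notin> C \<Longrightarrow> \<phi> x = 0" "\<And>x. x \<notin> C \<Longrightarrow> D\<phi> x = 0"
    using Cc1_support[OF \<phi>] by blast
  define e :: "real^2" where "e = axis i 1"
  have De: "D\<phi> x $ i = D\<phi> x \<bullet> e" for x by (simp add: e_def inner_axis)
  have meas[measurable]: "\<phi> \<in> borel_measurable borel" "(\<lambda>x. D\<phi> x $ i) \<in> borel_measurable borel"
    using Cc1_continuous[OF \<phi>] by (auto intro: borel_measurable_continuous_onI)
  have "bounded (D\<phi> ` C)"
    by (intro compact_imp_bounded compact_continuous_image Cc1_continuous[OF \<phi>] C)
  then obtain B where "\<And>x. x \<in> C \<Longrightarrow> norm (D\<phi> x) \<le> B" "0 < B"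
    unfolding bounded_pos by auto
  then have B: "norm (D\<phi> x) \<le> B" for x using C(4)[of x] by (cases "x \<in> C") auto
  \<comment> \<open>This bounds the difference quotients \<open>q n\<close> uniformly by
    \<open>B\<close>.\<close>
  have lip: "\<bar>\<phi> (x + t *\<^sub>R e) - \<phi> x\<bar> \<le> B * \<bar>t\<bar>" for x t
  proof -
    have "norm (\<phi> (x + t *\<^sub>R e) - \<phi> x) \<le> B * norm (x + t *\<^sub>R e - x)"
    proof (rule differentiable_bound[of UNIV \<phi> "\<lambda>x v. D\<phi> x \<bullet> v"])
      fix x show "(\<phi> has_derivative (\<lambda>v. D\<phi> x \<bullet> v)) (at x)" using \<phi> by (simp add: Cc1_def)
      have "onorm (\<lambda>v. D\<phi> x \<bullet> v) \<le> norm (D\<phi> x)"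
        by (intro onorm_bound) (auto simp: Cauchy_Schwarz_ineq2)
      then show "onorm (\<lambda>v. D\<phi> x \<bullet> v) \<le> B" using B[of x] by linarith
    qed auto
    then show ?thesis by (simp add: e_def)
  qed
  obtain R where R: "\<And>x. x \<in> C \<Longrightarrow> norm x \<le> R"
    using compact_imp_bounded[OF C(1)] unfolding bounded_iff by auto
  define q where "q n x = real (Suc n) * (\<phi> (x + (1 / real (Suc n)) *\<^sub>R e) - \<phi> x)" for n x
  have \<phi>_int: "integrable lborel \<phi>"
  proof -
    have "integrable lborel (\<lambda>x. indicator C x *\<^sub>R \<phi> x)"
      by (intro borel_integrable_compact C Cc1_continuous[OF \<phi>])
    moreover have "(\<lambda>x. indicator C x *\<^sub>R \<phi> x) = \<phi>"
      using C(3) by (intro ext) (auto simp: indicator_def)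
    ultimately show ?thesis by simp
  qed
  have "(\<integral>x. q n x \<partial>lborel) = 0" for n
  proof -
    define c where "c = (1 / real (Suc n)) *\<^sub>R e"
    have [measurable]: "(+) c \<in> borel_measurable lborel" by measurable
    have "integrable lborel (\<lambda>x. \<phi> (c + x))"
      using \<phi>_int integrable_distr_eq[of "(+) c" lborel borel \<phi>] by (simp add: lborel_distr_plus)
    moreover have "(\<integral>x. \<phi> (c + x) \<partial>lborel) = (\<integral>x. \<phi> x \<partial>lborel)"
      using integral_distr[of "(+) c" lborel borel \<phi>] by (simp add: lborel_distr_plus)
    ultimately show ?thesis unfolding q_def
      using \<phi>_int by (simp add: c_def add.commute)
  qed
  have "(\<lambda>n. \<integral>x. q n x \<partial>lborel) \<longlonglongrightarrow> (\<integral>x. D\<phi> x $ i \<partial>lborel)"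
  \<comment> \<open>The shifts have length at most 1, so all difference quotients vanish outside the
    ball of radius \<open>R + 1\<close>.\<close>
  proof (rule integral_dominated_convergence[where w = "\<lambda>x. B * indicator (cball 0 (R + 1)) x"])
    show "AE x in lborel. (\<lambda>n. q n x) \<longlonglongrightarrow> D\<phi> x $ i"
    proof (rule AE_I2)
      fix x
      have "((\<lambda>t. \<phi> (x + t *\<^sub>R e)) has_real_derivative D\<phi> x $ i) (at 0)"
      proof -
        have "(\<phi> has_derivative (\<lambda>v. D\<phi> x \<bullet> v)) (at (x + 0 *\<^sub>R e))" using \<phi> by (simp add: Cc1_def)
        then have "((\<lambda>t. \<phi> (x + t *\<^sub>R e)) has_derivative (\<lambda>t. D\<phi> x \<bullet> (t *\<^sub>R e))) (at 0)"
          by (rule has_derivative_compose[rotated]) (auto intro!: derivative_eq_intros)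
        moreover have "(\<lambda>t. D\<phi> x \<bullet> (t *\<^sub>R e)) = (*) (D\<phi> x $ i)" by (auto simp: De)
        ultimately show ?thesis by (simp add: has_field_derivative_def)
      qed
      then have "((\<lambda>h. (\<phi> (x + (0 + h) *\<^sub>R e) - \<phi> (x + 0 *\<^sub>R e)) / h) \<longlongrightarrow> D\<phi> x $ i) (at 0)"
        by (simp add: DERIV_def)
      then have "((\<lambda>h. (\<phi> (x + h *\<^sub>R e) - \<phi> x) / h) \<circ> (\<lambda>n. 1 / real (Suc n))) \<longlonglongrightarrow> D\<phi> x $ i"
        unfolding tendsto_at_iff_sequentially
        using LIMSEQ_inverse_real_of_nat by (auto simp: inverse_eq_divide)
      moreover have "(\<lambda>h. (\<phi> (x + h *\<^sub>R e) - \<phi> x) / h) \<circ> (\<lambda>n. 1 / real (Suc n)) = (\<lambda>n. q n x)"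
        by (auto simp: q_def)
      ultimately show "(\<lambda>n. q n x) \<longlonglongrightarrow> D\<phi> x $ i" by simp
    qed
    show "AE x in lborel. norm (q n x) \<le> B * indicator (cball 0 (R + 1)) x" for n
    proof (rule AE_I2)
      fix x
      define t where "t = 1 / real (Suc n)"
      have t: "0 < t" "t \<le> 1" by (auto simp: t_def)
      show "norm (q n x) \<le> B * indicator (cball 0 (R + 1)) x"
      proof (cases "x \<in> cball 0 (R + 1)")
        case True
        have "norm (q n x) = real (Suc n) * \<bar>\<phi> (x + t *\<^sub>R e) - \<phi> x\<bar>"
          by (simp add: q_def t_def abs_mult)
        also have "\<dots> \<le> real (Suc n) * (B * \<bar>t\<bar>)" by (intro mult_left_mono lip) auto
        also have "\<dots> = B" by (simp add: t_def)
        finally show ?thesis using True by simp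
      next
        case False
        have "norm (t *\<^sub>R e) \<le> 1" using t by (simp add: e_def)
        then have "R < norm (x + t *\<^sub>R e)"
          using False norm_triangle_ineq4[of "x + t *\<^sub>R e" "t *\<^sub>R e"] by simp
        moreover have "R < norm x" using False by simp
        ultimately have "x + t *\<^sub>R e \<notin> C" "x \<notin> C" using R[of x] R[of "x + t *\<^sub>R e"] by auto
        then show ?thesis using False C(3) by (simp add: q_def t_def)
      qed
    qed
    show "integrable lborel (\<lambda>x. B * indicator (cball 0 (R + 1)) x :: real)"
      by (intro integrable_mult_right integrable_real_indicator) (use emeasure_bounded_finite[OF bounded_cball] in auto)
  qed (unfold q_def, measurable)
  then have "(\<integral>x. D\<phi> x $ i \<partial>lborel) = 0"
    using \<open>\<And>n. (\<integral>x. q n x \<partial>lborel) = 0\<close> by (simp add: LIMSEQ_const_iff)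
  moreover have "integral\<^sup>L (lebesgue_on \<Omega>) (\<lambda>x. D\<phi> x $ i) = (\<integral>x. indicator \<Omega> x *\<^sub>R (D\<phi> x $ i) \<partial>lebesgue)"
    by (rule integral_restrict_space) (use \<open>open \<Omega>\<close> in auto)
  moreover have "(\<lambda>x. indicator \<Omega> x *\<^sub>R (D\<phi> x $ i)) = (\<lambda>x. D\<phi> x $ i)"
    using C(2) C(4) by (intro ext) (force simp: indicator_def)
  ultimately show ?thesis by (simp add: integral_completion)
qed

text \<open>\<open>h\<close> is regular only inside \<Omega>, hence the extension by 0. The open
  sets \<Omega> and the complement of the support cover the plane: on the former the product rule
  applies, on the latter everything vanishes.\<close>

lemma Cc1_mult:
  assumes \<phi>: "Cc1 \<Omega> \<phi> D\<phi>" and "open \<Omega>"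
    and h: "\<And>x. x \<in> \<Omega> \<Longrightarrow> (h has_derivative (\<lambda>v. D x \<bullet> v)) (at x)" and D: "continuous_on \<Omega> D"
  shows "Cc1 \<Omega> (\<lambda>x. if x \<in> \<Omega> then h x * \<phi> x else 0)
     (\<lambda>x. if x \<in> \<Omega> then h x *\<^sub>R D\<phi> x + \<phi> x *\<^sub>R D x else 0)" (is "Cc1 \<Omega> ?f ?Df")
proof -
  obtain C where C: "compact C" "C \<subseteq> \<Omega>" "\<And>x. x \<notin> C \<Longrightarrow> \<phi> x = 0" "\<And>x. x \<notin> C \<Longrightarrow> D\<phi> x = 0"
    using Cc1_support[OF \<phi>] by blast
  have openC: "open (- C)" using C(1) by (simp add: compact_imp_closed open_Compl)
  have f0: "?f x = 0" "?Df x = 0" if "x \<notin> C" for x using C that by auto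
  have cover: "\<Omega> \<union> - C = UNIV" using C(2) by auto
  have h_cont: "continuous_on \<Omega> h"
    using h by (meson continuous_at_imp_continuous_on has_derivative_continuous)
  have "continuous_on (\<Omega> \<union> - C) ?Df"
  proof (rule continuous_on_open_Un[OF \<open>open \<Omega>\<close> openC])
    have "continuous_on \<Omega> (\<lambda>x. h x *\<^sub>R D\<phi> x + \<phi> x *\<^sub>R D x)"
      by (intro continuous_intros h_cont D Cc1_continuous[OF \<phi>])
    then show "continuous_on \<Omega> ?Df" by (rule continuous_on_eq) auto
    show "continuous_on (- C) ?Df"
      by (rule continuous_on_eq[OF continuous_on_const[of _ 0]]) (use f0 in auto)
  qed
  moreover have "(?f has_derivative (\<lambda>v. ?Df x \<bullet> v)) (at x)" for x
  proof (cases "x \<in> \<Omega>")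
    case True
    have "(\<phi> has_derivative (\<lambda>v. D\<phi> x \<bullet> v)) (at x)" using \<phi> by (simp add: Cc1_def)
    with h[OF True] have "((\<lambda>x. h x * \<phi> x) has_derivative (\<lambda>v. h x * (D\<phi> x \<bullet> v) + (D x \<bullet> v) * \<phi> x)) (at x)"
      by (rule has_derivative_mult)
    then have "(?f has_derivative (\<lambda>v. h x * (D\<phi> x \<bullet> v) + (D x \<bullet> v) * \<phi> x)) (at x)"
      by (rule has_derivative_transform_within_open[OF _ \<open>open \<Omega>\<close> True]) auto
    moreover have "(\<lambda>v. h x * (D\<phi> x \<bullet> v) + (D x \<bullet> v) * \<phi> x) = (\<lambda>v. ?Df x \<bullet> v)"
      using True by (auto simp: inner_add_left)
    ultimately show ?thesis by simp
  next
    case False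
    then have x: "x \<in> - C" using C(2) by auto
    have "((\<lambda>y. 0) has_derivative (\<lambda>v. 0)) (at x)" by simp
    then have "(?f has_derivative (\<lambda>v. 0)) (at x)"
      by (rule has_derivative_transform_within_open[OF _ openC x]) (use f0 in auto)
    then show ?thesis using False by simp
  qed
  ultimately show ?thesis using C(1,2) f0 unfolding Cc1_def cover by blast
qed

section \<open>Integration by parts and the Poincare inequality for test functions\<close>

lemma open_lmeasurable:
  "open \<Omega> \<Longrightarrow> bounded \<Omega> \<Longrightarrow> \<Omega> \<in> lmeasurable" for \<Omega> :: "'a::euclidean_space set"
  by (intro bounded_set_imp_lmeasurable) auto

text \<open>Continuity on an open set allows blow-up at the boundary; the compact support makes
  \<open>f\<close> bounded, and \<Omega> has finite measure.\<close>

lemma integrable_compact_support: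
  fixes f :: "'a::euclidean_space \<Rightarrow> real"
  assumes "open \<Omega>" "bounded \<Omega>" "continuous_on \<Omega> f" "compact C" "C \<subseteq> \<Omega>" "\<And>x. x \<notin> C \<Longrightarrow> f x = 0"
  shows "integrable (lebesgue_on \<Omega>) f"
proof -
  interpret finite_measure "lebesgue_on \<Omega>"
    by (intro finite_measure_lebesgue_on open_lmeasurable assms)
  have "bounded (f ` C)"
    by (intro compact_imp_bounded compact_continuous_image continuous_on_subset[OF assms(3)] assms)
  then obtain B where "\<And>x. x \<in> C \<Longrightarrow> norm (f x) \<le> B" "0 < B"
    unfolding bounded_pos by auto
  then have "norm (f x) \<le> B" for x using assms(6)[of x] by (cases "x \<in> C") auto
  then show ?thesis
    by (intro integrable_const_bound[of _ B] AE_I2 continuous_imp_measurable_on_sets_lebesgue assms)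
       (use assms in auto)
qed

lemma Cc1_sqint:
  assumes "Cc1 \<Omega> \<phi> D\<phi>" "open \<Omega>" "bounded \<Omega>"
  shows "sqint (lebesgue_on \<Omega>) \<phi>" "sqint (lebesgue_on \<Omega>) D\<phi>"
proof -
  obtain C where C: "compact C" "C \<subseteq> \<Omega>" "\<And>x. x \<notin> C \<Longrightarrow> \<phi> x = 0" "\<And>x. x \<notin> C \<Longrightarrow> D\<phi> x = 0"
    using Cc1_support[OF assms(1)] by blast
  have "integrable (lebesgue_on \<Omega>) (\<lambda>x. (norm (\<phi> x))^2)" "integrable (lebesgue_on \<Omega>) (\<lambda>x. (norm (D\<phi> x))^2)"
    by (rule integrable_compact_support[OF assms(2,3) _ C(1,2)],
        use C in \<open>auto intro!: continuous_intros Cc1_continuous[OF assms(1)]\<close>)+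
  moreover have "\<phi> \<in> borel_measurable (lebesgue_on \<Omega>)" "D\<phi> \<in> borel_measurable (lebesgue_on \<Omega>)"
    by (rule continuous_imp_measurable_on_sets_lebesgue, rule Cc1_continuous[OF assms(1)],
        use assms(2) in \<open>auto simp: borel_open\<close>)+
  ultimately show "sqint (lebesgue_on \<Omega>) \<phi>" "sqint (lebesgue_on \<Omega>) D\<phi>"
    by (auto simp: sqint_def)
qed

text \<open>The product \<open>h \<phi>\<close>, extended by 0, is a test function, so the integral
  of its partial derivative is 0.\<close>

lemma Cc1_integral_by_parts:
  assumes \<phi>: "Cc1 \<Omega> \<phi> D\<phi>" and \<Omega>: "open \<Omega>" "bounded \<Omega>"
    and h: "\<And>x. x \<in> \<Omega> \<Longrightarrow> (h has_derivative (\<lambda>v. D x \<bullet> v)) (at x)" and D: "continuous_on \<Omega> D"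
  shows "(\<integral>x. h x * D\<phi> x $ i \<partial>lebesgue_on \<Omega>) = - (\<integral>x. D x $ i * \<phi> x \<partial>lebesgue_on \<Omega>)"
proof -
  obtain C where C: "compact C" "C \<subseteq> \<Omega>" "\<And>x. x \<notin> C \<Longrightarrow> \<phi> x = 0" "\<And>x. x \<notin> C \<Longrightarrow> D\<phi> x = 0"
    using Cc1_support[OF \<phi>] by blast
  have h_cont: "continuous_on \<Omega> h"
    using h by (meson continuous_at_imp_continuous_on has_derivative_continuous)
  have int: "integrable (lebesgue_on \<Omega>) (\<lambda>x. h x * D\<phi> x $ i)" "integrable (lebesgue_on \<Omega>) (\<lambda>x. D x $ i * \<phi> x)"
    by (rule integrable_compact_support[OF \<Omega> _ C(1,2)],
        use C in \<open>auto intro!: continuous_intros Cc1_continuous[OF \<phi>] h_cont D\<close>)+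
  have "0 = (\<integral>x. (if x \<in> \<Omega> then h x *\<^sub>R D\<phi> x + \<phi> x *\<^sub>R D x else 0) $ i \<partial>lebesgue_on \<Omega>)"
    by (rule integral_Cc1_deriv_eq_0[OF Cc1_mult[OF \<phi> \<Omega>(1) h D] \<Omega>(1), symmetric])
  also have "\<dots> = (\<integral>x. h x * D\<phi> x $ i + D x $ i * \<phi> x \<partial>lebesgue_on \<Omega>)"
    by (intro Bochner_Integration.integral_cong) auto
  also have "\<dots> = (\<integral>x. h x * D\<phi> x $ i \<partial>lebesgue_on \<Omega>) + (\<integral>x. D x $ i * \<phi> x \<partial>lebesgue_on \<Omega>)"
    using int by simp
  finally show ?thesis by simp
qed

text \<open>Integrate \<open>x\<^sub>1 \<partial>\<^sub>1(\<phi>^2)\<close> by parts.\<close>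

lemma Cc1_poincare:
  assumes \<phi>: "Cc1 \<Omega> \<phi> D\<phi>" and \<Omega>: "open \<Omega>" "bounded \<Omega>" and R: "\<And>x. x \<in> \<Omega> \<Longrightarrow> norm x \<le> R"
  shows "L2norm (lebesgue_on \<Omega>) \<phi> \<le> 2 * R * L2norm (lebesgue_on \<Omega>) D\<phi>"
\<comment> \<open>The argument ends with a division by the norm of \<open>\<phi>\<close>; a point of
  \<Omega> is needed to know \<open>0 \<le> R\<close>.\<close>
proof (cases "L2norm (lebesgue_on \<Omega>) \<phi> = 0 \<or> \<Omega> = {}")
  case True
  show ?thesis
  proof (cases "\<Omega> = {}")
    case True
    then show ?thesis by (simp add: L2norm_def Bochner_Integration.integral_empty)
  next
    case False
    then have "0 \<le> R" using R norm_ge_zero order_trans by blast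
    then show ?thesis using True False by (simp add: L2norm_nonneg)
  qed
next
  case False
  let ?M = "lebesgue_on \<Omega>"
  note sq = Cc1_sqint[OF \<phi> \<Omega>]
  have mx: "(\<lambda>x::real^2. x $ 1) \<in> borel_measurable ?M"
    by (rule continuous_imp_measurable_on_sets_lebesgue) (use \<Omega> in \<open>auto intro!: continuous_intros\<close>)
  have sq1: "sqint ?M (\<lambda>x. D\<phi> x $ 1)" using sq sqint_vec by blast
  have x1: "\<bar>x $ 1\<bar> \<le> R" if "x \<in> space ?M" for x
    using R[of x] component_le_norm_cart[of x 1] that by simp
  note sqx = sqint_bounded_mult[OF sq1 mx x1]
  have "(\<integral>x. (x $ 1 * \<phi> x) * D\<phi> x $ 1 \<partial>?M) = - (\<integral>x. (\<phi> x *\<^sub>R axis 1 1 + x $ 1 *\<^sub>R D\<phi> x) $ 1 * \<phi> x \<partial>?M)"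
  proof (rule Cc1_integral_by_parts[OF \<phi> \<Omega>])
    fix x assume "x \<in> \<Omega>"
    have "((\<lambda>x::real^2. x $ 1) has_derivative (\<lambda>v. v $ 1)) (at x)"
      by (rule bounded_linear_imp_has_derivative) (rule bounded_linear_vec_nth)
    moreover have "(\<phi> has_derivative (\<lambda>v. D\<phi> x \<bullet> v)) (at x)" using \<phi> by (simp add: Cc1_def)
    ultimately show "((\<lambda>x. x $ 1 * \<phi> x) has_derivative (\<lambda>v. (\<phi> x *\<^sub>R axis 1 1 + x $ 1 *\<^sub>R D\<phi> x) \<bullet> v)) (at x)"
      by (rule has_derivative_eq_rhs[OF has_derivative_mult]) (auto simp: inner_add_left inner_axis' algebra_simps)
  qed (intro continuous_intros Cc1_continuous[OF \<phi>])
  moreover have "(\<integral>x. (\<phi> x *\<^sub>R axis 1 1 + x $ 1 *\<^sub>R D\<phi> x) $ 1 * \<phi> x \<partial>?M)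
      = (\<integral>x. \<phi> x \<bullet> \<phi> x + \<phi> x \<bullet> (x $ 1 *\<^sub>R (D\<phi> x $ 1)) \<partial>?M)"
    by (intro Bochner_Integration.integral_cong) (auto simp: algebra_simps)
  moreover have "\<dots> = ip ?M \<phi> \<phi> + ip ?M \<phi> (\<lambda>x. x $ 1 *\<^sub>R (D\<phi> x $ 1))"
    unfolding ip_def by (intro Bochner_Integration.integral_add sqint_inner_integrable sq sqx)
  moreover have "(\<integral>x. (x $ 1 * \<phi> x) * D\<phi> x $ 1 \<partial>?M) = ip ?M \<phi> (\<lambda>x. x $ 1 *\<^sub>R (D\<phi> x $ 1))"
    unfolding ip_def by (intro Bochner_Integration.integral_cong) (auto simp: algebra_simps)
  ultimately have "ip ?M \<phi> \<phi> = - 2 * ip ?M \<phi> (\<lambda>x. x $ 1 *\<^sub>R (D\<phi> x $ 1))" by simp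
  also have "\<dots> \<le> 2 * (L2norm ?M \<phi> * L2norm ?M (\<lambda>x. x $ 1 *\<^sub>R (D\<phi> x $ 1)))"
    using ip_Cauchy_Schwarz[OF sq(1) sqx(1)] by simp
  also have "\<dots> \<le> 2 * (L2norm ?M \<phi> * (R * L2norm ?M (\<lambda>x. D\<phi> x $ 1)))"
    using sqx(2) by (intro mult_left_mono) (auto simp: L2norm_nonneg)
  also have "\<dots> \<le> 2 * (L2norm ?M \<phi> * (R * L2norm ?M D\<phi>))"
  proof -
    have "0 \<le> R" using False R norm_ge_zero order_trans by blast
    moreover have "L2norm ?M (\<lambda>x. D\<phi> x $ 1) \<le> L2norm ?M D\<phi>"
      unfolding L2norm_def using sq sq1
      by (intro real_sqrt_le_mono integral_mono) (auto simp: sqint_def norm_vec2_power2)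
    ultimately show ?thesis by (intro mult_left_mono) (auto simp: L2norm_nonneg)
  qed
  finally have "L2norm ?M \<phi> * L2norm ?M \<phi> \<le> L2norm ?M \<phi> * (2 * R * L2norm ?M D\<phi>)"
    by (simp add: ip_self power2_eq_square algebra_simps)
  then show ?thesis
    using False L2norm_nonneg[of ?M \<phi>] by (simp add: mult_le_cancel_left)
qed

section \<open>The space \<open>H\<^sup>1\<^sub>0\<close>\<close>

text \<open>The weak gradient condition follows from the approximation: integration by parts holds
  for the approximating test functions and passes to the limit. What remains is convergence in norm
  of functions and gradients separately.\<close>

lemma H10_iff:
  assumes \<Omega>: "open \<Omega>" "bounded \<Omega>"
  shows "H10 \<Omega> u g \<longleftrightarrow> sqint (lebesgue_on \<Omega>) u \<and> sqint (lebesgue_on \<Omega>) g \<and>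
    (\<exists>\<phi> D\<phi>. (\<forall>n. Cc1 \<Omega> (\<phi> n) (D\<phi> n)) \<and>
       (\<lambda>n. L2norm (lebesgue_on \<Omega>) (\<lambda>x. \<phi> n x - u x)) \<longlonglongrightarrow> 0 \<and>
       (\<lambda>n. L2norm (lebesgue_on \<Omega>) (\<lambda>x. D\<phi> n x - g x)) \<longlonglongrightarrow> 0)"
    (is "_ \<longleftrightarrow> sqint ?M u \<and> sqint ?M g \<and> ?approx")
proof -
  have eq: "(\<lambda>n. integral\<^sup>L ?M (\<lambda>x. (u x - \<phi> n x)^2 + (norm (g x - D\<phi> n x))^2)) \<longlonglongrightarrow> 0 \<longleftrightarrow>
      (\<lambda>n. L2norm ?M (\<lambda>x. \<phi> n x - u x)) \<longlonglongrightarrow> 0 \<and> (\<lambda>n. L2norm ?M (\<lambda>x. D\<phi> n x - g x)) \<longlonglongrightarrow> 0"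
    if sq: "sqint ?M u" "sqint ?M g" and \<phi>: "\<And>n. Cc1 \<Omega> (\<phi> n) (D\<phi> n)" for \<phi> D\<phi>
  proof -
    let ?a = "\<lambda>n. L2norm ?M (\<lambda>x. \<phi> n x - u x)" and ?b = "\<lambda>n. L2norm ?M (\<lambda>x. D\<phi> n x - g x)"
    have *: "integral\<^sup>L ?M (\<lambda>x. (u x - \<phi> n x)^2 + (norm (g x - D\<phi> n x))^2) = (?a n)^2 + (?b n)^2" for n
      using sqint_diff[OF sq(1) Cc1_sqint(1)[OF \<phi>[of n] \<Omega>]] sqint_diff[OF sq(2) Cc1_sqint(2)[OF \<phi>[of n] \<Omega>]]
      by (subst Bochner_Integration.integral_add)
         (auto simp: sqint_def L2norm_power2 norm_minus_commute power2_commute)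
    show ?thesis unfolding *
    proof (intro iffI conjI; (elim conjE)?)
      assume lim: "(\<lambda>n. (?a n)^2 + (?b n)^2) \<longlonglongrightarrow> 0"
      have "(\<lambda>n. (?a n)^2) \<longlonglongrightarrow> 0" "(\<lambda>n. (?b n)^2) \<longlonglongrightarrow> 0"
        by (rule tendsto_sandwich[OF _ _ tendsto_const lim]; simp)+
      then show "?a \<longlonglongrightarrow> 0" "?b \<longlonglongrightarrow> 0" using tendsto_real_sqrt by (auto simp: L2norm_nonneg dest!: tendsto_real_sqrt)
    qed (auto intro!: tendsto_eq_intros)
  qed
  have wg: "weak_grad \<Omega> u g" if sq: "sqint ?M u" "sqint ?M g" and \<phi>: "\<And>n. Cc1 \<Omega> (\<phi> n) (D\<phi> n)"
    and lim: "(\<lambda>n. L2norm ?M (\<lambda>x. \<phi> n x - u x)) \<longlonglongrightarrow> 0" "(\<lambda>n. L2norm ?M (\<lambda>x. D\<phi> n x - g x)) \<longlonglongrightarrow> 0"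
    for \<phi> D\<phi>
    unfolding weak_grad_def L2_on_iff_sqint
  proof (intro conjI allI impI)
    show "sqint ?M u" "sqint ?M (\<lambda>x. g x $ i)" for i using sq sqint_vec by blast+
    fix \<psi> D\<psi> i assume \<psi>: "Cc1 \<Omega> \<psi> D\<psi>"
    have s1: "sqint ?M (\<lambda>x. D\<psi> x $ i)" using Cc1_sqint[OF \<psi> \<Omega>] sqint_vec by blast
    have s2: "sqint ?M (\<lambda>x. \<psi> x *\<^sub>R (axis i 1 :: real^2))"
      using Cc1_sqint[OF \<psi> \<Omega>] by (auto simp: sqint_def)
    have "(\<lambda>n. ip ?M (\<phi> n) (\<lambda>x. D\<psi> x $ i)) \<longlonglongrightarrow> ip ?M u (\<lambda>x. D\<psi> x $ i)"
      by (rule ip_tendsto) (use s1 sq Cc1_sqint[OF \<phi> \<Omega>] lim in auto)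
    moreover have "(\<lambda>n. - ip ?M (D\<phi> n) (\<lambda>x. \<psi> x *\<^sub>R axis i 1)) \<longlonglongrightarrow> - ip ?M g (\<lambda>x. \<psi> x *\<^sub>R axis i 1)"
      by (rule tendsto_minus, rule ip_tendsto) (use s2 sq Cc1_sqint[OF \<phi> \<Omega>] lim in auto)
    moreover have "ip ?M (\<phi> n) (\<lambda>x. D\<psi> x $ i) = - ip ?M (D\<phi> n) (\<lambda>x. \<psi> x *\<^sub>R axis i 1)" for n
      using Cc1_integral_by_parts[OF \<psi> \<Omega> _ Cc1_continuous(2)[OF \<phi>], of "\<phi> n" n i] \<phi>[of n]
      by (simp add: ip_def Cc1_def inner_axis mult.commute)
    ultimately have "ip ?M u (\<lambda>x. D\<psi> x $ i) = - ip ?M g (\<lambda>x. \<psi> x *\<^sub>R axis i 1)"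
      using LIMSEQ_unique by simp
    then show "(\<integral>x. u x * D\<psi> x $ i \<partial>?M) = - (\<integral>x. g x $ i * \<psi> x \<partial>?M)"
      by (simp add: ip_def inner_axis mult.commute)
  qed
  show ?thesis
  proof
    assume "H10 \<Omega> u g"
    then have H: "weak_grad \<Omega> u g" "\<exists>\<phi> D\<phi>. (\<forall>n. Cc1 \<Omega> (\<phi> n) (D\<phi> n)) \<and>
        (\<lambda>n. integral\<^sup>L ?M (\<lambda>x. (u x - \<phi> n x)^2 + (norm (g x - D\<phi> n x))^2)) \<longlonglongrightarrow> 0"
      by (auto simp: H10_def)
    then have sq: "sqint ?M u" "sqint ?M g"
      by (auto simp: weak_grad_def L2_on_iff_sqint sqint_vec[of _ g])
    then show "sqint ?M u \<and> sqint ?M g \<and> ?approx" using H(2) eq by blast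
  next
    assume H: "sqint ?M u \<and> sqint ?M g \<and> ?approx"
    then obtain \<phi> D\<phi> where \<phi>: "\<And>n. Cc1 \<Omega> (\<phi> n) (D\<phi> n)"
       "(\<lambda>n. L2norm ?M (\<lambda>x. \<phi> n x - u x)) \<longlonglongrightarrow> 0" "(\<lambda>n. L2norm ?M (\<lambda>x. D\<phi> n x - g x)) \<longlonglongrightarrow> 0" by blast
    then show "H10 \<Omega> u g" unfolding H10_def using wg eq H by blast
  qed
qed

section \<open>Linear structure and closedness of \<open>H10\<close> and of the cone
  \<open>inK\<close>\<close>

lemma tendsto_0_norm_le:
  fixes f g :: "nat \<Rightarrow> real"
  assumes "\<And>n. 0 \<le> f n" "\<And>n. f n \<le> g n" "g \<longlonglongrightarrow> 0"
  shows "f \<longlonglongrightarrow> 0"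
  by (rule tendsto_sandwich[OF _ _ tendsto_const assms(3)]) (use assms in auto)

locale bounded_domain =
  fixes \<Omega> :: "(real^2) set" and M :: "(real^2) measure"
  defines "M \<equiv> lebesgue_on \<Omega>"
  assumes \<Omega>: "open \<Omega>" "bounded \<Omega>"
begin

lemma finite_measure_M: "finite_measure M"
  unfolding M_def by (intro finite_measure_lebesgue_on open_lmeasurable \<Omega>)

lemma space_M: "space M = \<Omega>" by (simp add: M_def)

lemmas H10_iff' = H10_iff[OF \<Omega>, folded M_def]

lemma H10_sqint: "H10 \<Omega> u g \<Longrightarrow> sqint M u" "H10 \<Omega> u g \<Longrightarrow> sqint M g"
  by (auto simp: H10_iff')

lemma H10_Cc1: "Cc1 \<Omega> \<phi> D\<phi> \<Longrightarrow> H10 \<Omega> \<phi> D\<phi>"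
  unfolding H10_iff' using Cc1_sqint[OF _ \<Omega>, folded M_def]
  by (auto intro!: exI[of _ "\<lambda>_. \<phi>"] exI[of _ "\<lambda>_. D\<phi>"] simp: L2norm_def)

lemma Cc1_lincomb:
  assumes "Cc1 \<Omega> \<phi> D\<phi>" "Cc1 \<Omega> \<psi> D\<psi>"
  shows "Cc1 \<Omega> (\<lambda>x. a * \<phi> x + b * \<psi> x) (\<lambda>x. a *\<^sub>R D\<phi> x + b *\<^sub>R D\<psi> x)"
proof -
  obtain C where C: "compact C" "C \<subseteq> \<Omega>" "\<forall>x. x \<notin> C \<longrightarrow> \<phi> x = 0" using assms by (auto simp: Cc1_def)
  obtain C' where C': "compact C'" "C' \<subseteq> \<Omega>" "\<forall>x. x \<notin> C' \<longrightarrow> \<psi> x = 0" using assms by (auto simp: Cc1_def)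
  have d: "(\<phi> has_derivative (\<lambda>v. D\<phi> x \<bullet> v)) (at x)" "(\<psi> has_derivative (\<lambda>v. D\<psi> x \<bullet> v)) (at x)" for x
    using assms by (auto simp: Cc1_def)
  show ?thesis unfolding Cc1_def
  proof (intro conjI allI)
    show "((\<lambda>x. a * \<phi> x + b * \<psi> x) has_derivative (\<lambda>v. (a *\<^sub>R D\<phi> x + b *\<^sub>R D\<psi> x) \<bullet> v)) (at x)" for x
      by (rule has_derivative_eq_rhs[OF has_derivative_add[OF has_derivative_mult_right[OF d(1)] has_derivative_mult_right[OF d(2)]]])
         (auto simp: inner_add_left)
    show "\<exists>C. compact C \<and> C \<subseteq> \<Omega> \<and> (\<forall>x. x \<notin> C \<longrightarrow> a * \<phi> x + b * \<psi> x = 0)"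
      by (rule exI[of _ "C \<union> C'"]) (use C C' in \<open>auto intro: compact_Un\<close>)
  qed (intro continuous_intros Cc1_continuous[OF assms(1)] Cc1_continuous[OF assms(2)])
qed

lemma L2norm_lincomb_diff_le:
  assumes "sqint M f" "sqint M g" "sqint M f'" "sqint M g'"
  shows "L2norm M (\<lambda>x. (a *\<^sub>R f x + b *\<^sub>R g x) - (a *\<^sub>R f' x + b *\<^sub>R g' x))
    \<le> \<bar>a\<bar> * L2norm M (\<lambda>x. f x - f' x) + \<bar>b\<bar> * L2norm M (\<lambda>x. g x - g' x)"
proof -
  have "(\<lambda>x. (a *\<^sub>R f x + b *\<^sub>R g x) - (a *\<^sub>R f' x + b *\<^sub>R g' x)) =
      (\<lambda>x. a *\<^sub>R (f x - f' x) + b *\<^sub>R (g x - g' x))" by (auto simp: algebra_simps)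
  then show ?thesis
    using L2norm_triangle[OF sqint_scaleR[OF sqint_diff[OF assms(1,3)], of a] sqint_scaleR[OF sqint_diff[OF assms(2,4)], of b]]
    by (simp add: L2norm_scaleR)
qed

lemma H10_lincomb:
  assumes "H10 \<Omega> u g" "H10 \<Omega> v h"
  shows "H10 \<Omega> (\<lambda>x. a * u x + b * v x) (\<lambda>x. a *\<^sub>R g x + b *\<^sub>R h x)"
proof -
  obtain \<phi> D\<phi> where 1: "\<And>n. Cc1 \<Omega> (\<phi> n) (D\<phi> n)"
     "(\<lambda>n. L2norm M (\<lambda>x. \<phi> n x - u x)) \<longlonglongrightarrow> 0" "(\<lambda>n. L2norm M (\<lambda>x. D\<phi> n x - g x)) \<longlonglongrightarrow> 0"
    using assms(1) unfolding H10_iff' by blast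
  obtain \<psi> D\<psi> where 2: "\<And>n. Cc1 \<Omega> (\<psi> n) (D\<psi> n)"
     "(\<lambda>n. L2norm M (\<lambda>x. \<psi> n x - v x)) \<longlonglongrightarrow> 0" "(\<lambda>n. L2norm M (\<lambda>x. D\<psi> n x - h x)) \<longlonglongrightarrow> 0"
    using assms(2) unfolding H10_iff' by blast
  note sq = H10_sqint[OF assms(1)] H10_sqint[OF assms(2)]
    Cc1_sqint[OF 1(1) \<Omega>, folded M_def] Cc1_sqint[OF 2(1) \<Omega>, folded M_def]
  have "(\<lambda>n. L2norm M (\<lambda>x. (a *\<^sub>R \<phi> n x + b *\<^sub>R \<psi> n x) - (a *\<^sub>R u x + b *\<^sub>R v x))) \<longlonglongrightarrow> 0"
    by (rule tendsto_0_norm_le[OF L2norm_nonneg L2norm_lincomb_diff_le])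
       (use sq in \<open>auto intro!: tendsto_eq_intros 1 2\<close>)
  moreover have "(\<lambda>n. L2norm M (\<lambda>x. (a *\<^sub>R D\<phi> n x + b *\<^sub>R D\<psi> n x) - (a *\<^sub>R g x + b *\<^sub>R h x))) \<longlonglongrightarrow> 0"
    by (rule tendsto_0_norm_le[OF L2norm_nonneg L2norm_lincomb_diff_le])
       (use sq in \<open>auto intro!: tendsto_eq_intros 1 2\<close>)
  moreover have "sqint M (\<lambda>x. a *\<^sub>R u x + b *\<^sub>R v x)" "sqint M (\<lambda>x. a *\<^sub>R g x + b *\<^sub>R h x)"
    by (intro sqint_add sqint_scaleR sq)+
  ultimately show ?thesis unfolding H10_iff'
    using Cc1_lincomb[OF 1(1) 2(1), of a _ b] by fastforce
qed

text \<open>Each \<open>(u n, g n)\<close> is replaced by a test function within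
  \<open>1 / (n + 1)\<close> of it. Function and gradient are chosen together as one pair
  \<open>p n\<close>.\<close>

lemma H10_closed:
  assumes H: "\<And>n. H10 \<Omega> (u n) (g n)" and sq: "sqint M v" "sqint M h"
    and lim: "(\<lambda>n. L2norm M (\<lambda>x. u n x - v x)) \<longlonglongrightarrow> 0" "(\<lambda>n. L2norm M (\<lambda>x. g n x - h x)) \<longlonglongrightarrow> 0"
  shows "H10 \<Omega> v h"
proof -
  have "\<exists>\<phi> D\<phi>. Cc1 \<Omega> \<phi> D\<phi> \<and> L2norm M (\<lambda>x. \<phi> x - u n x) < inverse (real (Suc n))
      \<and> L2norm M (\<lambda>x. D\<phi> x - g n x) < inverse (real (Suc n))" for n
  proof -
    obtain \<phi> D\<phi> where 1: "\<And>k. Cc1 \<Omega> (\<phi> k) (D\<phi> k)"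
       "(\<lambda>k. L2norm M (\<lambda>x. \<phi> k x - u n x)) \<longlonglongrightarrow> 0" "(\<lambda>k. L2norm M (\<lambda>x. D\<phi> k x - g n x)) \<longlonglongrightarrow> 0"
      using H[of n] unfolding H10_iff' by blast
    have "\<forall>\<^sub>F k in sequentially. L2norm M (\<lambda>x. \<phi> k x - u n x) < inverse (real (Suc n))
        \<and> L2norm M (\<lambda>x. D\<phi> k x - g n x) < inverse (real (Suc n))"
      by (intro eventually_conj order_tendstoD(2)[OF 1(2)] order_tendstoD(2)[OF 1(3)]) auto
    then obtain k where "L2norm M (\<lambda>x. \<phi> k x - u n x) < inverse (real (Suc n))
        \<and> L2norm M (\<lambda>x. D\<phi> k x - g n x) < inverse (real (Suc n))"
      using eventually_happens by fastforce
    then show ?thesis using 1(1) by blast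
  qed
  then have "\<forall>n. \<exists>p. Cc1 \<Omega> (fst p) (snd p) \<and> L2norm M (\<lambda>x. fst p x - u n x) < inverse (real (Suc n))
      \<and> L2norm M (\<lambda>x. snd p x - g n x) < inverse (real (Suc n))" by simp
  from choice[OF this] obtain p where p: "\<forall>n. Cc1 \<Omega> (fst (p n)) (snd (p n)) \<and>
      L2norm M (\<lambda>x. fst (p n) x - u n x) < inverse (real (Suc n)) \<and>
      L2norm M (\<lambda>x. snd (p n) x - g n x) < inverse (real (Suc n))" by blast
  define \<phi> where "\<phi> n = fst (p n)" for n
  define D\<phi> where "D\<phi> n = snd (p n)" for n
  have \<phi>: "Cc1 \<Omega> (\<phi> n) (D\<phi> n)" and close: "L2norm M (\<lambda>x. \<phi> n x - u n x) < inverse (real (Suc n))"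
      "L2norm M (\<lambda>x. D\<phi> n x - g n x) < inverse (real (Suc n))" for n
    using p by (auto simp: \<phi>_def D\<phi>_def)
  note sqs = Cc1_sqint[OF \<phi> \<Omega>, folded M_def] H10_sqint[OF H] sq
  have "(\<lambda>n. inverse (real (Suc n)) + L2norm M (\<lambda>x. u n x - v x)) \<longlonglongrightarrow> 0"
      "(\<lambda>n. inverse (real (Suc n)) + L2norm M (\<lambda>x. g n x - h x)) \<longlonglongrightarrow> 0"
    using tendsto_add[OF LIMSEQ_inverse_real_of_nat lim(1)] tendsto_add[OF LIMSEQ_inverse_real_of_nat lim(2)] by auto
  note lim' = this
  have le1: "L2norm M (\<lambda>x. \<phi> n x - v x) \<le> inverse (real (Suc n)) + L2norm M (\<lambda>x. u n x - v x)" for n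
    using L2norm_triangle_diff[OF sqs(1)[of n] sqs(3)[of n] sqs(5)] close(1)[of n] by linarith
  have le2: "L2norm M (\<lambda>x. D\<phi> n x - h x) \<le> inverse (real (Suc n)) + L2norm M (\<lambda>x. g n x - h x)" for n
    using L2norm_triangle_diff[OF sqs(2)[of n] sqs(4)[of n] sqs(6)] close(2)[of n] by linarith
  have "(\<lambda>n. L2norm M (\<lambda>x. \<phi> n x - v x)) \<longlonglongrightarrow> 0" "(\<lambda>n. L2norm M (\<lambda>x. D\<phi> n x - h x)) \<longlonglongrightarrow> 0"
    by (rule tendsto_0_norm_le[OF L2norm_nonneg le1 lim'(1)], rule tendsto_0_norm_le[OF L2norm_nonneg le2 lim'(2)])
  then show ?thesis unfolding H10_iff' using \<phi> sq by blast
qed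

text \<open>By density of test functions. The limit is taken in squared norms because these are
  inner products.\<close>

lemma ex_poincare: "\<exists>R>0. \<forall>u g. H10 \<Omega> u g \<longrightarrow> L2norm M u \<le> R * L2norm M g"
proof -
  obtain R where R: "0 < R" "\<And>x. x \<in> \<Omega> \<Longrightarrow> norm x \<le> R"
    using \<Omega>(2) unfolding bounded_pos by auto
  have "L2norm M u \<le> 2 * R * L2norm M g" if H: "H10 \<Omega> u g" for u g
  proof -
    obtain \<phi> D\<phi> where 1: "\<And>n. Cc1 \<Omega> (\<phi> n) (D\<phi> n)"
       "(\<lambda>n. L2norm M (\<lambda>x. \<phi> n x - u x)) \<longlonglongrightarrow> 0" "(\<lambda>n. L2norm M (\<lambda>x. D\<phi> n x - g x)) \<longlonglongrightarrow> 0"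
      using H unfolding H10_iff' by blast
    note sq = H10_sqint[OF H] Cc1_sqint[OF 1(1) \<Omega>, folded M_def]
    have lim: "(\<lambda>n. (L2norm M (\<phi> n))^2) \<longlonglongrightarrow> (L2norm M u)^2" "(\<lambda>n. (L2norm M (D\<phi> n))^2) \<longlonglongrightarrow> (L2norm M g)^2"
      unfolding ip_self[symmetric] by (intro ip_tendsto sq 1)+
    have "(L2norm M u)^2 \<le> (2 * R)^2 * (L2norm M g)^2"
    proof (rule LIMSEQ_le[OF lim(1) tendsto_mult[OF tendsto_const lim(2)]])
      show "\<exists>N. \<forall>n\<ge>N. (L2norm M (\<phi> n))^2 \<le> (2 * R)^2 * (L2norm M (D\<phi> n))^2"
        using power_mono[OF Cc1_poincare[OF 1(1) \<Omega> R(2), folded M_def] L2norm_nonneg, of _ 2]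
        by (auto simp: power_mult_distrib)
    qed
    then have "(L2norm M u)^2 \<le> (2 * R * L2norm M g)^2" by (simp add: power_mult_distrib)
    then show ?thesis by (rule power2_le_imp_le) (use R(1) in \<open>simp add: L2norm_nonneg\<close>)
  qed
  then show ?thesis using R(1) by (intro exI[of _ "2 * R"]) auto
qed

definition poincare_const :: real where
  "poincare_const = (SOME R. R > 0 \<and> (\<forall>u g. H10 \<Omega> u g \<longrightarrow> L2norm M u \<le> R * L2norm M g))"

lemma poincare: "0 < poincare_const" "H10 \<Omega> u g \<Longrightarrow> L2norm M u \<le> poincare_const * L2norm M g"
  using someI_ex[OF ex_poincare] unfolding poincare_const_def by blast+

lemma inK_lincomb:
  assumes "inK \<Omega> u g" "inK \<Omega> v h" "0 \<le> a" "0 \<le> b"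
  shows "inK \<Omega> (\<lambda>x. a * u x + b * v x) (\<lambda>x. a *\<^sub>R g x + b *\<^sub>R h x)"
  using assms H10_lincomb[of u g v h a b] unfolding inK_def
  by (auto elim!: eventually_elim2)

lemma inK_zero: "inK \<Omega> (\<lambda>x. 0) (\<lambda>x. 0)"
proof -
  have "Cc1 \<Omega> (\<lambda>x. 0) (\<lambda>x. 0)" by (auto simp: Cc1_def intro!: exI[of _ "{}"])
  then show ?thesis by (auto simp: inK_def intro: H10_Cc1)
qed

text \<open>Nonnegativity survives without pointwise convergence: since \<open>u n \<ge> 0\<close>,
  the negative part of \<open>v\<close> is bounded by \<open>\<bar>u n - v\<bar>\<close>, so its L2
  norm is 0.\<close>

lemma inK_closed:
  assumes K: "\<And>n. inK \<Omega> (u n) (g n)" and sq: "sqint M v" "sqint M h"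
    and lim: "(\<lambda>n. L2norm M (\<lambda>x. u n x - v x)) \<longlonglongrightarrow> 0" "(\<lambda>n. L2norm M (\<lambda>x. g n x - h x)) \<longlonglongrightarrow> 0"
  shows "inK \<Omega> v h"
proof -
  have H: "H10 \<Omega> (u n) (g n)" for n using K by (simp add: inK_def)
  have [measurable]: "v \<in> borel_measurable M" using sq by (simp add: sqint_def)
  let ?neg = "\<lambda>x. min 0 (v x)"
  have int: "integrable M (\<lambda>x. (?neg x)^2)"
    by (rule Bochner_Integration.integrable_bound[of M "\<lambda>x. (norm (v x))^2"])
       (use sq in \<open>auto simp: sqint_def min_def\<close>)
  have "(\<integral>x. (?neg x)^2 \<partial>M) \<le> (L2norm M (\<lambda>x. u n x - v x))^2" for n
    unfolding L2norm_power2
  proof (rule integral_mono_AE[OF int])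
    show "integrable M (\<lambda>x. (norm (u n x - v x))^2)"
      using sqint_diff[OF H10_sqint(1)[OF H] sq(1)] by (simp add: sqint_def)
    have "AE x in M. 0 \<le> u n x" using K[of n, unfolded inK_def, folded M_def] by simp
    then show "AE x in M. (?neg x)^2 \<le> (norm (u n x - v x))^2"
    proof eventually_elim
      fix x assume "0 \<le> u n x"
      then have "\<bar>?neg x\<bar> \<le> \<bar>u n x - v x\<bar>" by auto
      then show "(?neg x)^2 \<le> (norm (u n x - v x))^2"
        by (simp only: abs_le_square_iff real_norm_def power2_abs)
    qed
  qed
  moreover have "(\<lambda>n. (L2norm M (\<lambda>x. u n x - v x))^2) \<longlonglongrightarrow> 0" using lim(1) by (auto intro!: tendsto_eq_intros)
  ultimately have "(\<integral>x. (?neg x)^2 \<partial>M) \<le> 0" by (meson LIMSEQ_le_const)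
  then have "(\<integral>x. (?neg x)^2 \<partial>M) = 0" by (intro antisym integral_nonneg_AE) auto
  then have "AE x in M. (?neg x)^2 = 0" using integral_nonneg_eq_0_iff_AE[OF int] by simp
  then have "AE x in M. 0 \<le> v x" by eventually_elim (auto simp: min_def split: if_splits)
  then show ?thesis unfolding inK_def M_def[symmetric] using H10_closed[OF H sq lim] by simp
qed

end

section \<open>The variational inequality\<close>

locale gap_domain = bounded_domain +
  fixes h0 :: "real^2 \<Rightarrow> real" and H :: real
  assumes h0_measurable: "h0 \<in> borel_measurable M"
    and h0_bounds: "\<And>x. x \<in> \<Omega> \<Longrightarrow> 0 \<le> h0 x" "\<And>x. x \<in> \<Omega> \<Longrightarrow> h0 x \<le> H"
    and H_nonneg: "0 \<le> H"
begin

section \<open>Bilinear form, load and energy\<close>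

definition w :: "real \<Rightarrow> real^2 \<Rightarrow> real" where
  "w \<beta> x = (h0 x + \<beta>)^3"

definition A :: "real \<Rightarrow> (real^2 \<Rightarrow> real^2) \<Rightarrow> (real^2 \<Rightarrow> real^2) \<Rightarrow> real" where
  "A \<beta> g k = ip M (\<lambda>x. w \<beta> x *\<^sub>R g x) k"

text \<open>Paired with a gradient, this field gives the integral of \<open>h0\<close> times the
  first partial derivative.\<close>

definition wedge :: "real^2 \<Rightarrow> real^2" where
  "wedge x = h0 x *\<^sub>R axis 1 1"

definition load :: "real \<Rightarrow> (real^2 \<Rightarrow> real) \<Rightarrow> (real^2 \<Rightarrow> real^2) \<Rightarrow> real" where
  "load \<gamma> u g = ip M wedge g - \<gamma> * ip M (\<lambda>x. 1) u"

text \<open>The energy whose minimisers over the cone solve the variational inequality: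
  \<open>A \<beta>\<close> is symmetric, so the first variation at \<open>(q, g)\<close> in
  direction \<open>(d, e)\<close> is \<open>A \<beta> g e - load \<gamma> d e\<close>.\<close>

definition J :: "real \<Rightarrow> real \<Rightarrow> (real^2 \<Rightarrow> real) \<Rightarrow> (real^2 \<Rightarrow> real^2) \<Rightarrow> real" where
  "J \<beta> \<gamma> u g = A \<beta> g g / 2 - load \<gamma> u g"

lemma w_measurable[measurable]: "w \<beta> \<in> borel_measurable M"
  using h0_measurable unfolding w_def by measurable

lemma w_bounds:
  assumes "0 \<le> \<beta>" "x \<in> space M"
  shows "\<beta>^3 \<le> w \<beta> x" "\<bar>w \<beta> x\<bar> \<le> (H + \<beta>)^3"
  using assms h0_bounds[of x] by (auto simp: w_def space_M intro!: power_mono)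

lemma sqint_w: "0 \<le> \<beta> \<Longrightarrow> sqint M g \<Longrightarrow> sqint M (\<lambda>x. w \<beta> x *\<^sub>R g x)"
  by (rule sqint_bounded_mult(1)[OF _ w_measurable w_bounds(2)])

lemma sqint_one: "sqint M (\<lambda>x. 1::real)"
  by (rule sqint_bounded[OF finite_measure_M, of _ 1]) auto

lemma sqint_wedge: "sqint M wedge"
proof (rule sqint_bounded[OF finite_measure_M, of _ H])
  show "wedge \<in> borel_measurable M" unfolding wedge_def using h0_measurable by measurable
  show "norm (wedge x) \<le> H" if "x \<in> space M" for x
    using h0_bounds[of x] that by (simp add: wedge_def space_M)
qed

lemma A_commute: "A \<beta> g k = A \<beta> k g"
  by (simp add: A_def ip_def inner_commute)

lemma A_lincomb:
  assumes "0 \<le> \<beta>" "sqint M g" "sqint M h" "sqint M k"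
  shows "A \<beta> k (\<lambda>x. a *\<^sub>R g x + b *\<^sub>R h x) = a * A \<beta> k g + b * A \<beta> k h"
  unfolding A_def using assms by (intro ip_lincomb_right sqint_w)

lemma A_diff:
  assumes "0 \<le> \<beta>" "sqint M g" "sqint M h" "sqint M k"
  shows "A \<beta> k (\<lambda>x. g x - h x) = A \<beta> k g - A \<beta> k h"
  using A_lincomb[OF assms, of 1 "-1"] by simp

lemma A_ge: "0 \<le> \<beta> \<Longrightarrow> sqint M g \<Longrightarrow> \<beta>^3 * (L2norm M g)^2 \<le> A \<beta> g g"
proof -
  assume a: "0 \<le> \<beta>" "sqint M g"
  have "\<beta>^3 * (L2norm M g)^2 = (\<integral>x. \<beta>^3 * (norm (g x))^2 \<partial>M)" by (simp add: L2norm_power2)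
  also have "\<dots> \<le> A \<beta> g g" unfolding A_def ip_def
  proof (rule integral_mono)
    show "integrable M (\<lambda>x. \<beta>^3 * (norm (g x))^2)" using a by (simp add: sqint_def)
    show "integrable M (\<lambda>x. (w \<beta> x *\<^sub>R g x) \<bullet> g x)" by (intro sqint_inner_integrable sqint_w a)
    show "\<beta>^3 * (norm (g x))^2 \<le> (w \<beta> x *\<^sub>R g x) \<bullet> g x" if "x \<in> space M" for x
      using w_bounds(1)[OF a(1) that] by (simp add: power2_norm_eq_inner mult_right_mono)
  qed
  finally show ?thesis .
qed

lemma load_lincomb:
  assumes "sqint M u" "sqint M v" "sqint M g" "sqint M h"
  shows "load \<gamma> (\<lambda>x. a * u x + b * v x) (\<lambda>x. a *\<^sub>R g x + b *\<^sub>R h x) = a * load \<gamma> u g + b * load \<gamma> v h"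
proof -
  have "ip M (\<lambda>x. 1) (\<lambda>x. a * u x + b * v x) = a * ip M (\<lambda>x. 1) u + b * ip M (\<lambda>x. 1) v"
    using ip_lincomb_right[OF assms(1,2) sqint_one, of a b] by (simp only: real_scaleR_def)
  then show ?thesis unfolding load_def ip_lincomb_right[OF assms(3,4) sqint_wedge]
    by (simp only:) argo
qed

lemma load_diff:
  assumes "sqint M u" "sqint M v" "sqint M g" "sqint M h"
  shows "load \<gamma> (\<lambda>x. u x - v x) (\<lambda>x. g x - h x) = load \<gamma> u g - load \<gamma> v h"
  using load_lincomb[OF assms, of \<gamma> 1 "-1"] by simp

lemma J_lincomb:
  assumes "0 \<le> \<beta>" "sqint M u" "sqint M v" "sqint M g" "sqint M h"
  shows "J \<beta> \<gamma> (\<lambda>x. a * u x + b * v x) (\<lambda>x. a *\<^sub>R g x + b *\<^sub>R h x) =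
    a^2 * A \<beta> g g / 2 + a * b * A \<beta> g h + b^2 * A \<beta> h h / 2 - a * load \<gamma> u g - b * load \<gamma> v h"
proof -
  let ?k = "\<lambda>x. a *\<^sub>R g x + b *\<^sub>R h x"
  have "sqint M ?k" by (intro sqint_add sqint_scaleR assms)
  then have "A \<beta> ?k ?k = a * A \<beta> g ?k + b * A \<beta> h ?k"
    using A_lincomb[OF assms(1,4,5), of ?k a b]
    unfolding A_commute[of \<beta> ?k g] A_commute[of \<beta> ?k h] by blast
  then show ?thesis
    unfolding J_def load_lincomb[OF assms(2-5)] A_lincomb[OF assms(1,4,5,4)] A_lincomb[OF assms(1,4,5,5)]
      A_commute[of \<beta> h g]
    by (simp add: power2_eq_square algebra_simps)
qed

text \<open>Bounds the norm of the functional taking \<open>u\<close> to its integral, measured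
  against the L2 norm of the gradient; \<open>load_norm\<close> does the same for
  \<open>load\<close>.\<close>

definition one_norm :: real where "one_norm = L2norm M (\<lambda>x. 1::real) * poincare_const"

definition load_norm :: "real \<Rightarrow> real" where
  "load_norm \<gamma> = L2norm M wedge + \<bar>\<gamma>\<bar> * one_norm"

lemma one_norm_nonneg: "0 \<le> one_norm"
  using poincare(1) by (simp add: one_norm_def L2norm_nonneg)

lemma load_norm_nonneg: "0 \<le> load_norm \<gamma>"
  using one_norm_nonneg by (simp add: load_norm_def L2norm_nonneg)

lemma ip_one_le:
  assumes "H10 \<Omega> u g"
  shows "\<bar>ip M (\<lambda>x. 1) u\<bar> \<le> one_norm * L2norm M g"
proof -
  have "\<bar>ip M (\<lambda>x. 1) u\<bar> \<le> L2norm M (\<lambda>x. 1::real) * L2norm M u"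
    by (intro ip_Cauchy_Schwarz sqint_one H10_sqint[OF assms])
  also have "\<dots> \<le> L2norm M (\<lambda>x. 1::real) * (poincare_const * L2norm M g)"
    by (intro mult_left_mono poincare assms L2norm_nonneg)
  finally show ?thesis by (simp add: one_norm_def mult.assoc)
qed

lemma load_le:
  assumes "H10 \<Omega> u g"
  shows "\<bar>load \<gamma> u g\<bar> \<le> load_norm \<gamma> * L2norm M g"
proof -
  have "\<bar>load \<gamma> u g\<bar> \<le> \<bar>ip M wedge g\<bar> + \<bar>\<gamma>\<bar> * \<bar>ip M (\<lambda>x. 1) u\<bar>"
    unfolding load_def by (rule order_trans[OF abs_triangle_ineq4]) (simp add: abs_mult)
  also have "\<dots> \<le> L2norm M wedge * L2norm M g + \<bar>\<gamma>\<bar> * (one_norm * L2norm M g)"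
    by (intro add_mono mult_left_mono ip_Cauchy_Schwarz sqint_wedge H10_sqint[OF assms] ip_one_le assms) auto
  finally show ?thesis by (simp add: load_norm_def algebra_simps)
qed

lemma vi_sol_iff:
  assumes "0 \<le> \<beta>"
  shows "vi_sol \<Omega> h0 \<beta> \<gamma> q g \<longleftrightarrow> inK \<Omega> q g \<and>
    (\<forall>\<phi> g\<phi>. inK \<Omega> \<phi> g\<phi> \<longrightarrow> load \<gamma> (\<lambda>x. \<phi> x - q x) (\<lambda>x. g\<phi> x - g x) \<le> A \<beta> g (\<lambda>x. g\<phi> x - g x))"
  unfolding vi_sol_def load_def A_def ip_def w_def wedge_def M_def
  by (auto simp: inner_axis' mult.assoc)

text \<open>Coercivity and the bound on the load reduce this to a quadratic polynomial in the norm
  of \<open>g\<close>; the constant comes from completing the square.\<close>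

lemma J_bounded_below:
  assumes "0 < \<beta>" "H10 \<Omega> u g"
  shows "- ((load_norm \<gamma>)^2) / (2 * \<beta>^3) \<le> J \<beta> \<gamma> u g"
proof -
  let ?n = "L2norm M g"
  have "0 \<le> (\<beta>^3 * ?n - load_norm \<gamma>)^2 / (2 * \<beta>^3)" using assms(1) by simp
  also have "\<dots> = \<beta>^3 * ?n^2 / 2 - load_norm \<gamma> * ?n + (load_norm \<gamma>)^2 / (2 * \<beta>^3)"
    using assms(1) by (simp add: power2_eq_square field_simps)
  also have "\<dots> \<le> J \<beta> \<gamma> u g + (load_norm \<gamma>)^2 / (2 * \<beta>^3)"
    using A_ge[of \<beta> g] H10_sqint[OF assms(2)] assms(1) load_le[OF assms(2), of \<gamma>] by (simp add: J_def)
  finally show ?thesis by simp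
qed

text \<open>Direct method. Strong convexity makes every minimising sequence Cauchy in norm, so no
  weak convergence is involved; the limit stays in the closed cone and minimises, and its first
  variation is the variational inequality.\<close>

lemma vi_sol_exists:
  assumes "0 < \<beta>"
  shows "\<exists>q g. vi_sol \<Omega> h0 \<beta> \<gamma> q g"
proof -
  define S where "S = {J \<beta> \<gamma> u g | u g. inK \<Omega> u g}"
  have "S \<noteq> {}" using inK_zero by (auto simp: S_def)
  have bdd: "bdd_below S"
    using J_bounded_below[OF assms] by (auto simp: S_def inK_def intro!: bdd_belowI)
  have Inf_le: "Inf S \<le> J \<beta> \<gamma> u g" if "inK \<Omega> u g" for u g
    using that by (intro cInf_lower bdd) (auto simp: S_def)
  have "\<forall>n. \<exists>p. inK \<Omega> (fst p) (snd p) \<and> J \<beta> \<gamma> (fst p) (snd p) < Inf S + inverse (real (Suc n))"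
  proof
    fix n
    obtain s where "s \<in> S" "s < Inf S + inverse (real (Suc n))"
      using cInf_lessD[OF \<open>S \<noteq> {}\<close>, of "Inf S + inverse (real (Suc n))"] by auto
    then show "\<exists>p. inK \<Omega> (fst p) (snd p) \<and> J \<beta> \<gamma> (fst p) (snd p) < Inf S + inverse (real (Suc n))"
      by (auto simp: S_def)
  qed
  from choice[OF this] obtain p where p: "\<forall>n. inK \<Omega> (fst (p n)) (snd (p n)) \<and>
      J \<beta> \<gamma> (fst (p n)) (snd (p n)) < Inf S + inverse (real (Suc n))" by blast
  define u where "u n = fst (p n)" for n
  define g where "g n = snd (p n)" for n
  have K: "inK \<Omega> (u n) (g n)" and J: "J \<beta> \<gamma> (u n) (g n) < Inf S + inverse (real (Suc n))" for n
    using p by (auto simp: u_def g_def)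
  have H: "H10 \<Omega> (u n) (g n)" for n using K by (simp add: inK_def)
  note sq = H10_sqint[OF H]
  \<comment> \<open>Parallelogram law: the load terms cancel, and the midpoint lies in the cone, so
    its energy is at least the infimum.\<close>
  have gdiff: "\<beta>^3 * (L2norm M (\<lambda>x. g m x - g n x))^2 \<le> 4 * (inverse (real (Suc m)) + inverse (real (Suc n)))" for m n
  proof -
    let ?mid = "J \<beta> \<gamma> (\<lambda>x. (1/2) * u m x + (1/2) * u n x) (\<lambda>x. (1/2) *\<^sub>R g m x + (1/2) *\<^sub>R g n x)"
    have "sqint M (\<lambda>x. g m x - g n x)" by (intro sqint_diff sq)
    then have "\<beta>^3 * (L2norm M (\<lambda>x. g m x - g n x))^2 \<le> A \<beta> (\<lambda>x. g m x - g n x) (\<lambda>x. g m x - g n x)"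
      using assms by (intro A_ge) auto
    also have "\<dots> = A \<beta> (g m) (g m) - 2 * A \<beta> (g m) (g n) + A \<beta> (g n) (g n)"
      using A_diff[OF less_imp_le[OF assms] sq(2)[of m] sq(2)[of n]] sq sqint_diff[OF sq(2)[of m] sq(2)[of n]]
      by (simp add: A_commute[of \<beta> "\<lambda>x. g m x - g n x" "g m"] A_commute[of \<beta> "\<lambda>x. g m x - g n x" "g n"] A_commute[of \<beta> "g n" "g m"])
    also have "\<dots> = 4 * (J \<beta> \<gamma> (u m) (g m) + J \<beta> \<gamma> (u n) (g n) - 2 * ?mid)"
      using assms sq by (subst J_lincomb) (auto simp: J_def power2_eq_square field_simps)
    also have "\<dots> \<le> 4 * (inverse (real (Suc m)) + inverse (real (Suc n)))"
      using J[of m] J[of n] Inf_le[OF inK_lincomb[OF K[of m] K[of n], of "1/2" "1/2"]] by simp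
    finally show ?thesis .
  qed
  have Cauchy_g: "\<exists>N. \<forall>m\<ge>N. \<forall>n\<ge>N. L2norm M (\<lambda>x. g m x - g n x) < e" if "0 < e" for e
  proof -
    have "0 < \<beta>^3 * e^2 / 8" using assms that by simp
    then obtain N where N: "inverse (real (Suc N)) < \<beta>^3 * e^2 / 8"
      using reals_Archimedean by blast
    have "L2norm M (\<lambda>x. g m x - g n x) < e" if "N \<le> m" "N \<le> n" for m n
    proof -
      have "inverse (real (Suc m)) \<le> inverse (real (Suc N))" "inverse (real (Suc n)) \<le> inverse (real (Suc N))"
        using that by (auto intro!: le_imp_inverse_le)
      then have "4 * (inverse (real (Suc m)) + inverse (real (Suc n))) \<le> 4 * (inverse (real (Suc N)) + inverse (real (Suc N)))"
        by (intro mult_left_mono add_mono) auto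
      also have "\<dots> < \<beta>^3 * e^2" using N by simp
      finally have "\<beta>^3 * (L2norm M (\<lambda>x. g m x - g n x))^2 < \<beta>^3 * e^2"
        by (rule le_less_trans[OF gdiff])
      then have "(L2norm M (\<lambda>x. g m x - g n x))^2 < e^2" using assms by simp
      then show ?thesis using \<open>0 < e\<close> by (simp add: power_less_imp_less_base)
    qed
    then show ?thesis by blast
  qed
  have Cauchy_u: "\<exists>N. \<forall>m\<ge>N. \<forall>n\<ge>N. L2norm M (\<lambda>x. u m x - u n x) < e" if "0 < e" for e
  proof -
    have P: "0 < poincare_const" by (rule poincare)
    have "0 < e / poincare_const" using that P by simp
    from Cauchy_g[OF this] obtain N where N: "\<forall>m\<ge>N. \<forall>n\<ge>N. L2norm M (\<lambda>x. g m x - g n x) < e / poincare_const"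
      by blast
    have "L2norm M (\<lambda>x. u m x - u n x) \<le> poincare_const * L2norm M (\<lambda>x. g m x - g n x)" for m n
      using poincare(2)[OF H10_lincomb[OF H[of m] H[of n], of 1 "-1"]] by simp
    moreover have "poincare_const * L2norm M (\<lambda>x. g m x - g n x) < e" if "N \<le> m" "N \<le> n" for m n
      using N that P by (simp add: field_simps)
    ultimately show ?thesis by (meson le_less_trans)
  qed
  obtain q where q: "sqint M q" "(\<lambda>n. L2norm M (\<lambda>x. u n x - q x)) \<longlonglongrightarrow> 0"
    using L2_complete[OF sq(1) Cauchy_u] by blast
  obtain h where h: "sqint M h" "(\<lambda>n. L2norm M (\<lambda>x. g n x - h x)) \<longlonglongrightarrow> 0"
    using L2_complete[OF sq(2) Cauchy_g] by blast
  have qK: "inK \<Omega> q h" by (rule inK_closed[OF K q(1) h(1) q(2) h(2)])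
  have wlim: "(\<lambda>n. L2norm M (\<lambda>x. w \<beta> x *\<^sub>R g n x - w \<beta> x *\<^sub>R h x)) \<longlonglongrightarrow> 0"
  proof (rule tendsto_0_norm_le[OF L2norm_nonneg])
    show "L2norm M (\<lambda>x. w \<beta> x *\<^sub>R g n x - w \<beta> x *\<^sub>R h x) \<le> (H + \<beta>)^3 * L2norm M (\<lambda>x. g n x - h x)" for n
      using sqint_bounded_mult(2)[OF sqint_diff[OF sq(2)[of n] h(1)] w_measurable w_bounds(2)] assms
      by (simp add: scaleR_diff_right)
    show "(\<lambda>n. (H + \<beta>)^3 * L2norm M (\<lambda>x. g n x - h x)) \<longlonglongrightarrow> 0"
      using h(2) by (auto intro!: tendsto_eq_intros)
  qed
  have "(\<lambda>n. J \<beta> \<gamma> (u n) (g n)) \<longlonglongrightarrow> J \<beta> \<gamma> q h"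
    unfolding J_def A_def load_def
    by (intro tendsto_intros ip_tendsto sqint_w sq q h wlim sqint_wedge sqint_one)
       (use assms in auto)
  moreover have "(\<lambda>n. Inf S + inverse (real (Suc n))) \<longlonglongrightarrow> Inf S"
    using tendsto_add[OF tendsto_const LIMSEQ_inverse_real_of_nat] by simp
  ultimately have "J \<beta> \<gamma> q h \<le> Inf S"
    by (rule LIMSEQ_le) (use J less_imp_le in blast)
  then have min: "J \<beta> \<gamma> q h \<le> J \<beta> \<gamma> \<phi> k" if "inK \<Omega> \<phi> k" for \<phi> k
    using Inf_le[OF that] by linarith
  have "load \<gamma> (\<lambda>x. \<phi> x - q x) (\<lambda>x. k x - h x) \<le> A \<beta> h (\<lambda>x. k x - h x)" if \<phi>: "inK \<Omega> \<phi> k" for \<phi> k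
  proof -
    have sqk: "sqint M \<phi>" "sqint M k" using H10_sqint \<phi> by (auto simp: inK_def)
    define d where "d x = \<phi> x - q x" for x
    define e where "e x = k x - h x" for x
    have sqd: "sqint M d" "sqint M e" unfolding d_def e_def by (intro sqint_diff sqk q h)+
    define D where "D = A \<beta> h e - load \<gamma> d e"
    \<comment> \<open>Along the segment from \<open>q\<close> to \<open>\<phi>\<close> the energy is
      a quadratic polynomial in \<open>t\<close>. Minimality divided by \<open>t\<close> leaves the
      first variation \<open>D\<close> and a term that disappears as \<open>t\<close> tends to
      0.\<close>
    have step: "0 \<le> D + t * (A \<beta> e e / 2)" if t: "0 < t" "t \<le> 1" for t
    proof -
      have "inK \<Omega> (\<lambda>x. (1 - t) * q x + t * \<phi> x) (\<lambda>x. (1 - t) *\<^sub>R h x + t *\<^sub>R k x)"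
        using t by (intro inK_lincomb qK \<phi>) auto
      also have "(\<lambda>x. (1 - t) * q x + t * \<phi> x) = (\<lambda>x. 1 * q x + t * d x)" by (auto simp: d_def algebra_simps)
      also have "(\<lambda>x. (1 - t) *\<^sub>R h x + t *\<^sub>R k x) = (\<lambda>x. 1 *\<^sub>R h x + t *\<^sub>R e x)" by (auto simp: e_def algebra_simps)
      finally have "J \<beta> \<gamma> q h \<le> J \<beta> \<gamma> (\<lambda>x. 1 * q x + t * d x) (\<lambda>x. 1 *\<^sub>R h x + t *\<^sub>R e x)" by (rule min)
      also have "\<dots> = J \<beta> \<gamma> q h + t * (D + t * (A \<beta> e e / 2))"
        using assms q h sqd by (subst J_lincomb) (auto simp: J_def D_def power2_eq_square algebra_simps)
      finally show ?thesis using t by (simp add: zero_le_mult_iff)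
    qed
    have "((\<lambda>t. D + t * (A \<beta> e e / 2)) \<longlongrightarrow> D + 0 * (A \<beta> e e / 2)) (at_right 0)"
      by (intro tendsto_intros)
    moreover have "\<forall>\<^sub>F t in at_right 0. 0 \<le> D + t * (A \<beta> e e / 2)"
      by (rule eventually_mono[OF eventually_at_right_real[OF zero_less_one]]) (use step in simp)
    ultimately have "0 \<le> D" by (simp add: tendsto_lowerbound)
    then show ?thesis by (simp add: D_def d_def[abs_def] e_def[abs_def])
  qed
  then have "vi_sol \<Omega> h0 \<beta> \<gamma> q h" using vi_sol_iff qK assms by simp
  then show ?thesis by blast
qed

section \<open>Uniqueness and dependence on gap and speed\<close>

lemma vi_sol_H10: "vi_sol \<Omega> h0 \<beta> \<gamma> q g \<Longrightarrow> H10 \<Omega> q g"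
  by (simp add: vi_sol_def inK_def)

text \<open>Each solution is inserted as competitor into the inequality of the other, and the two
  are added. The change of weight is charged to \<open>g2\<close>, so for equal gaps only the speed
  term remains; this gives uniqueness, monotonicity and the Lipschitz bound from one
  estimate.\<close>

lemma vi_sol_compare:
  assumes \<beta>: "0 < \<beta>1" "0 < \<beta>2"
    and sol: "vi_sol \<Omega> h0 \<beta>1 \<gamma>1 q1 g1" "vi_sol \<Omega> h0 \<beta>2 \<gamma>2 q2 g2"
  shows "A \<beta>1 (\<lambda>x. g1 x - g2 x) (\<lambda>x. g1 x - g2 x) \<le>
    ip M (\<lambda>x. (w \<beta>2 x - w \<beta>1 x) *\<^sub>R g2 x) (\<lambda>x. g1 x - g2 x) - (\<gamma>1 - \<gamma>2) * ip M (\<lambda>x. 1) (\<lambda>x. q1 x - q2 x)"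
proof -
  note sq = H10_sqint[OF vi_sol_H10[OF sol(1)]] H10_sqint[OF vi_sol_H10[OF sol(2)]]
  define d where "d x = g1 x - g2 x" for x
  have sqd: "sqint M d" unfolding d_def by (intro sqint_diff sq)
  have v1: "load \<gamma>1 q2 g2 - load \<gamma>1 q1 g1 \<le> A \<beta>1 g1 g2 - A \<beta>1 g1 g1"
    using sol \<beta> sq unfolding vi_sol_iff[OF less_imp_le[OF \<beta>(1)]] vi_sol_iff[OF less_imp_le[OF \<beta>(2)]]
    by (metis (no_types, lifting) A_diff less_imp_le load_diff)
  have v2: "load \<gamma>2 q1 g1 - load \<gamma>2 q2 g2 \<le> A \<beta>2 g2 g1 - A \<beta>2 g2 g2"
    using sol \<beta> sq unfolding vi_sol_iff[OF less_imp_le[OF \<beta>(1)]] vi_sol_iff[OF less_imp_le[OF \<beta>(2)]]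
    by (metis (no_types, lifting) A_diff less_imp_le load_diff)
  have e1: "ip M (\<lambda>x. (w \<beta>2 x - w \<beta>1 x) *\<^sub>R g2 x) d = A \<beta>2 g2 d - A \<beta>1 g2 d"
    unfolding A_def scaleR_diff_left using \<beta> sq sqd by (intro ip_diff_left sqint_w) auto
  have e2: "A \<beta>1 d d = A \<beta>1 g1 d - A \<beta>1 g2 d"
    using A_diff[of \<beta>1 g1 g2 d, folded d_def[abs_def]] \<beta> sq sqd by (simp add: A_commute[of \<beta>1 d g1] A_commute[of \<beta>1 d g2])
  have e3: "A \<beta>1 g1 d = A \<beta>1 g1 g1 - A \<beta>1 g1 g2" "A \<beta>2 g2 d = A \<beta>2 g2 g1 - A \<beta>2 g2 g2"
    unfolding d_def using \<beta> sq by (auto intro!: A_diff)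
  have e4: "ip M (\<lambda>x. 1) (\<lambda>x. q1 x - q2 x) = ip M (\<lambda>x. 1) q1 - ip M (\<lambda>x. 1) q2"
    by (intro ip_diff_right sqint_one sq)
  have "A \<beta>1 d d \<le> ip M (\<lambda>x. (w \<beta>2 x - w \<beta>1 x) *\<^sub>R g2 x) d - (\<gamma>1 - \<gamma>2) * (ip M (\<lambda>x. 1) q1 - ip M (\<lambda>x. 1) q2)"
    unfolding e1 e2 e3 using v1 v2 by (simp add: load_def left_diff_distrib right_diff_distrib)
  then show ?thesis unfolding e4 d_def[abs_def] .
qed

text \<open>The admissible set is a convex cone, so \<open>q + \<psi>\<close> is a
  competitor.\<close>

lemma vi_sol_test:
  assumes "0 < \<beta>" "vi_sol \<Omega> h0 \<beta> \<gamma> q g" "inK \<Omega> \<psi> D\<psi>"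
  shows "load \<gamma> \<psi> D\<psi> \<le> A \<beta> g D\<psi>"
proof -
  have K: "inK \<Omega> q g" using assms(2) by (simp add: vi_sol_def)
  have "inK \<Omega> \<phi> k \<Longrightarrow> load \<gamma> (\<lambda>x. \<phi> x - q x) (\<lambda>x. k x - g x) \<le> A \<beta> g (\<lambda>x. k x - g x)" for \<phi> k
    using assms(1,2) vi_sol_iff[of \<beta>] by simp
  from this[OF inK_lincomb[OF K assms(3), of 1 1]] show ?thesis by simp
qed

lemma vi_sol_norm_le:
  assumes "0 < \<beta>" "vi_sol \<Omega> h0 \<beta> \<gamma> q g"
  shows "\<beta>^3 * L2norm M g \<le> load_norm \<gamma>"
proof -
  have H: "H10 \<Omega> q g" by (rule vi_sol_H10[OF assms(2)])
  note sq = H10_sqint[OF H]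
  \<comment> \<open>The competitor is 0.\<close>
  have "load \<gamma> (\<lambda>x. 0 - q x) (\<lambda>x. 0 - g x) \<le> A \<beta> g (\<lambda>x. 0 - g x)"
    using assms vi_sol_iff[of \<beta>] inK_zero by fastforce
  then have "A \<beta> g g \<le> load \<gamma> q g"
    using load_lincomb[OF sq(1) sq(1) sq(2) sq(2), of \<gamma> "-1" 0] A_lincomb[OF _ sq(2) sq(2) sq(2), of \<beta> "-1" 0] assms(1)
    by simp
  then have "\<beta>^3 * (L2norm M g)^2 \<le> load_norm \<gamma> * L2norm M g"
    using A_ge[OF _ sq(2), of \<beta>] load_le[OF H, of \<gamma>] assms(1) by simp
  then show ?thesis
    using L2norm_nonneg[of M g] load_norm_nonneg[of \<gamma>]
    by (cases "L2norm M g = 0") (auto simp: power2_eq_square mult.assoc[symmetric])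
qed

lemma vi_sol_integral_unique:
  assumes "0 < \<beta>" "vi_sol \<Omega> h0 \<beta> \<gamma> q1 g1" "vi_sol \<Omega> h0 \<beta> \<gamma> q2 g2"
  shows "integral\<^sup>L M q1 = integral\<^sup>L M q2"
proof -
  note H = vi_sol_H10[OF assms(2)] vi_sol_H10[OF assms(3)]
  note sq = H10_sqint[OF H(1)] H10_sqint[OF H(2)]
  have "A \<beta> (\<lambda>x. g1 x - g2 x) (\<lambda>x. g1 x - g2 x) \<le> 0"
    using vi_sol_compare[OF assms(1,1,2,3)] by (simp add: ip_def)
  then have "\<beta>^3 * (L2norm M (\<lambda>x. g1 x - g2 x))^2 \<le> 0"
    using A_ge[OF _ sqint_diff[OF sq(2,4)], of \<beta>] assms(1) by linarith
  then have "L2norm M (\<lambda>x. g1 x - g2 x) = 0" using assms(1) by (simp add: mult_le_0_iff)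
  then have "\<bar>ip M (\<lambda>x. 1) (\<lambda>x. q1 x - q2 x)\<bar> \<le> 0"
    using ip_one_le[OF H10_lincomb[OF H, of 1 "-1"]] by simp
  then have "ip M (\<lambda>x. 1) q1 = ip M (\<lambda>x. 1) q2"
    using ip_diff_right[OF sq(1,3) sqint_one] by simp
  then show ?thesis using sqint_integrable(2)[OF finite_measure_M] sq by simp
qed

text \<open>Copies the description inside \<open>G\<close>, so that \<open>G\<close> is
  \<open>I - F\<close> by unfolding. Uniqueness of the integral gives the description its
  meaning.\<close>

definition I :: "real \<Rightarrow> real \<Rightarrow> real" where
  "I \<beta> \<gamma> = (THE I. \<exists>q g. vi_sol \<Omega> h0 \<beta> \<gamma> q g \<and> I = integral\<^sup>L M q)"

lemma I_eq:
  assumes "0 < \<beta>" "vi_sol \<Omega> h0 \<beta> \<gamma> q g"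
  shows "I \<beta> \<gamma> = integral\<^sup>L M q" "I \<beta> \<gamma> = ip M (\<lambda>x. 1) q"
proof -
  show "I \<beta> \<gamma> = integral\<^sup>L M q"
    unfolding I_def by (rule the_equality) (use vi_sol_integral_unique[OF assms(1)] assms(2) in blast)+
  then show "I \<beta> \<gamma> = ip M (\<lambda>x. 1) q"
    using sqint_integrable(2)[OF finite_measure_M] H10_sqint(1)[OF vi_sol_H10[OF assms(2)]] by simp
qed

text \<open>For equal gaps the comparison reduces to \<open>0 \<le> (\<gamma>' - \<gamma>) * (I
  \<beta> \<gamma> - I \<beta> \<gamma>')\<close>.\<close>

lemma I_antimono:
  assumes "0 < \<beta>" "\<gamma> \<le> \<gamma>'"
  shows "I \<beta> \<gamma>' \<le> I \<beta> \<gamma>"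
proof (cases "\<gamma> = \<gamma>'")
  case False
  obtain q g where s: "vi_sol \<Omega> h0 \<beta> \<gamma> q g" using vi_sol_exists[OF assms(1)] by blast
  obtain q' g' where s': "vi_sol \<Omega> h0 \<beta> \<gamma>' q' g'" using vi_sol_exists[OF assms(1)] by blast
  note sq = H10_sqint[OF vi_sol_H10[OF s]] H10_sqint[OF vi_sol_H10[OF s']]
  have "0 \<le> A \<beta> (\<lambda>x. g x - g' x) (\<lambda>x. g x - g' x)"
    using A_ge[OF _ sqint_diff[OF sq(2,4)], of \<beta>] assms(1)
    by (smt (verit) mult_nonneg_nonneg zero_le_power zero_le_power2)
  also have "\<dots> \<le> - ((\<gamma> - \<gamma>') * ip M (\<lambda>x. 1) (\<lambda>x. q x - q' x))"
    using vi_sol_compare[OF assms(1,1) s s'] by (simp add: ip_def[of M "\<lambda>x. 0"])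
  also have "\<dots> = (\<gamma>' - \<gamma>) * (I \<beta> \<gamma> - I \<beta> \<gamma>')"
    unfolding I_eq(2)[OF assms(1) s] I_eq(2)[OF assms(1) s'] ip_diff_right[OF sq(1,3) sqint_one]
    by (simp add: algebra_simps)
  finally show ?thesis using False assms(2) by (simp add: zero_le_mult_iff)
qed simp

text \<open>The decay in \<beta> makes the constant load \<open>F\<close> win at large gaps.\<close>

lemma I_le:
  assumes "0 < \<beta>"
  shows "I \<beta> \<gamma> \<le> one_norm * load_norm \<gamma> / \<beta>^3"
proof -
  obtain q g where s: "vi_sol \<Omega> h0 \<beta> \<gamma> q g" using vi_sol_exists[OF assms(1)] by blast
  have "I \<beta> \<gamma> \<le> one_norm * L2norm M g"
    using I_eq(2)[OF assms s] ip_one_le[OF vi_sol_H10[OF s]] by simp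
  also have "\<dots> \<le> one_norm * (load_norm \<gamma> / \<beta>^3)"
    using vi_sol_norm_le[OF assms s] assms by (intro mult_left_mono one_norm_nonneg) (simp add: field_simps)
  finally show ?thesis by simp
qed

lemma I_locally_lipschitz:
  assumes "0 < a"
  shows "\<exists>L>0. \<forall>\<beta>1\<in>{a..R}. \<forall>\<beta>2\<in>{a..R}. \<forall>\<gamma>1\<in>{-R..R}. \<forall>\<gamma>2\<in>{-R..R}.
     \<bar>I \<beta>1 \<gamma>1 - I \<beta>2 \<gamma>2\<bar> \<le> L * (\<bar>\<beta>1 - \<beta>2\<bar> + \<bar>\<gamma>1 - \<gamma>2\<bar>)"
proof -
  \<comment> \<open>The factor \<open>3 * (H + \<bar>R\<bar>)^2\<close> is the Lipschitz constant of
    the cube on the range of \<open>h0 + \<beta>\<close>; \<open>load_norm R / a^3\<close> bounds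
    the norm of \<open>g2\<close>.\<close>
  define C where "C = 3 * (H + \<bar>R\<bar>)^2 * (load_norm R / a^3)"
  have C: "0 \<le> C" using assms load_norm_nonneg H_nonneg by (simp add: C_def)
  \<comment> \<open>Adding 1 keeps \<open>L\<close> positive even if the first summand is 0.\<close>
  define L where "L = one_norm * ((C + one_norm) / a^3) + 1"
  have L: "0 < L" using assms C one_norm_nonneg by (simp add: L_def add_nonneg_pos)
  have "\<bar>I \<beta>1 \<gamma>1 - I \<beta>2 \<gamma>2\<bar> \<le> L * (\<bar>\<beta>1 - \<beta>2\<bar> + \<bar>\<gamma>1 - \<gamma>2\<bar>)"
    if b: "\<beta>1 \<in> {a..R}" "\<beta>2 \<in> {a..R}" "\<gamma>1 \<in> {-R..R}" "\<gamma>2 \<in> {-R..R}" for \<beta>1 \<beta>2 \<gamma>1 \<gamma>2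
  proof -
    have pos: "0 < \<beta>1" "0 < \<beta>2" using b assms by auto
    obtain q1 g1 where s1: "vi_sol \<Omega> h0 \<beta>1 \<gamma>1 q1 g1" using vi_sol_exists[OF pos(1)] by blast
    obtain q2 g2 where s2: "vi_sol \<Omega> h0 \<beta>2 \<gamma>2 q2 g2" using vi_sol_exists[OF pos(2)] by blast
    note H = vi_sol_H10[OF s1] vi_sol_H10[OF s2]
    note sq = H10_sqint[OF H(1)] H10_sqint[OF H(2)]
    let ?d = "\<lambda>x. g1 x - g2 x"
    have sqd: "sqint M ?d" by (intro sqint_diff sq)
    have Hd: "H10 \<Omega> (\<lambda>x. q1 x - q2 x) ?d" using H10_lincomb[OF H, of 1 "-1"] by simp
    have w_diff: "\<bar>w \<beta>2 x - w \<beta>1 x\<bar> \<le> 3 * (H + \<bar>R\<bar>)^2 * \<bar>\<beta>1 - \<beta>2\<bar>" if "x \<in> space M" for x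
    proof -
      let ?s = "h0 x + \<beta>2" and ?t = "h0 x + \<beta>1"
      have st: "0 \<le> ?s" "?s \<le> H + \<bar>R\<bar>" "0 \<le> ?t" "?t \<le> H + \<bar>R\<bar>"
        using that h0_bounds[of x] b pos by (auto simp: space_M)
      have K: "0 \<le> H + \<bar>R\<bar>" using H_nonneg by simp
      have "?s^3 - ?t^3 = (?s - ?t) * (?s * ?s + ?s * ?t + ?t * ?t)" by (simp add: power3_eq_cube algebra_simps)
      then have eq: "\<bar>w \<beta>2 x - w \<beta>1 x\<bar> = \<bar>\<beta>1 - \<beta>2\<bar> * \<bar>?s * ?s + ?s * ?t + ?t * ?t\<bar>"
        by (simp add: w_def abs_mult abs_minus_commute)
      have "?s * ?s + ?s * ?t + ?t * ?t \<le> (H + \<bar>R\<bar>) * (H + \<bar>R\<bar>) + (H + \<bar>R\<bar>) * (H + \<bar>R\<bar>) + (H + \<bar>R\<bar>) * (H + \<bar>R\<bar>)"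
        by (rule add_mono[OF add_mono[OF mult_mono[OF st(2) st(2) K st(1)] mult_mono[OF st(2) st(4) K st(3)]]
            mult_mono[OF st(4) st(4) K st(3)]])
      also have "\<dots> = 3 * (H + \<bar>R\<bar>)^2" by (simp add: power2_eq_square)
      finally have "\<bar>?s * ?s + ?s * ?t + ?t * ?t\<bar> \<le> 3 * (H + \<bar>R\<bar>)^2" using st by simp
      from mult_left_mono[OF this abs_ge_zero[of "\<beta>1 - \<beta>2"]] show ?thesis unfolding eq by (simp add: mult.commute)
    qed
    note wd = sqint_bounded_mult[OF sq(4) borel_measurable_diff[OF w_measurable w_measurable] w_diff]
    have "load_norm \<gamma>2 \<le> load_norm R"
      unfolding load_norm_def using b one_norm_nonneg by (intro add_left_mono mult_right_mono) auto
    then have "a^3 * L2norm M g2 \<le> load_norm R"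
      using vi_sol_norm_le[OF pos(2) s2] mult_right_mono[OF power_mono[of a \<beta>2 3] L2norm_nonneg[of M g2]] b assms by simp
    then have g2: "L2norm M g2 \<le> load_norm R / a^3" using assms by (simp add: field_simps)
    have "ip M (\<lambda>x. (w \<beta>2 x - w \<beta>1 x) *\<^sub>R g2 x) ?d \<le> L2norm M (\<lambda>x. (w \<beta>2 x - w \<beta>1 x) *\<^sub>R g2 x) * L2norm M ?d"
      using ip_Cauchy_Schwarz[OF wd(1) sqd] by simp
    also have "\<dots> \<le> (3 * (H + \<bar>R\<bar>)^2 * \<bar>\<beta>1 - \<beta>2\<bar> * L2norm M g2) * L2norm M ?d"
      by (intro mult_right_mono wd(2) L2norm_nonneg)
    also have "\<dots> \<le> (3 * (H + \<bar>R\<bar>)^2 * \<bar>\<beta>1 - \<beta>2\<bar> * (load_norm R / a^3)) * L2norm M ?d"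
      by (intro mult_right_mono mult_left_mono g2 L2norm_nonneg) auto
    also have "\<dots> = C * \<bar>\<beta>1 - \<beta>2\<bar> * L2norm M ?d" by (simp add: C_def)
    finally have t1: "ip M (\<lambda>x. (w \<beta>2 x - w \<beta>1 x) *\<^sub>R g2 x) ?d \<le> C * \<bar>\<beta>1 - \<beta>2\<bar> * L2norm M ?d" .
    have "- ((\<gamma>1 - \<gamma>2) * ip M (\<lambda>x. 1) (\<lambda>x. q1 x - q2 x)) \<le> \<bar>\<gamma>1 - \<gamma>2\<bar> * \<bar>ip M (\<lambda>x. 1) (\<lambda>x. q1 x - q2 x)\<bar>"
      unfolding abs_mult[symmetric] by (rule abs_ge_minus_self)
    also have "\<dots> \<le> \<bar>\<gamma>1 - \<gamma>2\<bar> * (one_norm * L2norm M ?d)"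
      by (intro mult_left_mono ip_one_le Hd) auto
    finally have t2: "- ((\<gamma>1 - \<gamma>2) * ip M (\<lambda>x. 1) (\<lambda>x. q1 x - q2 x)) \<le> \<bar>\<gamma>1 - \<gamma>2\<bar> * (one_norm * L2norm M ?d)" .
    have "a^3 * (L2norm M ?d)^2 \<le> \<beta>1^3 * (L2norm M ?d)^2"
      using b assms by (intro mult_right_mono power_mono) auto
    also have "\<dots> \<le> A \<beta>1 ?d ?d" using A_ge[OF _ sqd] pos by simp
    also have "\<dots> \<le> C * \<bar>\<beta>1 - \<beta>2\<bar> * L2norm M ?d + \<bar>\<gamma>1 - \<gamma>2\<bar> * (one_norm * L2norm M ?d)"
      using vi_sol_compare[OF pos s1 s2] t1 t2 by simp
    also have "\<dots> \<le> (C + one_norm) * (\<bar>\<beta>1 - \<beta>2\<bar> + \<bar>\<gamma>1 - \<gamma>2\<bar>) * L2norm M ?d"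
      using C one_norm_nonneg L2norm_nonneg[of M ?d] by (simp add: algebra_simps)
    finally have "a^3 * L2norm M ?d \<le> (C + one_norm) * (\<bar>\<beta>1 - \<beta>2\<bar> + \<bar>\<gamma>1 - \<gamma>2\<bar>)"
      using L2norm_nonneg[of M ?d] C one_norm_nonneg
      by (cases "L2norm M ?d = 0") (auto simp: power2_eq_square mult.assoc[symmetric])
    then have d: "L2norm M ?d \<le> (C + one_norm) / a^3 * (\<bar>\<beta>1 - \<beta>2\<bar> + \<bar>\<gamma>1 - \<gamma>2\<bar>)"
      using assms by (simp add: field_simps)
    have "\<bar>I \<beta>1 \<gamma>1 - I \<beta>2 \<gamma>2\<bar> = \<bar>ip M (\<lambda>x. 1) (\<lambda>x. q1 x - q2 x)\<bar>"
      using I_eq(2)[OF pos(1) s1] I_eq(2)[OF pos(2) s2] ip_diff_right[OF sq(1,3) sqint_one] by simp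
    also have "\<dots> \<le> one_norm * L2norm M ?d" by (rule ip_one_le[OF Hd])
    also have "\<dots> \<le> one_norm * ((C + one_norm) / a^3 * (\<bar>\<beta>1 - \<beta>2\<bar> + \<bar>\<gamma>1 - \<gamma>2\<bar>))"
      by (intro mult_left_mono d one_norm_nonneg)
    also have "\<dots> \<le> L * (\<bar>\<beta>1 - \<beta>2\<bar> + \<bar>\<gamma>1 - \<gamma>2\<bar>)" unfolding L_def by (simp add: algebra_simps)
    finally show ?thesis .
  qed
  then show ?thesis using L by blast
qed

end

section \<open>Lower bounds for the pressure\<close>

text \<open>The exponent 3 makes the cutoff twice continuously differentiable, so that
  \<open>bump'\<close> can itself be used in a test function.\<close>

definition bump :: "real \<Rightarrow> real" where "bump s = (max 0 (1 - s^2))^3"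
definition bump' :: "real \<Rightarrow> real" where "bump' s = - 6 * s * (max 0 (1 - s^2))^2"
definition bump'' :: "real \<Rightarrow> real" where
  "bump'' s = - 6 * (max 0 (1 - s^2))^2 + 24 * s^2 * max 0 (1 - s^2)"

text \<open>An exponent of at least 2 removes the kink: at 0 the difference quotient is bounded by a
  positive power of \<open>\<bar>h\<bar>\<close>.\<close>

lemma DERIV_max_power:
  "((\<lambda>u. (max 0 u)^(Suc (Suc n))) has_real_derivative real (Suc (Suc n)) * (max 0 u)^(Suc n)) (at u)"
proof (cases u "0::real" rule: linorder_cases)
  case less
  have "((\<lambda>u. 0) has_real_derivative 0) (at u)" by simp
  then have "((\<lambda>u. (max 0 u)^(Suc (Suc n))) has_real_derivative 0) (at u)"
    by (rule has_field_derivative_transform_within_open[where S = "{..<0}"]) (use less in auto)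
  then show ?thesis using less by simp
next
  case greater
  have "((\<lambda>u. u^(Suc (Suc n))) has_real_derivative real (Suc (Suc n)) * u^(Suc n)) (at u)"
    by (rule DERIV_cong[OF DERIV_pow]) simp
  then have "((\<lambda>u. (max 0 u)^(Suc (Suc n))) has_real_derivative real (Suc (Suc n)) * u^(Suc n)) (at u)"
    by (rule has_field_derivative_transform_within_open[where S = "{0<..}"]) (use greater in auto)
  then show ?thesis using greater by simp
next
  case equal
  have "((\<lambda>h::real. (max 0 h)^(Suc (Suc n)) / h) \<longlongrightarrow> 0) (at 0)"
  proof (rule Lim_null_comparison)
    show "\<forall>\<^sub>F h in at (0::real). norm ((max 0 h)^(Suc (Suc n)) / h) \<le> \<bar>h\<bar>^(Suc n)"
    proof (intro always_eventually allI)
      fix h :: real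
      show "norm ((max 0 h)^(Suc (Suc n)) / h) \<le> \<bar>h\<bar>^(Suc n)"
      proof (cases "0 < h")
        case False
        then have "norm ((max 0 h)^(Suc (Suc n)) / h) = 0" by simp
        then show ?thesis by (metis abs_ge_zero zero_le_power)
      qed simp
    qed
    show "((\<lambda>h::real. \<bar>h\<bar>^(Suc n)) \<longlongrightarrow> 0) (at 0)"
      using tendsto_power[OF tendsto_rabs[OF tendsto_ident_at[of "0::real" UNIV]], of "Suc n"] by simp
  qed
  then show ?thesis using equal by (simp add: DERIV_def)
qed

lemma DERIV_max_cube: "((\<lambda>u. (max 0 u)^3) has_real_derivative 3 * (max 0 u)^2) (at u)"
  and DERIV_max_square: "((\<lambda>u. (max 0 u)^2) has_real_derivative 2 * max 0 u) (at u)"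
proof -
  have n: "Suc 2 = 3" "Suc (Suc 0) = 2" "Suc 1 = 2" by simp_all
  show "((\<lambda>u. (max 0 u)^3) has_real_derivative 3 * (max 0 u)^2) (at u)"
    using DERIV_max_power[of 1 u] by (simp only: n of_nat_numeral)
  show "((\<lambda>u. (max 0 u)^2) has_real_derivative 2 * max 0 u) (at u)"
    using DERIV_max_power[of 0 u] by (simp only: n of_nat_numeral power_Suc0_right)
qed

lemma DERIV_one_minus_square: "((\<lambda>s::real. 1 - s^2) has_real_derivative - 2 * s) (at s)"
  by (auto intro!: derivative_eq_intros)

lemma DERIV_bump: "(bump has_real_derivative bump' s) (at s)"
  unfolding bump_def[abs_def] bump'_def
  using DERIV_chain2[OF DERIV_max_cube[of "1 - s^2"] DERIV_one_minus_square]
  by (rule DERIV_cong) simp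

lemma DERIV_bump': "(bump' has_real_derivative bump'' s) (at s)"
proof -
  have "((\<lambda>s::real. - 6 * s) has_real_derivative - 6) (at s)"
    by (auto intro!: derivative_eq_intros)
  from DERIV_mult[OF this DERIV_chain2[OF DERIV_max_square[of "1 - s^2"] DERIV_one_minus_square]]
  show ?thesis unfolding bump'_def[abs_def] bump''_def
    by (rule DERIV_cong) (simp add: power2_eq_square)
qed

lemma continuous_bump: "continuous_on S bump" "continuous_on S bump'" "continuous_on S bump''"
  unfolding bump_def[abs_def] bump'_def[abs_def] bump''_def[abs_def] by (intro continuous_intros)+

lemma bump_outside:
  assumes "1 < \<bar>s\<bar>" shows "bump s = 0" "bump' s = 0" "bump'' s = 0"
proof -
  have "1^2 < \<bar>s\<bar>^2" using assms by (intro power_strict_mono) auto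
  then have "1 < s^2" by simp
  then show "bump s = 0" "bump' s = 0" "bump'' s = 0" by (auto simp: bump_def bump'_def bump''_def)
qed

lemma bump_bounds: "0 \<le> bump s" "\<bar>bump s\<bar> \<le> 1" "\<bar>bump' s\<bar> \<le> 6" "\<bar>bump'' s\<bar> \<le> 30"
proof -
  let ?m = "max 0 (1 - s^2)"
  have m: "0 \<le> ?m" "?m \<le> 1" by auto
  show nn: "0 \<le> bump s" by (simp add: bump_def)
  have "bump s \<le> 1" unfolding bump_def using m by (rule power_le_one)
  then show "\<bar>bump s\<bar> \<le> 1" using nn by simp
  have m2: "0 \<le> ?m^2" "?m^2 \<le> 1" using m by (auto intro: power_le_one)
  show "\<bar>bump' s\<bar> \<le> 6"
  proof (cases "1 < \<bar>s\<bar>")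
    case False
    then have "\<bar>s\<bar> * ?m^2 \<le> 1 * 1" by (intro mult_mono m2) auto
    then show ?thesis using m2 by (simp add: bump'_def abs_mult)
  qed (simp add: bump_outside)
  show "\<bar>bump'' s\<bar> \<le> 30"
  proof (cases "1 < \<bar>s\<bar>")
    case False
    then have "s^2 \<le> 1" by (simp add: abs_square_le_1)
    then have "s^2 * ?m \<le> 1 * 1" by (intro mult_mono m) auto
    moreover have "0 \<le> s^2 * ?m" by (intro mult_nonneg_nonneg m) auto
    ultimately show ?thesis using m2 unfolding bump''_def by linarith
  qed (simp add: bump_outside)
qed

text \<open>On the inner half \<open>1 - s^2 \<ge> 3/4\<close>, and
  \<open>(3/4)^3 = 27/64\<close>.\<close>

lemma bump_half: "\<bar>s\<bar> \<le> 1/2 \<Longrightarrow> 27/64 \<le> bump s"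
proof -
  assume "\<bar>s\<bar> \<le> 1/2"
  then have "\<bar>s\<bar>^2 \<le> (1/2)^2" by (intro power_mono) auto
  then have "s^2 \<le> 1/4" by (simp add: power_divide)
  then have "3/4 \<le> max 0 (1 - s^2)" by linarith
  then have "(3/4)^3 \<le> bump s" unfolding bump_def by (rule power_mono) simp
  then show ?thesis by (simp add: power3_eq_cube)
qed

text \<open>\<open>d\<close> and \<open>l\<close> are half side lengths, whence the area
  \<open>4 * d * l\<close>.\<close>

definition rect :: "real^2 \<Rightarrow> real \<Rightarrow> real \<Rightarrow> (real^2) set" where
  "rect c d l = {x. \<bar>x $ 1 - c $ 1\<bar> \<le> d \<and> \<bar>x $ 2 - c $ 2\<bar> \<le> l}"

lemma rect_eq_cbox: "rect c d l = cbox (vector [c $ 1 - d, c $ 2 - l]) (vector [c $ 1 + d, c $ 2 + l])"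
  by (auto simp: rect_def mem_box_cart forall_2)

lemma measure_rect:
  assumes "0 \<le> d" "0 \<le> l"
  shows "measure lborel (rect c d l) = 4 * d * l"
proof -
  have "rect c d l \<noteq> {}" using assms by (auto simp: rect_def intro!: exI[of _ c])
  then show ?thesis unfolding rect_eq_cbox measure_lborel_cbox_eq[symmetric]
    by (simp add: content_cbox_cart prod.reindex UNIV_2)
qed

text \<open>Stated for two arbitrary profiles because the bump itself and both of its rescaled
  partial derivatives have this product form.\<close>

lemma Cc1_tensor:
  assumes f: "\<And>s. (f has_real_derivative f' s) (at s)" "continuous_on UNIV f'" "\<And>s. 1 < \<bar>s\<bar> \<Longrightarrow> f s = 0"
    and g: "\<And>s. (g has_real_derivative g' s) (at s)" "continuous_on UNIV g'" "\<And>s. 1 < \<bar>s\<bar> \<Longrightarrow> g s = 0"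
    and pos: "0 < d" "0 < l" and sub: "rect c d l \<subseteq> \<Omega>"
  shows "Cc1 \<Omega> (\<lambda>x. f ((x $ 1 - c $ 1) / d) * g ((x $ 2 - c $ 2) / l))
     (\<lambda>x. vector [f' ((x $ 1 - c $ 1) / d) / d * g ((x $ 2 - c $ 2) / l), f ((x $ 1 - c $ 1) / d) * (g' ((x $ 2 - c $ 2) / l) / l)])"
    (is "Cc1 \<Omega> ?\<phi> ?D")
proof -
  have contf: "continuous_on UNIV f" and contg: "continuous_on UNIV g"
    using f(1) g(1) DERIV_continuous_on by blast+
  have cont: "continuous_on UNIV (\<lambda>x::real^2. k ((x $ i - b) / a))" if "continuous_on UNIV k" "0 < a" for k :: "real \<Rightarrow> real" and i b a
    by (rule continuous_on_compose2[OF that(1)]) (use that in \<open>auto intro!: continuous_intros\<close>)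
  have D1: "continuous_on UNIV (\<lambda>x. ?D x)"
  proof -
    have "continuous_on UNIV (\<lambda>x. \<chi> i. ?D x $ i)"
    proof (rule continuous_on_vec_lambda)
      fix i :: 2
      show "continuous_on UNIV (\<lambda>x. ?D x $ i)"
        using exhaust_2[of i] pos
        by (elim disjE; simp) (intro continuous_intros cont f(2) g(2) contf contg; simp)+
    qed
    then show ?thesis by simp
  qed
  have D2: "(?\<phi> has_derivative (\<lambda>v. ?D x \<bullet> v)) (at x)" for x
  proof -
    have lin: "((\<lambda>x::real^2. (x $ i - b) / a) has_derivative (\<lambda>v. v $ i / a)) (at x)" for i b a
    proof -
      have "((\<lambda>x::real^2. (x $ i - b) * inverse a) has_derivative (\<lambda>v. (v $ i - 0) * inverse a)) (at x)"
        by (intro has_derivative_mult_left has_derivative_diff has_derivative_const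
            bounded_linear_imp_has_derivative bounded_linear_vec_nth)
      then show ?thesis by (simp add: divide_inverse)
    qed
    have F: "((\<lambda>x. f ((x $ 1 - c $ 1) / d)) has_derivative (\<lambda>v. f' ((x $ 1 - c $ 1) / d) * (v $ 1 / d))) (at x)"
      using has_derivative_compose[OF lin f(1)[unfolded has_field_derivative_def]] .
    have Gd: "((\<lambda>x. g ((x $ 2 - c $ 2) / l)) has_derivative (\<lambda>v. g' ((x $ 2 - c $ 2) / l) * (v $ 2 / l))) (at x)"
      using has_derivative_compose[OF lin g(1)[unfolded has_field_derivative_def]] .
    show ?thesis
      by (rule has_derivative_eq_rhs[OF has_derivative_mult[OF F Gd]])
         (auto simp: inner_vec_def sum_2 algebra_simps)
  qed
  have "?\<phi> x = 0" if "x \<notin> rect c d l" for x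
  proof -
    have "1 < \<bar>(x $ 1 - c $ 1) / d\<bar> \<or> 1 < \<bar>(x $ 2 - c $ 2) / l\<bar>"
      using that pos by (auto simp: rect_def)
    then show ?thesis using f(3) g(3) by auto
  qed
  moreover have "compact (rect c d l)" unfolding rect_eq_cbox by (rule compact_cbox)
  ultimately show ?thesis unfolding Cc1_def using D1 D2 sub by blast
qed

section \<open>The lower bound by a bump test function\<close>

context gap_domain
begin

text \<open>Test the variational inequality with \<open>p(x) = bump ((x\<^sub>1 - c\<^sub>1) / d) bump ((x\<^sub>2 - c\<^sub>2) / l)\<close>.
  Two integrations by parts turn the elliptic form into an integral of \<open>q\<close> against a bounded function,
  so that no comparison principle is needed.\<close>

lemma I_lower_bound:
  assumes D: "\<And>x. x \<in> \<Omega> \<Longrightarrow> (h0 has_derivative (\<lambda>v. D x \<bullet> v)) (at x)" "continuous_on \<Omega> D"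
    and pos: "0 < \<beta>" "\<gamma> \<le> 0" "0 < d" "d \<le> l" "0 \<le> C" and sub: "rect c d l \<subseteq> \<Omega>"
    and h0_le: "\<And>x. x \<in> rect c d l \<Longrightarrow> h0 x \<le> C * \<beta>"
    and D_le: "\<And>x. x \<in> rect c d l \<Longrightarrow> D x $ 1 \<le> - \<kappa> * (\<beta> / d)" "\<And>x. x \<in> rect c d l \<Longrightarrow> norm (D x) \<le> C * (\<beta> / d)"
    and "0 \<le> \<kappa>"
  shows "(27/64)^2 * (d * l) * (\<kappa> * (\<beta> / d) + \<bar>\<gamma>\<bar>) \<le> 96 * (C + 1)^3 * (\<beta>^3 / d^2) * I \<beta> \<gamma>"
proof -
  have "0 < l" using pos by simp
  define s1 where "s1 x = (x $ 1 - c $ 1) / d" for x :: "real^2"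
  define s2 where "s2 x = (x $ 2 - c $ 2) / l" for x :: "real^2"
  define p where "p x = bump (s1 x) * bump (s2 x)" for x
  define Dp where "Dp x = (vector [bump' (s1 x) / d * bump (s2 x), bump (s1 x) * (bump' (s2 x) / l)] :: real^2)" for x
  \<comment> \<open>Up to the factors \<open>d\<close> and \<open>l\<close>, \<open>p1\<close> and
    \<open>p2\<close> are the partial derivatives of \<open>p\<close>. They are again test functions
    supported in the rectangle.\<close>
  define p1 where "p1 x = bump' (s1 x) * bump (s2 x)" for x
  define Dp1 where "Dp1 x = (vector [bump'' (s1 x) / d * bump (s2 x), bump' (s1 x) * (bump' (s2 x) / l)] :: real^2)" for x
  define p2 where "p2 x = bump (s1 x) * bump' (s2 x)" for x
  define Dp2 where "Dp2 x = (vector [bump' (s1 x) / d * bump' (s2 x), bump (s1 x) * (bump'' (s2 x) / l)] :: real^2)" for x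
  have Cp: "Cc1 \<Omega> p Dp" "Cc1 \<Omega> p1 Dp1" "Cc1 \<Omega> p2 Dp2"
    unfolding p_def[abs_def] Dp_def[abs_def] p1_def[abs_def] Dp1_def[abs_def] p2_def[abs_def] Dp2_def[abs_def] s1_def s2_def
    by (rule Cc1_tensor[OF _ _ _ _ _ _ \<open>0 < d\<close> \<open>0 < l\<close> sub],
        rule DERIV_bump DERIV_bump', rule continuous_bump, erule bump_outside,
        rule DERIV_bump DERIV_bump', rule continuous_bump, erule bump_outside)+
  have out: "p x = 0" "p1 x = 0" "p2 x = 0" "Dp1 x $ 1 = 0" "Dp2 x $ 2 = 0" if "x \<notin> rect c d l" for x
  proof -
    have "1 < \<bar>s1 x\<bar> \<or> 1 < \<bar>s2 x\<bar>"
      using that \<open>0 < d\<close> \<open>0 < l\<close> by (auto simp: rect_def s1_def s2_def)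
    then show "p x = 0" "p1 x = 0" "p2 x = 0" "Dp1 x $ 1 = 0" "Dp2 x $ 2 = 0"
      by (auto simp: p_def p1_def p2_def Dp1_def Dp2_def bump_outside)
  qed
  have p_nonneg: "0 \<le> p x" for x by (simp add: p_def bump_bounds)
  have Kp: "inK \<Omega> p Dp" unfolding inK_def using H10_Cc1[OF Cp(1)] p_nonneg by simp
  obtain q g where s: "vi_sol \<Omega> h0 \<beta> \<gamma> q g" using vi_sol_exists[OF pos(1)] by blast
  have Hq: "H10 \<Omega> q g" by (rule vi_sol_H10[OF s])
  note sq = H10_sqint[OF Hq]
  have wg: "(\<integral>x. q x * D\<phi> x $ i \<partial>M) = - (\<integral>x. g x $ i * \<phi> x \<partial>M)" if "Cc1 \<Omega> \<phi> D\<phi>" for \<phi> D\<phi> i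
    using Hq that unfolding H10_def weak_grad_def M_def by blast
  have q_nonneg: "AE x in M. 0 \<le> q x" using s unfolding vi_sol_def inK_def M_def by blast

  define Dw where "Dw x = (3 * (h0 x + \<beta>)^2) *\<^sub>R D x" for x
  have Dw: "(w \<beta> has_derivative (\<lambda>v. Dw x \<bullet> v)) (at x)" if "x \<in> \<Omega>" for x
  proof -
    have "((\<lambda>x. (h0 x + \<beta>)^3) has_derivative (\<lambda>v. real 3 * (D x \<bullet> v + 0) * (h0 x + \<beta>)^(3 - 1))) (at x)"
      by (intro has_derivative_power has_derivative_add D that has_derivative_const)
    then show ?thesis unfolding w_def[abs_def]
      by (rule has_derivative_eq_rhs) (auto simp: Dw_def)
  qed
  have h0_cont: "continuous_on \<Omega> h0"
    using D(1) by (meson continuous_at_imp_continuous_on has_derivative_continuous)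
  have Dw_cont: "continuous_on \<Omega> Dw" unfolding Dw_def by (intro continuous_intros D h0_cont)
  \<comment> \<open>The weighted derivatives \<open>w p1\<close> and \<open>w p2\<close> are
    legitimate test functions in the weak gradient identity for \<open>q\<close>; this moves the
    gradient off \<open>q\<close>.\<close>
  define V1 where "V1 x = (if x \<in> \<Omega> then w \<beta> x * p1 x else 0)" for x
  define V2 where "V2 x = (if x \<in> \<Omega> then w \<beta> x * p2 x else 0)" for x
  define DV1 where "DV1 x = (if x \<in> \<Omega> then w \<beta> x *\<^sub>R Dp1 x + p1 x *\<^sub>R Dw x else 0)" for x
  define DV2 where "DV2 x = (if x \<in> \<Omega> then w \<beta> x *\<^sub>R Dp2 x + p2 x *\<^sub>R Dw x else 0)" for x
  have CV1: "Cc1 \<Omega> V1 DV1" unfolding V1_def[abs_def] DV1_def[abs_def]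
    by (rule Cc1_mult[OF Cp(2) \<Omega>(1) Dw Dw_cont])
  have CV2: "Cc1 \<Omega> V2 DV2" unfolding V2_def[abs_def] DV2_def[abs_def]
    by (rule Cc1_mult[OF Cp(3) \<Omega>(1) Dw Dw_cont])
  note CV = CV1 CV2
  have sV: "sqint M V1" "sqint M V2" "sqint M (\<lambda>x. DV1 x $ 1)" "sqint M (\<lambda>x. DV2 x $ 2)"
    using Cc1_sqint[OF CV(1) \<Omega>, folded M_def] Cc1_sqint[OF CV(2) \<Omega>, folded M_def] sqint_vec by blast+
  have sg: "sqint M (\<lambda>x. g x $ i)" for i using sq(2) sqint_vec by blast

  have "A \<beta> g Dp = (\<integral>x. (g x $ 1 \<bullet> V1 x) / d + (g x $ 2 \<bullet> V2 x) / l \<partial>M)"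
    unfolding A_def ip_def
    by (rule Bochner_Integration.integral_cong)
       (auto simp: space_M V1_def V2_def Dp_def p1_def p2_def inner_vec_def sum_2 algebra_simps)
  also have "\<dots> = (\<integral>x. g x $ 1 \<bullet> V1 x \<partial>M) / d + (\<integral>x. g x $ 2 \<bullet> V2 x \<partial>M) / l"
    using sqint_inner_integrable[OF sg sV(1)] sqint_inner_integrable[OF sg sV(2)] by simp
  also have "\<dots> = - (\<integral>x. q x * DV1 x $ 1 \<partial>M) / d - (\<integral>x. q x * DV2 x $ 2 \<partial>M) / l"
    using wg[OF CV(1), of 1] wg[OF CV(2), of 2] by simp
  also have "\<dots> = (\<integral>x. q x * (- (DV1 x $ 1) / d - DV2 x $ 2 / l) \<partial>M)"
    using sqint_inner_integrable[OF sq(1) sV(3)] sqint_inner_integrable[OF sq(1) sV(4)]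
    by (simp add: right_diff_distrib)
  finally have A_eq: "A \<beta> g Dp = (\<integral>x. q x * (- (DV1 x $ 1) / d - DV2 x $ 2 / l) \<partial>M)" .

  \<comment> \<open>\<open>48 = 30 + 6 * 3\<close>: the bound 30 for \<open>bump''\<close>, and the
    bound 6 for \<open>bump'\<close> times the 3 from differentiating the cube. \<open>C + 1\<close>
    appears since \<open>h0 + \<beta> \<le> (C + 1) * \<beta>\<close> on the rectangle.\<close>
  define K where "K = 48 * (C + 1)^3 * (\<beta>^3 / d^2)"
  have K_nonneg: "0 \<le> K" using pos by (simp add: K_def)
  \<comment> \<open>One estimate for both directions, used with \<open>e = d\<close> and
    \<open>e = l\<close>; by \<open>d \<le> e\<close> all inverse lengths are bounded by
    \<open>1 / d\<close>.\<close>
  have ess: "\<bar>w \<beta> x * a + b * (3 * (h0 x + \<beta>)^2 * D x $ i)\<bar> / e \<le> K"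
    if x: "x \<in> rect c d l" and a: "\<bar>a\<bar> \<le> 30 / e" and b: "\<bar>b\<bar> \<le> 6" and e: "d \<le> e" for x a b e i
  proof -
    have "0 < e" using e pos by simp
    have h: "0 \<le> h0 x + \<beta>" "h0 x + \<beta> \<le> (C + 1) * \<beta>"
      using h0_le[OF x] h0_bounds[of x] x sub pos by (auto simp: algebra_simps)
    have w: "0 \<le> w \<beta> x" "w \<beta> x \<le> ((C + 1) * \<beta>)^3" unfolding w_def using h by (auto intro: power_mono)
    have "\<bar>D x $ i\<bar> \<le> C * (\<beta> / d)" using D_le(2)[OF x] component_le_norm_cart order_trans by blast
    then have Di: "\<bar>D x $ i\<bar> \<le> (C + 1) * (\<beta> / d)" using pos by (simp add: field_simps)
    have h2: "(h0 x + \<beta>)^2 \<le> ((C + 1) * \<beta>)^2" using h by (intro power_mono)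
    have "\<bar>w \<beta> x * a + b * (3 * (h0 x + \<beta>)^2 * D x $ i)\<bar> \<le> w \<beta> x * \<bar>a\<bar> + \<bar>b\<bar> * (3 * ((h0 x + \<beta>)^2 * \<bar>D x $ i\<bar>))"
      by (rule order_trans[OF abs_triangle_ineq]) (use w in \<open>simp add: abs_mult\<close>)
    also have "\<dots> \<le> ((C + 1) * \<beta>)^3 * (30 / e) + 6 * (3 * (((C + 1) * \<beta>)^2 * ((C + 1) * (\<beta> / d))))"
      using w a b Di h2 pos \<open>0 < e\<close> by (intro add_mono mult_mono) auto
    also have "\<dots> \<le> ((C + 1) * \<beta>)^3 * (30 / d) + 6 * (3 * (((C + 1) * \<beta>)^2 * ((C + 1) * (\<beta> / d))))"
      using e pos by (intro add_mono mult_left_mono divide_left_mono) auto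
    also have "\<dots> = 48 * (C + 1)^3 * (\<beta>^3 / d)" using pos by (simp add: field_simps power2_eq_square power3_eq_cube)
    finally have "\<bar>w \<beta> x * a + b * (3 * (h0 x + \<beta>)^2 * D x $ i)\<bar> / e \<le> 48 * (C + 1)^3 * (\<beta>^3 / d) / d"
      using e pos by (intro frac_le) auto
    then show ?thesis by (simp add: K_def power2_eq_square)
  qed
  have DV_le: "- (DV1 x $ 1) / d - DV2 x $ 2 / l \<le> 2 * K" if "x \<in> \<Omega>" for x
  proof (cases "x \<in> rect c d l")
    case True
    have "\<bar>Dp1 x $ 1\<bar> \<le> 30 / d" "\<bar>Dp2 x $ 2\<bar> \<le> 30 / l"
      using bump_bounds[of "s1 x"] bump_bounds[of "s2 x"] pos \<open>0 < l\<close>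
        mult_mono[of "\<bar>bump'' (s1 x)\<bar>" 30 "\<bar>bump (s2 x)\<bar>" 1] mult_mono[of "\<bar>bump (s1 x)\<bar>" 1 "\<bar>bump'' (s2 x)\<bar>" 30]
      by (auto simp: Dp1_def Dp2_def abs_mult divide_right_mono)
    moreover have "\<bar>p1 x\<bar> \<le> 6" "\<bar>p2 x\<bar> \<le> 6"
      using bump_bounds[of "s1 x"] bump_bounds[of "s2 x"]
        mult_mono[of "\<bar>bump' (s1 x)\<bar>" 6 "\<bar>bump (s2 x)\<bar>" 1] mult_mono[of "\<bar>bump (s1 x)\<bar>" 1 "\<bar>bump' (s2 x)\<bar>" 6]
      by (auto simp: p1_def p2_def abs_mult)
    ultimately have "\<bar>DV1 x $ 1\<bar> / d \<le> K" "\<bar>DV2 x $ 2\<bar> / l \<le> K"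
      using ess[OF True, of "Dp1 x $ 1" d "p1 x" 1] ess[OF True, of "Dp2 x $ 2" l "p2 x" 2] that pos
      by (auto simp: DV1_def DV2_def Dw_def mult.assoc)
    moreover have "- (DV1 x $ 1) / d \<le> \<bar>DV1 x $ 1\<bar> / d" "- (DV2 x $ 2 / l) \<le> \<bar>DV2 x $ 2\<bar> / l"
      using pos \<open>0 < l\<close> by (auto simp: field_simps)
    ultimately show ?thesis by linarith
  next
    case False
    then show ?thesis using out[OF False] K_nonneg that by (simp add: DV1_def DV2_def)
  qed
  \<comment> \<open>The constraint \<open>q \<ge> 0\<close> lets the pointwise upper bound on the
    second factor be integrated against \<open>q\<close>.\<close>
  have "A \<beta> g Dp \<le> (\<integral>x. q x * (2 * K) \<partial>M)"
    unfolding A_eq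
  proof (rule integral_mono_AE)
    show "integrable M (\<lambda>x. q x * (- (DV1 x $ 1) / d - DV2 x $ 2 / l))"
      using sqint_inner_integrable[OF sq(1) sV(3)] sqint_inner_integrable[OF sq(1) sV(4)]
      by (simp add: right_diff_distrib)
    show "integrable M (\<lambda>x. q x * (2 * K))"
      using sqint_integrable(1)[OF finite_measure_M sq(1)] by simp
    show "AE x in M. q x * (- (DV1 x $ 1) / d - DV2 x $ 2 / l) \<le> q x * (2 * K)"
      using q_nonneg AE_space[of M]
      by eventually_elim (intro mult_left_mono DV_le, auto simp: space_M)
  qed
  also have "\<dots> = 2 * K * I \<beta> \<gamma>" by (simp add: I_eq(1)[OF pos(1) s] mult.commute)
  finally have upper: "load \<gamma> p Dp \<le> 2 * K * I \<beta> \<gamma>"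
    using vi_sol_test[OF pos(1) s Kp] by simp

  have sp: "sqint M p" using Cc1_sqint[OF Cp(1) \<Omega>, folded M_def] by simp
  note p_int = sqint_integrable(1)[OF finite_measure_M sp]
  define P where "P = (\<integral>x. p x \<partial>M)"
  \<comment> \<open>Lower bound for the load: on the support of \<open>p\<close> the gap decreases
    in the first coordinate at rate at least \<open>\<kappa> * (\<beta> / d)\<close>, and
    integration by parts identifies the result with the wedge term.\<close>
  have "(\<kappa> * (\<beta> / d)) * P = (\<integral>x. (\<kappa> * (\<beta> / d)) * p x \<partial>M)" by (simp add: P_def)
  also have "\<dots> \<le> (\<integral>x. - (D x $ 1 * p x) \<partial>M)"
  proof (rule integral_mono)
    obtain Cs where Cs: "compact Cs" "Cs \<subseteq> \<Omega>" "\<forall>x. x \<notin> Cs \<longrightarrow> p x = 0" using Cp(1) by (auto simp: Cc1_def)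
    show "integrable M (\<lambda>x. - (D x $ 1 * p x))" unfolding M_def
      by (rule integrable_compact_support[OF \<Omega> _ Cs(1,2)])
         (use Cs in \<open>auto intro!: continuous_intros D Cc1_continuous[OF Cp(1)]\<close>)
    show "integrable M (\<lambda>x. \<kappa> * (\<beta> / d) * p x)" using p_int by simp
    show "\<kappa> * (\<beta> / d) * p x \<le> - (D x $ 1 * p x)" for x
    proof (cases "x \<in> rect c d l")
      case True
      have "\<kappa> * (\<beta> / d) * p x \<le> - (D x $ 1) * p x"
        using D_le(1)[OF True] by (intro mult_right_mono p_nonneg) linarith
      then show ?thesis by simp
    qed (simp add: out)
  qed
  also have "\<dots> = (\<integral>x. h0 x * Dp x $ 1 \<partial>M)"
    using Cc1_integral_by_parts[OF Cp(1) \<Omega> D, of 1, folded M_def] by simp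
  also have "\<dots> = ip M wedge Dp" by (simp add: ip_def wedge_def inner_axis')
  finally have "(\<kappa> * (\<beta> / d) + \<bar>\<gamma>\<bar>) * P \<le> load \<gamma> p Dp"
    using pos(2) by (simp add: load_def P_def ip_def algebra_simps)
  then have lower: "(\<kappa> * (\<beta> / d) + \<bar>\<gamma>\<bar>) * P \<le> 2 * K * I \<beta> \<gamma>" using upper by simp

  \<comment> \<open>The rectangle of half the size has area \<open>d * l\<close>, and each factor of
    \<open>p\<close> is at least \<open>27/64\<close> on it.\<close>
  let ?R = "rect c (d / 2) (l / 2)"
  have R_sub: "?R \<subseteq> \<Omega>" using sub pos \<open>0 < l\<close> by (force simp: rect_def)
  have R_meas: "?R \<in> sets lebesgue" unfolding rect_eq_cbox by simp
  have "(27/64)^2 * (d * l) = (27/64)^2 * measure M ?R"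
  proof -
    have "measure M ?R = measure lebesgue ?R"
      unfolding M_def using R_sub R_meas \<Omega> by (intro measure_restrict_space) auto
    also have "\<dots> = measure lborel ?R" unfolding rect_eq_cbox by simp
    finally show ?thesis using measure_rect[of "d/2" "l/2" c] pos by simp
  qed
  also have "\<dots> = (\<integral>x. (27/64)^2 * indicator ?R x \<partial>M)"
    using R_sub by (simp add: space_M Int_absorb2)
  also have "\<dots> \<le> P" unfolding P_def
  proof (rule integral_mono)
    have "?R \<in> sets M" unfolding M_def using R_sub R_meas \<Omega> by (auto simp: sets_restrict_space_iff)
    then show "integrable M (\<lambda>x. (27/64)^2 * indicator ?R x :: real)"
      using finite_measure.emeasure_finite[OF finite_measure_M, of ?R]
      by (intro integrable_mult_right integrable_real_indicator) (auto simp: top.not_eq_extremum)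
    show "(27/64)^2 * indicator ?R x \<le> p x" for x
    proof (cases "x \<in> ?R")
      case True
      then have "\<bar>s1 x\<bar> \<le> 1/2" "\<bar>s2 x\<bar> \<le> 1/2"
        using pos \<open>0 < l\<close> by (auto simp: rect_def s1_def s2_def field_simps)
      then have "27/64 * (27/64) \<le> p x" unfolding p_def
        by (intro mult_mono bump_half) (auto simp: bump_bounds)
      then show ?thesis using True by (simp add: power2_eq_square)
    qed (simp add: p_nonneg)
  qed (rule p_int)
  finally have "(27/64)^2 * (d * l) * (\<kappa> * (\<beta> / d) + \<bar>\<gamma>\<bar>) \<le> P * (\<kappa> * (\<beta> / d) + \<bar>\<gamma>\<bar>)"
    by (rule mult_right_mono) (use pos \<open>0 \<le> \<kappa>\<close> in \<open>intro add_nonneg_nonneg mult_nonneg_nonneg; simp\<close>)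
  then show ?thesis using lower by (simp add: K_def mult_ac)
qed

end

section \<open>Ordinary differential equations\<close>

text \<open>The derivative is taken within a larger set \<open>S\<close> because
  \<open>ode_sol\<close> differentiates within the interval of existence, which is one-sided at
  0.\<close>

lemma nondecreasing_of_deriv_within:
  fixes f f' :: "real \<Rightarrow> real"
  assumes "a \<le> b" "{a..b} \<subseteq> S"
    and "\<And>x. x \<in> {a..b} \<Longrightarrow> (f has_real_derivative f' x) (at x within S)"
    and "\<And>x. x \<in> {a..b} \<Longrightarrow> 0 \<le> f' x"
  shows "f a \<le> f b"
proof -
  have "\<exists>x\<in>{a..b}. f b - f a = (\<lambda>h. f' x * h) (b - a)"
  proof (rule mvt_very_simple[OF \<open>a \<le> b\<close>])
    fix x assume "a \<le> x" "x \<le> b"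
    then have "(f has_real_derivative f' x) (at x within {a..b})"
      using assms(2,3) DERIV_subset by (metis atLeastAtMost_iff)
    then show "(f has_derivative (\<lambda>h. f' x * h)) (at x within {a..b})"
      by (simp add: has_field_derivative_def)
  qed
  then obtain x where x: "x \<in> {a..b}" "f b - f a = f' x * (b - a)" by auto
  then have "0 \<le> f b - f a" using assms(1,4) by simp
  then show ?thesis by simp
qed

text \<open>Picard's theorem; the weight \<open>exp (- 2 L t)\<close> makes the integral operator a contraction
  on the whole interval at once.\<close>

lemma lipschitz_ode_exists:
  fixes f :: "'a::banach \<Rightarrow> 'a"
  assumes lip: "\<And>x y. norm (f x - f y) \<le> L * norm (x - y)" and "0 < L"
    and bound: "\<And>x. norm (f x) \<le> B" and "0 \<le> \<tau>"
  shows "\<exists>y. y 0 = y0 \<and> (\<forall>t\<in>{0..\<tau>}. (y has_vector_derivative f (y t)) (at t within {0..\<tau>}))"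
proof -
  have contf: "continuous_on UNIV f"
    by (rule lipschitz_on_continuous_on[of L], rule lipschitz_onI)
       (use lip \<open>0 < L\<close> in \<open>auto simp: dist_norm\<close>)
  \<comment> \<open>Freezing time outside \<open>[0, \<tau>]\<close> turns functions on the interval
    into bounded continuous functions on the whole line, a complete space.\<close>
  define c where "c t = max 0 (min \<tau> t)" for t
  have c: "c t \<in> {0..\<tau>}" for t using \<open>0 \<le> \<tau>\<close> by (auto simp: c_def)
  have cid: "c t = t" if "t \<in> {0..\<tau>}" for t using that by (auto simp: c_def)
  have contc: "continuous_on UNIV c" unfolding c_def by (intro continuous_intros)
  define Q where "Q z t = y0 + integral {0..t} (\<lambda>s. f (exp (2*L * s) *\<^sub>R apply_bcontfun z s))"
    for z :: "real \<Rightarrow>\<^sub>C 'a" and t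
  \<comment> \<open>The unknown of the fixed point equation is \<open>exp (- 2 * L * t)\<close>
    times the solution; \<open>Q\<close> undoes the weight inside the integral.\<close>
  define P where "P z t = exp (- 2*L*c t) *\<^sub>R Q z (c t)" for z :: "real \<Rightarrow>\<^sub>C 'a" and t
  have contg: "continuous_on S (\<lambda>s. f (exp (2*L * s) *\<^sub>R apply_bcontfun z s))" for S and z :: "real \<Rightarrow>\<^sub>C 'a"
    by (intro continuous_on_compose2[OF contf] continuous_intros) auto
  have contQ: "continuous_on {0..\<tau>} (Q z)" for z
    unfolding Q_def by (intro continuous_intros indefinite_integral_continuous_1
        integrable_continuous_interval contg)
  have Pb: "P z \<in> bcontfun" for z
  proof -
    have contP: "continuous_on UNIV (P z)" unfolding P_def
      by (intro continuous_intros continuous_on_compose2[OF contQ] contc) (use c contc in auto)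
    have "norm (P z t) \<le> norm y0 + B * \<tau>" for t
    proof -
      have "norm (integral {0..c t} (\<lambda>s. f (exp (2*L * s) *\<^sub>R apply_bcontfun z s)))
          \<le> integral {0..c t} (\<lambda>s. B)"
        by (intro integral_norm_bound_integral integrable_continuous_interval contg continuous_intros bound)
      also have "\<dots> = B * c t" using c[of t] by simp
      also have "\<dots> \<le> B * \<tau>"
        using c[of t] order_trans[OF norm_ge_zero bound[of 0]] by (intro mult_left_mono) auto
      finally have "norm (Q z (c t)) \<le> norm y0 + B * \<tau>"
        unfolding Q_def by (metis add_left_mono norm_triangle_ineq order_trans)
      moreover have "norm (P z t) \<le> norm (Q z (c t))"
        unfolding P_def norm_scaleR
        by (rule mult_left_le_one_le) (use c[of t] \<open>0 < L\<close> in auto)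
      ultimately show ?thesis by linarith
    qed
    then show ?thesis by (rule bcontfun_normI[OF contP])
  qed
  define PP where "PP z = Bcontfun (P z)" for z
  have PP: "apply_bcontfun (PP z) t = P z t" for z t
    unfolding PP_def by (simp add: Bcontfun_inverse[OF Pb])
  have contraction: "dist (PP z) (PP w) \<le> 1/2 * dist z w" for z w
  proof (rule dist_bound)
    fix t
    have "norm (Q z (c t) - Q w (c t)) =
       norm (integral {0..c t} (\<lambda>s. f (exp (2*L * s) *\<^sub>R apply_bcontfun z s) - f (exp (2*L * s) *\<^sub>R apply_bcontfun w s)))"
      unfolding Q_def by (subst integral_diff) (auto intro!: integrable_continuous_interval contg)
    also have "\<dots> \<le> integral {0..c t} (\<lambda>s. L * dist z w * exp (2*L * s))"
    proof (intro integral_norm_bound_integral integrable_continuous_interval continuous_intros contg)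
      fix s
      have "norm (f (exp (2*L * s) *\<^sub>R apply_bcontfun z s) - f (exp (2*L * s) *\<^sub>R apply_bcontfun w s))
         \<le> L * norm (exp (2*L * s) *\<^sub>R apply_bcontfun z s - exp (2*L * s) *\<^sub>R apply_bcontfun w s)"
        by (rule lip)
      also have "\<dots> = L * (exp (2*L * s) * dist (apply_bcontfun z s) (apply_bcontfun w s))"
        by (simp add: scaleR_diff_right[symmetric] dist_norm)
      also have "\<dots> \<le> L * (exp (2*L * s) * dist z w)"
        using \<open>0 < L\<close> by (intro mult_left_mono dist_bounded) auto
      finally show "norm (f (exp (2*L * s) *\<^sub>R apply_bcontfun z s) - f (exp (2*L * s) *\<^sub>R apply_bcontfun w s))
         \<le> L * dist z w * exp (2*L * s)" by (simp add: mult_ac)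
    qed
    \<comment> \<open>Integrating \<open>L * exp (2 * L * s)\<close> yields the contraction factor
      \<open>L / (2 * L) = 1/2\<close>, whatever the length of the interval.\<close>
    also have "\<dots> = dist z w / 2 * (exp (2*L*c t) - 1)"
    proof (rule integral_unique)
      have "((\<lambda>s. L * dist z w * exp (2*L * s)) has_integral
         dist z w / 2 * exp (2*L*c t) - dist z w / 2 * exp (2*L*0)) {0..c t}"
        using c[of t]
        by (intro fundamental_theorem_of_calculus)
           (auto intro!: derivative_eq_intros simp: has_real_derivative_iff_has_vector_derivative[symmetric])
      then show "((\<lambda>s. L * dist z w * exp (2*L * s)) has_integral dist z w / 2 * (exp (2*L*c t) - 1)) {0..c t}"
        by (simp add: algebra_simps)
    qed
    finally have *: "norm (Q z (c t) - Q w (c t)) \<le> dist z w / 2 * (exp (2*L*c t) - 1)" .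
    have "dist (P z t) (P w t) = exp (- 2*L*c t) * norm (Q z (c t) - Q w (c t))"
      unfolding P_def dist_norm by (simp add: scaleR_diff_right[symmetric])
    also have "\<dots> \<le> exp (- 2*L*c t) * (dist z w / 2 * (exp (2*L*c t) - 1))"
      using * by (intro mult_left_mono) auto
    also have "\<dots> = dist z w / 2 * (1 - exp (- 2*L*c t))"
      by (simp add: algebra_simps exp_minus)
    also have "\<dots> \<le> dist z w / 2 * 1" by (intro mult_left_mono) auto
    finally show "dist (apply_bcontfun (PP z) t) (apply_bcontfun (PP w) t) \<le> 1/2 * dist z w"
      unfolding PP by simp
  qed
  obtain z where z: "PP z = z"
    using banach_fix_type[of "1/2" PP] contraction by auto
  define y where "y t = (if t \<in> {0..\<tau>} then Q z t else y0)" for t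
  have yz: "exp (2*L*t) *\<^sub>R apply_bcontfun z t = y t" if "t \<in> {0..\<tau>}" for t
    using PP[of z t] that unfolding z P_def y_def cid[OF that]
    by (simp add: mult_exp_exp)
  have "(y has_vector_derivative f (y t)) (at t within {0..\<tau>})" if t: "t \<in> {0..\<tau>}" for t
  proof -
    have "((\<lambda>u. integral {0..u} (\<lambda>s. f (exp (2*L * s) *\<^sub>R apply_bcontfun z s))) has_vector_derivative
       f (exp (2*L*t) *\<^sub>R apply_bcontfun z t)) (at t within {0..\<tau>})"
      by (rule integral_has_vector_derivative[OF contg t])
    then have "(Q z has_vector_derivative f (y t)) (at t within {0..\<tau>})"
      unfolding Q_def yz[OF t] by (auto intro!: derivative_eq_intros)
    then show ?thesis
      by (rule has_vector_derivative_transform[OF t, rotated]) (auto simp: y_def)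
  qed
  moreover have "y 0 = y0" using \<open>0 \<le> \<tau>\<close> by (simp add: y_def Q_def)
  ultimately show ?thesis by blast
qed

text \<open>Gronwall in differential form: the squared distance times
  \<open>exp (- 2 * L * s)\<close> is nonincreasing and starts at 0.\<close>

lemma lipschitz_ode_unique:
  fixes y z :: "real \<Rightarrow> 'a::real_inner"
  assumes "0 \<le> t" "{0..t} \<subseteq> S"
    and lip: "\<And>x y. norm (f x - f y) \<le> L * norm (x - y)"
    and y: "\<And>s. s \<in> {0..t} \<Longrightarrow> (y has_vector_derivative f (y s)) (at s within S)"
    and z: "\<And>s. s \<in> {0..t} \<Longrightarrow> (z has_vector_derivative f (z s)) (at s within S)"
    and "y 0 = z 0"
  shows "y t = z t"
proof -
  define w where "w s = exp (- 2*L * s) * ((y s - z s) \<bullet> (y s - z s))" for s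
  have dw: "(w has_real_derivative
      2 * exp (- 2*L * s) * ((y s - z s) \<bullet> (f (y s) - f (z s)) - L * ((y s - z s) \<bullet> (y s - z s))))
      (at s within S)" if "s \<in> {0..t}" for s
  proof -
    have "((\<lambda>s. (y s - z s) \<bullet> (y s - z s)) has_real_derivative
        2 * ((y s - z s) \<bullet> (f (y s) - f (z s)))) (at s within S)"
      unfolding has_real_derivative_iff_has_vector_derivative
      by (rule has_vector_derivative_eq_rhs[OF bounded_bilinear.has_vector_derivative[OF bounded_bilinear_inner
            has_vector_derivative_diff[OF y[OF that] z[OF that]]
            has_vector_derivative_diff[OF y[OF that] z[OF that]]]])
         (simp add: inner_commute)
    note di = this
    have "((\<lambda>s. exp (- 2*L * s)) has_real_derivative - 2*L * exp (- 2*L * s)) (at s within S)"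
      by (auto intro!: derivative_eq_intros)
    from DERIV_mult[OF this di] show ?thesis unfolding w_def
      by (rule DERIV_cong) (simp add: algebra_simps)
  qed
  have "- w 0 \<le> - w t"
  proof (rule nondecreasing_of_deriv_within[OF assms(1,2)])
    fix s assume s: "s \<in> {0..t}"
    show "((\<lambda>s. - w s) has_real_derivative
      - (2 * exp (- 2*L * s) * ((y s - z s) \<bullet> (f (y s) - f (z s)) - L * ((y s - z s) \<bullet> (y s - z s)))))
      (at s within S)"
      by (intro derivative_intros dw s)
    have "(y s - z s) \<bullet> (f (y s) - f (z s)) \<le> norm (y s - z s) * norm (f (y s) - f (z s))"
      by (rule norm_cauchy_schwarz)
    also have "\<dots> \<le> norm (y s - z s) * (L * norm (y s - z s))"
      by (intro mult_left_mono lip) auto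
    also have "\<dots> = L * ((y s - z s) \<bullet> (y s - z s))"
      by (simp add: dot_square_norm power2_eq_square)
    finally show "0 \<le> - (2 * exp (- 2*L * s) * ((y s - z s) \<bullet> (f (y s) - f (z s)) - L * ((y s - z s) \<bullet> (y s - z s))))"
      by (simp add: mult_nonneg_nonpos)
  qed
  then have "w t \<le> 0" using \<open>y 0 = z 0\<close> by (simp add: w_def)
  then show ?thesis by (simp add: w_def mult_le_0_iff dot_square_norm)
qed

text \<open>The boxes keep the gap at least \<open>a\<close> away from contact, and the constant may
  depend on \<open>a\<close>.\<close>

definition locally_lipschitz_pos :: "(real \<Rightarrow> real \<Rightarrow> real) \<Rightarrow> bool" where
  "locally_lipschitz_pos g \<longleftrightarrow> (\<forall>a>0. \<forall>R. \<exists>L>0. \<forall>x\<in>{a..R}. \<forall>x'\<in>{a..R}. \<forall>y\<in>{-R..R}. \<forall>y'\<in>{-R..R}.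
     \<bar>g x y - g x' y'\<bar> \<le> L * (\<bar>x - x'\<bar> + \<bar>y - y'\<bar>))"

lemma locally_lipschitz_pos_isCont:
  assumes "locally_lipschitz_pos g" "0 < x"
  shows "isCont (\<lambda>x. g x 0) x"
proof -
  obtain L where L: "L > 0" "\<forall>u\<in>{x/2..2*x}. \<forall>u'\<in>{x/2..2*x}. \<forall>y\<in>{-(2*x)..2*x}. \<forall>y'\<in>{-(2*x)..2*x}.
     \<bar>g u y - g u' y'\<bar> \<le> L * (\<bar>u - u'\<bar> + \<bar>y - y'\<bar>)"
    using assms unfolding locally_lipschitz_pos_def by (meson half_gt_zero)
  have "continuous_on {x/2..2*x} (\<lambda>x. g x 0)"
  proof (rule lipschitz_on_continuous_on[of L], rule lipschitz_onI)
    fix u v assume "u \<in> {x/2..2*x}" "v \<in> {x/2..2*x}"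
    then have "\<bar>g u 0 - g v 0\<bar> \<le> L * (\<bar>u - v\<bar> + \<bar>0 - 0\<bar>)"
      using L(2) assms(2) by (intro L(2)[rule_format]) auto
    then show "dist (g u 0) (g v 0) \<le> L * dist u v" by (simp add: dist_real_def)
  qed (use L in auto)
  then have "continuous_on {x/2<..<2*x} (\<lambda>x. g x 0)"
    by (rule continuous_on_subset) auto
  then show ?thesis using assms(2) by (auto simp: continuous_on_eq_continuous_at)
qed

section \<open>A priori bounds for the motion\<close>

lemma ode_solD:
  assumes "ode_sol g a b T \<eta> \<eta>'" "0 \<le> t" "ereal t < T"
  shows "0 < \<eta> t"
    "(\<eta> has_real_derivative \<eta>' t) (at t within {s. 0 \<le> s \<and> ereal s < T})"
    "(\<eta>' has_real_derivative g (\<eta> t) (\<eta>' t)) (at t within {s. 0 \<le> s \<and> ereal s < T})"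
  using assms unfolding ode_sol_def by auto

text \<open>The potential has a lower bound: it decreases up to \<open>b\<close>, attains a minimum
  on the compact middle part, and grows with slope at least \<open>f\<close> beyond. The lower bound
  limits the speed, the growth limits the gap.\<close>

lemma ode_upper_bounds:
  assumes lip: "locally_lipschitz_pos g"
    and mono: "\<And>x y z. 0 < x \<Longrightarrow> y \<le> z \<Longrightarrow> g x z \<le> g x y"
    and far: "0 < f" "\<And>x. B \<le> x \<Longrightarrow> g x 0 \<le> - f"
    and near: "0 < b" "\<And>x. 0 < x \<Longrightarrow> x \<le> b \<Longrightarrow> 0 < g x 0"
    and sol: "ode_sol g \<eta>0 \<eta>1 T \<eta> \<eta>'"
  shows "\<exists>M0 M1. \<forall>t\<ge>0. ereal t < T \<longrightarrow> \<eta> t \<le> M0 \<and> \<bar>\<eta>' t\<bar> \<le> M1"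
proof -
  define S where "S = {s. 0 \<le> s \<and> ereal s < T}"
  have S: "{0..t} \<subseteq> S" if "t \<in> S" for t
    using that le_less_trans[of "ereal _" "ereal t" T] by (auto simp: S_def)
  obtain \<Psi> where \<Psi>: "(\<Psi> has_real_derivative g x 0) (at x)" if "0 < x" for x
    using einterval_antiderivative[of 0 \<infinity> "\<lambda>x. g x 0"] locally_lipschitz_pos_isCont[OF lip]
    by (auto simp: has_real_derivative_iff_has_vector_derivative)
  define \<Phi> where "\<Phi> x = - \<Psi> x" for x
  have \<Phi>: "(\<Phi> has_real_derivative - g x 0) (at x)" if "0 < x" for x
    unfolding \<Phi>_def by (intro derivative_intros \<Psi> that)
  define C where "C = max b B"
  have C: "b \<le> C" "B \<le> C" "0 < C" using near(1) by (auto simp: C_def)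
  have \<Phi>_far: "\<Phi> C + f * (x - C) \<le> \<Phi> x" if "C \<le> x" for x
  proof -
    have "\<Phi> C - f * (C - C) \<le> \<Phi> x - f * (x - C)"
    proof (rule nondecreasing_of_deriv_within[OF that subset_UNIV])
      fix y assume y: "y \<in> {C..x}"
      show "((\<lambda>x. \<Phi> x - f * (x - C)) has_real_derivative - g y 0 - f) (at y)"
        using y C by (auto intro!: derivative_eq_intros \<Phi>)
      show "0 \<le> - g y 0 - f" using far(2)[of y] y C by simp
    qed
    then show ?thesis by simp
  qed
  have \<Phi>_near: "\<Phi> b \<le> \<Phi> x" if "0 < x" "x \<le> b" for x
  proof -
    have "- \<Phi> x \<le> - \<Phi> b"
      by (rule nondecreasing_of_deriv_within[OF that(2) subset_UNIV, where f' = "\<lambda>x. g x 0"])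
         (use that near(2) in \<open>auto intro!: derivative_eq_intros \<Phi> less_imp_le\<close>)
    then show ?thesis by simp
  qed
  have "continuous_on {b..C} \<Phi>"
    by (rule DERIV_continuous_on[OF has_field_derivative_at_within[OF \<Phi>]]) (use near(1) in auto)
  then obtain x0 where x0: "x0 \<in> {b..C}" "\<forall>x\<in>{b..C}. \<Phi> x0 \<le> \<Phi> x"
    using continuous_attains_inf[of "{b..C}" \<Phi>] C by auto
  have \<Phi>_min: "\<Phi> x0 \<le> \<Phi> x" if "0 < x" for x
  proof -
    consider "x \<le> b" | "x \<in> {b..C}" | "C \<le> x" by force
    then show ?thesis
    proof cases
      case 1
      then show ?thesis using \<Phi>_near[OF that] x0(2)[rule_format, of b] C by simp
    next
      case 3
      then have "\<Phi> C \<le> \<Phi> x"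
        using \<Phi>_far[OF 3] far(1) by (smt (verit) mult_nonneg_nonneg)
      then show ?thesis using x0(2)[rule_format, of C] C by simp
    qed (use x0 in auto)
  qed
  define E where "E t = (\<eta>' t)^2 / 2 + \<Phi> (\<eta> t)" for t
  have E_le: "E t \<le> E 0" if t: "t \<in> S" for t
  proof -
    have "- E 0 \<le> - E t"
    proof (rule nondecreasing_of_deriv_within[OF _ S[OF t]])
      show "0 \<le> t" using t by (simp add: S_def)
      fix s assume "s \<in> {0..t}"
      then have s: "0 \<le> s" "ereal s < T" using S[OF t] by (auto simp: S_def)
      note d = ode_solD[OF sol s, folded S_def]
      \<comment> \<open>The potential cancels the force at zero speed. The remaining difference has
        the sign opposite to \<open>\<eta>'\<close> because \<open>g\<close> is nonincreasing in the
        speed.\<close>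
      show "((\<lambda>t. - E t) has_real_derivative - (\<eta>' s * (g (\<eta> s) (\<eta>' s) - g (\<eta> s) 0))) (at s within S)"
      proof -
        have "((\<lambda>t. (\<eta>' t)^2 / 2) has_real_derivative \<eta>' s * g (\<eta> s) (\<eta>' s)) (at s within S)"
          by (auto intro!: derivative_eq_intros d(3))
        then show ?thesis unfolding E_def
          by (rule DERIV_cong[OF DERIV_minus[OF DERIV_add[OF _ DERIV_chain2[OF \<Phi>[OF d(1)] d(2)]]]])
             (simp add: algebra_simps)
      qed
      show "0 \<le> - (\<eta>' s * (g (\<eta> s) (\<eta>' s) - g (\<eta> s) 0))"
        using mono[OF d(1), of "\<eta>' s" 0] mono[OF d(1), of 0 "\<eta>' s"]
        by (cases "0 \<le> \<eta>' s") (auto simp: mult_nonneg_nonpos mult_nonpos_nonneg)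
    qed
    then show ?thesis by simp
  qed
  have "\<eta> t \<le> max C (C + (E 0 - \<Phi> C) / f) \<and> \<bar>\<eta>' t\<bar> \<le> sqrt (2 * (E 0 - \<Phi> x0))"
    if "0 \<le> t" "ereal t < T" for t
  proof
    have pos: "0 < \<eta> t" using ode_solD(1)[OF sol that] .
    have E: "(\<eta>' t)^2 / 2 + \<Phi> (\<eta> t) \<le> E 0" using E_le[of t] that by (simp add: S_def E_def)
    have "(\<eta>' t)^2 \<le> 2 * (E 0 - \<Phi> x0)" using E \<Phi>_min[OF pos] by simp
    then show "\<bar>\<eta>' t\<bar> \<le> sqrt (2 * (E 0 - \<Phi> x0))" using real_le_rsqrt by force
    show "\<eta> t \<le> max C (C + (E 0 - \<Phi> C) / f)"
    proof (cases "\<eta> t \<le> C")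
      case False
      then have "\<Phi> C + f * (\<eta> t - C) \<le> \<Phi> (\<eta> t)" by (intro \<Phi>_far) simp
      moreover have "\<Phi> (\<eta> t) \<le> E 0" using E zero_le_power2[of "\<eta>' t"] by linarith
      ultimately have "\<eta> t - C \<le> (E 0 - \<Phi> C) / f" using far(1) by (simp add: field_simps)
      then show ?thesis by simp
    qed simp
  qed
  then show ?thesis by blast
qed

text \<open>The maximum of the compact set where \<open>f \<ge> m\<close>. It serves for the gap
  and, with time reversed, for the velocity, where it finds the first zero after a given
  time.\<close>

lemma last_time_above:
  fixes f :: "real \<Rightarrow> real"
  assumes "continuous_on {a..b} f" "a \<le> b" "m \<le> f a" "f b < m"
  obtains s where "a \<le> s" "s < b" "f s = m" "\<And>x. s < x \<Longrightarrow> x \<le> b \<Longrightarrow> f x < m"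
proof -
  define Z where "Z = {a..b} \<inter> f -` {m..}"
  have "closed Z" unfolding Z_def
    by (rule continuous_closed_preimage) (use assms in auto)
  moreover have "bounded Z" by (rule bounded_subset[of "{a..b}"]) (auto simp: Z_def)
  moreover have "a \<in> Z" using assms by (auto simp: Z_def)
  ultimately obtain s where s: "s \<in> Z" "\<forall>x\<in>Z. x \<le> s"
    using compact_attains_sup[of Z] compact_eq_bounded_closed by blast
  have *: "a \<le> s" "s \<le> b" "m \<le> f s" using s by (auto simp: Z_def)
  have "s < b" using * assms(4) by (cases "s = b") auto
  have lt: "f x < m" if "s < x" "x \<le> b" for x
  proof (rule ccontr)
    assume "\<not> f x < m"
    then have "x \<in> Z" using that * by (auto simp: Z_def)
    then show False using s that by force
  qed
  have "f s = m"
  proof -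
    obtain x where x: "s \<le> x" "x \<le> b" "f x = m"
      using IVT2'[of f b m s] * assms(4) continuous_on_subset[OF assms(1), of "{s..b}"] by auto
    then show ?thesis using lt[of x] by (cases "x = s") auto
  qed
  then show thesis using that * \<open>s < b\<close> lt by blast
qed

text \<open>On each \<open>[0, t]\<close> the gap attains its minimum at some \<open>u\<close>. If
  that minimum is below \<open>m\<close>, the motion from the last earlier time \<open>s\<close>
  with gap \<open>m\<close> up to \<open>u\<close> is nonincreasing throughout, so the monotone
  quantity can be compared at \<open>s\<close> and \<open>u\<close>.\<close>

lemma ode_lower_bound:
  assumes near: "0 < b" "0 < c"
      "\<And>x y. 0 < x \<Longrightarrow> x \<le> b \<Longrightarrow> y \<le> 0 \<Longrightarrow> 0 < g x y"
      "\<And>x y. 0 < x \<Longrightarrow> x \<le> b \<Longrightarrow> y \<le> 0 \<Longrightarrow> c * \<bar>y\<bar> / x \<le> g x y"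
    and sol: "ode_sol g \<eta>0 \<eta>1 T \<eta> \<eta>'"
    and vel: "\<And>t. 0 \<le> t \<Longrightarrow> ereal t < T \<Longrightarrow> \<bar>\<eta>' t\<bar> \<le> M1"
  shows "\<exists>m0>0. \<forall>t\<ge>0. ereal t < T \<longrightarrow> m0 \<le> \<eta> t"
proof -
  define S where "S = {s. 0 \<le> s \<and> ereal s < T}"
  have S: "{0..t} \<subseteq> S" if "t \<in> S" for t
    using that le_less_trans[of "ereal _" "ereal t" T] by (auto simp: S_def)
  have pos: "0 < \<eta> t" and d: "(\<eta> has_real_derivative \<eta>' t) (at t within S)"
    and dd: "(\<eta>' has_real_derivative g (\<eta> t) (\<eta>' t)) (at t within S)" if "t \<in> S" for t
    using ode_solD[OF sol, of t] that by (auto simp: S_def)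
  have cont: "continuous_on S \<eta>" "continuous_on S \<eta>'"
    by (rule DERIV_continuous_on, erule d, rule DERIV_continuous_on, erule dd)
  have "0 \<in> S" using sol by (auto simp: ode_sol_def S_def zero_ereal_def)
  define m where "m = min b (\<eta> 0)"
  have m: "0 < m" "m \<le> b" "m \<le> \<eta> 0" using near(1) pos[OF \<open>0 \<in> S\<close>] by (auto simp: m_def)
  have "\<bar>\<eta>' 0\<bar> \<le> M1" using vel[of 0] \<open>0 \<in> S\<close> by (simp add: S_def)
  then have "0 \<le> M1" by linarith
  \<comment> \<open>Obtained by solving \<open>c * ln m - M1 \<le> c * ln (\<eta> u)\<close> for
    \<open>\<eta> u\<close>.\<close>
  define m0 where "m0 = m * exp (- M1 / c)"
  have "m0 \<le> m * 1" unfolding m0_def using m \<open>0 \<le> M1\<close> \<open>0 < c\<close> by (intro mult_left_mono) auto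
  have "m0 \<le> \<eta> t" if t: "t \<in> S" for t
  proof -
    have "0 \<le> t" using t by (simp add: S_def)
    obtain u where u: "u \<in> {0..t}" "\<forall>x\<in>{0..t}. \<eta> u \<le> \<eta> x"
      using continuous_attains_inf[of "{0..t}" \<eta>] continuous_on_subset[OF cont(1) S[OF t]] \<open>0 \<le> t\<close> by auto
    have uS: "u \<in> S" using u S[OF t] by auto
    show ?thesis
    proof (cases "\<eta> u < m")
      case False
      then show ?thesis using \<open>m0 \<le> m * 1\<close> u(2) \<open>0 \<le> t\<close> by force
    next
      case True
      have "0 < u" using True m u(1) by (cases "u = 0") auto
      \<comment> \<open>Only times before \<open>u\<close> are compared, since \<open>u\<close> may
        be the right end of the interval.\<close>
      have u_neg: "\<eta>' u \<le> 0"
      proof (rule ccontr)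
        assume "\<not> \<eta>' u \<le> 0"
        then obtain e where "e > 0" "\<forall>h>0. u - h \<in> S \<longrightarrow> h < e \<longrightarrow> \<eta> (u - h) < \<eta> u"
          using has_real_derivative_pos_inc_left[OF d[OF uS]] by (meson not_le)
        moreover define h where "h = min (e/2) u"
        moreover have "u - h \<in> S" using \<open>0 < u\<close> \<open>e > 0\<close> S[OF uS] by (auto simp: h_def)
        moreover have "0 < h" "h < e" using \<open>0 < u\<close> \<open>e > 0\<close> by (auto simp: h_def)
        ultimately have "\<eta> (u - h) < \<eta> u" by blast
        moreover have "u - h \<in> {0..t}" using \<open>0 < u\<close> \<open>e > 0\<close> u(1) by (auto simp: h_def)
        ultimately show False using bspec[OF u(2), of "u - h"] by simp
      qed
      obtain s where s: "0 \<le> s" "s < u" "\<eta> s = m" "\<And>x. s < x \<Longrightarrow> x \<le> u \<Longrightarrow> \<eta> x < m"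
        using last_time_above[of 0 u \<eta> m] continuous_on_subset[OF cont(1) S[OF uS]] True m \<open>0 < u\<close>
        by auto
      have su: "{s..u} \<subseteq> S" using S[OF uS] s(1) by auto
      have le_m: "\<eta> x \<le> m" if "x \<in> {s..u}" for x
        using s(3) s(4)[of x] that by (cases "x = s") auto
      \<comment> \<open>A positive velocity at \<open>r\<close> would have to fall back to a first
        zero \<open>z\<close> through positive values. But at \<open>z\<close> the acceleration is
        positive, so the velocity is negative just before \<open>z\<close>.\<close>
      have neg: "\<eta>' r \<le> 0" if r: "r \<in> {s..u}" for r
      proof (rule ccontr)
        assume *: "\<not> \<eta>' r \<le> 0"
        \<comment> \<open>Time reversal: the last time at which \<open>- \<eta>' (- x)\<close> is
          nonnegative corresponds to the first zero of \<open>\<eta>'\<close> after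
          \<open>r\<close>.\<close>
        have "continuous_on {-u..-r} (\<lambda>x. - \<eta>' (- x))"
          by (intro continuous_intros continuous_on_compose2[OF continuous_on_subset[OF cont(2) su]])
             (use r in auto)
        then obtain z' where z': "-u \<le> z'" "z' < -r" "- \<eta>' (- z') = 0"
            "\<And>x. z' < x \<Longrightarrow> x \<le> -r \<Longrightarrow> - \<eta>' (- x) < 0"
          using last_time_above[of "-u" "-r" "\<lambda>x. - \<eta>' (- x)" 0] u_neg * r by auto
        define z where "z = - z'"
        have z: "z \<in> {s..u}" "r < z" "\<eta>' z = 0" 
          using z' r by (auto simp: z_def)
        have z_pos: "0 < \<eta>' x" if "r \<le> x" "x < z" for x
          using z'(4)[of "- x"] that by (simp add: z_def)
        have "0 < g (\<eta> z) (\<eta>' z)"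
          using near(3)[of "\<eta> z" 0] pos[of z] z su le_m[OF z(1)] m by auto
        moreover have "z \<in> S" using z su by auto
        ultimately obtain e where "e > 0" "\<forall>h>0. z - h \<in> S \<longrightarrow> h < e \<longrightarrow> \<eta>' (z - h) < \<eta>' z"
          using has_real_derivative_pos_inc_left[OF dd] by blast
        moreover define h where "h = min (e/2) (z - r)"
        moreover have "0 < h" "h < e" "r \<le> z - h" using \<open>e > 0\<close> z by (auto simp: h_def)
        moreover have "z - h \<in> S" using su r z \<open>0 < h\<close> \<open>r \<le> z - h\<close> by auto
        ultimately have "\<eta>' (z - h) < 0" using z(3) by auto
        then show False using z_pos[of "z - h"] \<open>0 < h\<close> \<open>r \<le> z - h\<close> by simp
      qed
      have "\<eta>' s + c * ln (\<eta> s) \<le> \<eta>' u + c * ln (\<eta> u)"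
      proof (rule nondecreasing_of_deriv_within[OF _ su])
        fix x assume x: "x \<in> {s..u}"
        then have xS: "x \<in> S" using su by auto
        show "((\<lambda>x. \<eta>' x + c * ln (\<eta> x)) has_real_derivative
            g (\<eta> x) (\<eta>' x) + c * (\<eta>' x / \<eta> x)) (at x within S)"
          using pos[OF xS] by (auto intro!: derivative_eq_intros d[OF xS] dd[OF xS])
        show "0 \<le> g (\<eta> x) (\<eta>' x) + c * (\<eta>' x / \<eta> x)"
          using near(4)[OF pos[OF xS] _ neg[OF x]] le_m[OF x] m neg[OF x] by auto
      qed (use s in auto)
      moreover have "- M1 \<le> \<eta>' s"
      proof -
        have "s \<in> S" using su s by auto
        then show ?thesis using vel[of s] by (auto simp: S_def)
      qed
      ultimately have "c * ln m - M1 \<le> c * ln (\<eta> u)" using u_neg s(3) by simp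
      then have "ln m + (- M1 / c) \<le> ln (\<eta> u)" using \<open>0 < c\<close> by (simp add: field_simps)
      then have "exp (ln m + (- M1 / c)) \<le> \<eta> u"
        using pos[OF uS] by (simp add: ln_ge_iff)
      then have "m0 \<le> \<eta> u" unfolding m0_def exp_add using m by simp
      then show ?thesis using u(2) \<open>0 \<le> t\<close> by force
    qed
  qed
  then show ?thesis using m by (intro exI[of _ m0]) (auto simp: m0_def S_def)
qed

section \<open>Continuation past a finite time\<close>

definition clamp_real :: "real \<Rightarrow> real \<Rightarrow> real \<Rightarrow> real" where
  "clamp_real a b x = max a (min b x)"

lemma clamp_real_in: "a \<le> b \<Longrightarrow> clamp_real a b x \<in> {a..b}"
  and clamp_real_id: "x \<in> {a..b} \<Longrightarrow> clamp_real a b x = x"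
  and clamp_real_lipschitz: "\<bar>clamp_real a b x - clamp_real a b y\<bar> \<le> \<bar>x - y\<bar>"
  by (auto simp: clamp_real_def)

text \<open>Clamping the right-hand side to a compact box makes it globally Lipschitz; the resulting
  solution on \<open>[0, T + 1]\<close> agrees with the given one before \<open>T\<close>, and stays in the box for a little while after.\<close>

lemma ode_extend:
  fixes \<tau> :: real
  assumes lip: "locally_lipschitz_pos g"
    and sol: "ode_sol g \<eta>0 \<eta>1 (ereal \<tau>) \<eta> \<eta>'"
    and m0: "0 < m0" "\<And>t. 0 \<le> t \<Longrightarrow> t < \<tau> \<Longrightarrow> m0 \<le> \<eta> t"
    and M: "\<And>t. 0 \<le> t \<Longrightarrow> t < \<tau> \<Longrightarrow> \<eta> t \<le> M \<and> \<bar>\<eta>' t\<bar> \<le> M"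
  shows "\<exists>T' \<zeta> \<zeta>'. T' > ereal \<tau> \<and> ode_sol g \<eta>0 \<eta>1 T' \<zeta> \<zeta>' \<and>
    (\<forall>t. 0 \<le> t \<and> ereal t < ereal \<tau> \<longrightarrow> \<zeta> t = \<eta> t \<and> \<zeta>' t = \<eta>' t)"
proof -
  have "0 < \<tau>" using sol by (simp add: ode_sol_def)
  have init: "\<eta> 0 = \<eta>0" "\<eta>' 0 = \<eta>1" using sol by (auto simp: ode_sol_def)
  have mM: "m0 \<le> M" using m0(2)[of 0] M[of 0] \<open>0 < \<tau>\<close> by auto
  \<comment> \<open>The box is strictly larger than the known bounds, which leaves room for the
    solution to continue beyond \<open>\<tau>\<close>.\<close>
  define R where "R = M + 1"
  define a where "a = m0 / 2"
  have aR: "0 < a" "a < m0" "a < R" "0 < R" "- R < R" using m0(1) mM by (auto simp: a_def R_def)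
  obtain L where L: "0 < L" "\<forall>x\<in>{a..R}. \<forall>x'\<in>{a..R}. \<forall>y\<in>{-R..R}. \<forall>y'\<in>{-R..R}.
     \<bar>g x y - g x' y'\<bar> \<le> L * (\<bar>x - x'\<bar> + \<bar>y - y'\<bar>)"
    using lip aR(1) unfolding locally_lipschitz_pos_def by meson
  define p where "p = clamp_real a R"
  define r where "r = clamp_real (-R) R"
  define f :: "real \<times> real \<Rightarrow> real \<times> real" where "f z = (r (snd z), g (p (fst z)) (r (snd z)))" for z
  have pr: "p x \<in> {a..R}" "r x \<in> {-R..R}" for x
    using aR by (auto simp only: p_def r_def intro!: clamp_real_in)
  have gl: "\<bar>g (p x) (r y) - g (p x') (r y')\<bar> \<le> L * (\<bar>x - x'\<bar> + \<bar>y - y'\<bar>)" for x x' y y'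
  proof -
    have "\<bar>g (p x) (r y) - g (p x') (r y')\<bar> \<le> L * (\<bar>p x - p x'\<bar> + \<bar>r y - r y'\<bar>)"
      using L(2) pr by blast
    also have "\<dots> \<le> L * (\<bar>x - x'\<bar> + \<bar>y - y'\<bar>)"
      using L(1) by (intro mult_left_mono add_mono) (auto simp: p_def r_def clamp_real_lipschitz)
    finally show ?thesis .
  qed
  have f_lip: "norm (f z - f w) \<le> (1 + 2 * L) * norm (z - w)" for z w
  proof -
    have n: "\<bar>fst z - fst w\<bar> \<le> norm (z - w)" "\<bar>snd z - snd w\<bar> \<le> norm (z - w)"
      using norm_fst_le[of "z - w" "0"] norm_snd_le[of "0" "z - w"]
      by (metis fst_diff norm_fst_le prod.collapse real_norm_def, metis snd_diff norm_snd_le prod.collapse real_norm_def)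
    have "norm (f z - f w) \<le> norm (fst (f z - f w)) + norm (snd (f z - f w))"
      by (metis norm_Pair_le prod.collapse)
    also have "\<dots> \<le> \<bar>snd z - snd w\<bar> + L * (\<bar>fst z - fst w\<bar> + \<bar>snd z - snd w\<bar>)"
      using clamp_real_lipschitz[of "- R" R, folded r_def] by (intro add_mono) (auto simp: f_def gl)
    also have "\<dots> \<le> norm (z - w) + L * (norm (z - w) + norm (z - w))"
      using n L(1) by (intro add_mono mult_left_mono) auto
    finally show ?thesis by (simp add: algebra_simps)
  qed
  have f_bound: "norm (f z) \<le> R + (\<bar>g R R\<bar> + L * (2 * R + 2 * R))" for z
  proof -
    have "\<bar>g (p (fst z)) (r (snd z)) - g R R\<bar> \<le> L * (\<bar>p (fst z) - R\<bar> + \<bar>r (snd z) - R\<bar>)"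
      using L(2) pr aR by (meson atLeastAtMost_iff less_imp_le order_refl)
    also have "\<dots> \<le> L * (2 * R + 2 * R)"
      using L(1) aR pr[of "fst z"] pr[of "snd z"] by (intro mult_left_mono add_mono) auto
    finally have "\<bar>snd (f z)\<bar> \<le> \<bar>g R R\<bar> + L * (2 * R + 2 * R)" by (simp add: f_def)
    moreover have "\<bar>fst (f z)\<bar> \<le> R" using pr[of "snd z"] by (auto simp: f_def)
    moreover have "norm (f z) \<le> norm (fst (f z)) + norm (snd (f z))"
      using norm_Pair_le[of "fst (f z)" "snd (f z)"] by simp
    ultimately show ?thesis by simp
  qed
  obtain y where y: "y 0 = (\<eta>0, \<eta>1)"
    "\<And>t. t \<in> {0..\<tau>+1} \<Longrightarrow> (y has_vector_derivative f (y t)) (at t within {0..\<tau>+1})"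
    using lipschitz_ode_exists[of f "1 + 2 * L", OF f_lip _ f_bound, of "\<tau> + 1" "(\<eta>0, \<eta>1)"] L(1) \<open>0 < \<tau>\<close>
    by auto
  define S where "S = {s. 0 \<le> s \<and> ereal s < ereal \<tau>}"
  have S_eq: "S = {0..<\<tau>}" by (auto simp: S_def)
  \<comment> \<open>Before \<open>\<tau>\<close> the given solution stays where the clamps act as
    the identity, so it solves the clamped system too.\<close>
  have y_eq: "y t = (\<eta> t, \<eta>' t)" if "t \<in> {0..<\<tau>}" for t
  proof (rule lipschitz_ode_unique[where y = y and z = "\<lambda>t. (\<eta> t, \<eta>' t)" and S = S and f = f, OF _ _ f_lip])
    show "0 \<le> t" "{0..t} \<subseteq> S" using that by (auto simp: S_eq)
    fix s assume "s \<in> {0..t}"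
    then have s: "s \<in> S" "0 \<le> s" "ereal s < ereal \<tau>" using that by (auto simp: S_eq)
    show "(y has_vector_derivative f (y s)) (at s within S)"
      by (rule has_vector_derivative_within_subset[OF y(2)]) (use s in \<open>auto simp: S_eq\<close>)
    have "p (\<eta> s) = \<eta> s" "r (\<eta>' s) = \<eta>' s"
      using m0(2)[of s] M[of s] s aR mM unfolding p_def r_def
      by (auto intro!: clamp_real_id simp: R_def)
    then show "((\<lambda>t. (\<eta> t, \<eta>' t)) has_vector_derivative f (\<eta> s, \<eta>' s)) (at s within S)"
      using ode_solD(2,3)[OF sol s(2,3), folded S_def]
      by (auto simp: f_def has_real_derivative_iff_has_vector_derivative intro!: has_vector_derivative_Pair)
  qed (simp add: y init)
  have conty: "continuous_on {0..\<tau>+1} y"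
    using y(2) has_vector_derivative_continuous by (force simp: continuous_on_eq_continuous_within)
  define Box where "Box = {a<..<R} \<times> {-R<..<R}"
  \<comment> \<open>The closed bounds pass to the limit from the left and lie strictly inside
    \<open>Box\<close>.\<close>
  have "y \<tau> \<in> {m0..M} \<times> {-M..M}"
  proof (rule Lim_in_closed_set)
    show "closed ({m0..M} \<times> {-M..M})" by (intro closed_Times) auto
    have "(y \<longlongrightarrow> y \<tau>) (at \<tau> within {0..\<tau>+1})"
      using conty \<open>0 < \<tau>\<close> by (auto simp: continuous_on_def)
    then show "(y \<longlongrightarrow> y \<tau>) (at \<tau> within {0..<\<tau>})"
      by (rule tendsto_within_subset) auto
    show "\<forall>\<^sub>F t in at \<tau> within {0..<\<tau>}. y t \<in> {m0..M} \<times> {-M..M}"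
      unfolding eventually_at_filter
    proof (intro always_eventually allI impI)
      fix t assume "t \<in> {0..<\<tau>}"
      then show "y t \<in> {m0..M} \<times> {-M..M}"
        using y_eq[of t] m0(2)[of t] M[of t] by auto
    qed
    show "at \<tau> within {0..<\<tau>} \<noteq> bot"
      using \<open>0 < \<tau>\<close> by (simp add: trivial_limit_within islimpt_Ico)
  qed
  then have "y \<tau> \<in> Box" using aR by (auto simp: Box_def R_def)
  moreover have "open Box" unfolding Box_def by (intro open_Times) auto
  moreover have "(y \<longlongrightarrow> y \<tau>) (at \<tau> within {0..\<tau>+1})"
    using conty \<open>0 < \<tau>\<close> by (auto simp: continuous_on_def)
  ultimately have "\<forall>\<^sub>F t in at \<tau> within {0..\<tau>+1}. y t \<in> Box"
    by (metis topological_tendstoD)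
  then obtain e where e: "0 < e" "\<And>t. t \<in> {0..\<tau>+1} \<Longrightarrow> t \<noteq> \<tau> \<Longrightarrow> dist t \<tau> < e \<Longrightarrow> y t \<in> Box"
    unfolding eventually_at by blast
  \<comment> \<open>The cap 1 stays within the interval \<open>[0, \<tau> + 1]\<close> on which
    \<open>y\<close> was constructed.\<close>
  define d where "d = min e 1"
  have d: "0 < d" "d \<le> e" "d \<le> 1" using e(1) by (auto simp: d_def)
  have inBox: "y t \<in> Box" if "0 \<le> t" "t < \<tau> + d" for t
  proof (cases t \<tau> rule: linorder_cases)
    case less
    then show ?thesis using y_eq[of t] m0(2)[of t] M[of t] aR that by (auto simp: Box_def R_def)
  next
    case greater
    then show ?thesis using e(2)[of t] that d by (auto simp: dist_real_def)
  qed (use \<open>y \<tau> \<in> Box\<close> in simp)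
  have "ode_sol g \<eta>0 \<eta>1 (ereal (\<tau> + d)) (\<lambda>t. fst (y t)) (\<lambda>t. snd (y t))"
    unfolding ode_sol_def
  proof (intro conjI allI impI; (elim conjE)?)
    fix t :: real assume t: "0 \<le> t" "ereal t < ereal (\<tau> + d)"
    have box: "y t \<in> Box" using inBox t by simp
    show "0 < fst (y t)" using box aR by (auto simp: Box_def)
    have "p (fst (y t)) = fst (y t)" "r (snd (y t)) = snd (y t)"
      using box unfolding p_def r_def Box_def by (auto intro!: clamp_real_id)
    then have feq: "f (y t) = (snd (y t), g (fst (y t)) (snd (y t)))" by (simp add: f_def)
    have D: "(y has_vector_derivative f (y t)) (at t within {s. 0 \<le> s \<and> ereal s < ereal (\<tau> + d)})"
      by (rule has_vector_derivative_within_subset[OF y(2)]) (use t d in auto)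
    show "((\<lambda>t. fst (y t)) has_real_derivative snd (y t)) (at t within {s. 0 \<le> s \<and> ereal s < ereal (\<tau> + d)})"
      "((\<lambda>t. snd (y t)) has_real_derivative g (fst (y t)) (snd (y t))) (at t within {s. 0 \<le> s \<and> ereal s < ereal (\<tau> + d)})"
      using bounded_linear.has_vector_derivative[OF bounded_linear_fst D]
        bounded_linear.has_vector_derivative[OF bounded_linear_snd D]
      by (auto simp: feq has_real_derivative_iff_has_vector_derivative)
  qed (use \<open>0 < \<tau>\<close> d y in auto)
  moreover have "\<forall>t. 0 \<le> t \<and> ereal t < ereal \<tau> \<longrightarrow> fst (y t) = \<eta> t \<and> snd (y t) = \<eta>' t"
    using y_eq by simp
  moreover have "ereal \<tau> < ereal (\<tau> + d)" using d by simp
  ultimately show ?thesis by blast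
qed

text \<open>Isolates what the motion needs of the force: regularity, monotonicity in the speed,
  attraction at large gaps, and repulsion with damping of order \<open>1 / x\<close> at small
  gaps.\<close>

lemma maximal_ode_sol_bounded:
  assumes lip: "locally_lipschitz_pos g"
    and mono: "\<And>x y z. 0 < x \<Longrightarrow> y \<le> z \<Longrightarrow> g x z \<le> g x y"
    and far: "0 < f" "\<And>x. B \<le> x \<Longrightarrow> g x 0 \<le> - f"
    and near: "0 < b" "0 < c"
      "\<And>x y. 0 < x \<Longrightarrow> x \<le> b \<Longrightarrow> y \<le> 0 \<Longrightarrow> 0 < g x y"
      "\<And>x y. 0 < x \<Longrightarrow> x \<le> b \<Longrightarrow> y \<le> 0 \<Longrightarrow> c * \<bar>y\<bar> / x \<le> g x y"
    and sol: "ode_sol g \<eta>0 \<eta>1 T \<eta> \<eta>'"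
    and maximal: "\<not> (\<exists>T' \<zeta> \<zeta>'. T' > T \<and> ode_sol g \<eta>0 \<eta>1 T' \<zeta> \<zeta>' \<and>
              (\<forall>t. 0 \<le> t \<and> ereal t < T \<longrightarrow> \<zeta> t = \<eta> t \<and> \<zeta>' t = \<eta>' t))"
  shows "T = \<infinity> \<and> (\<exists>m0 M0 M1. 0 < m0 \<and> m0 \<le> M0 \<and> 0 \<le> M1 \<and>
           (\<forall>t\<ge>0. m0 \<le> \<eta> t \<and> \<eta> t \<le> M0 \<and> \<bar>\<eta>' t\<bar> \<le> M1))"
proof -
  obtain M0 M1 where M: "\<And>t. 0 \<le> t \<Longrightarrow> ereal t < T \<Longrightarrow> \<eta> t \<le> M0 \<and> \<bar>\<eta>' t\<bar> \<le> M1"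
    using ode_upper_bounds[OF lip mono far near(1) near(3) sol] by force
  obtain m0 where m0: "0 < m0" "\<And>t. 0 \<le> t \<Longrightarrow> ereal t < T \<Longrightarrow> m0 \<le> \<eta> t"
    using ode_lower_bound[OF near sol, of M1] M by blast
  have "0 < T" using sol by (simp add: ode_sol_def)
  have "T = \<infinity>"
  proof (cases T)
    case (real \<tau>)
    have "\<exists>T' \<zeta> \<zeta>'. T' > ereal \<tau> \<and> ode_sol g \<eta>0 \<eta>1 T' \<zeta> \<zeta>' \<and>
      (\<forall>t. 0 \<le> t \<and> ereal t < ereal \<tau> \<longrightarrow> \<zeta> t = \<eta> t \<and> \<zeta>' t = \<eta>' t)"
    proof (rule ode_extend[OF lip sol[unfolded real] m0(1)])
      fix t assume "0 \<le> t" "t < \<tau>"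
      then show "m0 \<le> \<eta> t" "\<eta> t \<le> max M0 M1 \<and> \<bar>\<eta>' t\<bar> \<le> max M0 M1"
        using m0(2)[of t] M[of t] real by auto
    qed
    then show ?thesis using maximal real by blast
  qed (use \<open>0 < T\<close> in auto)
  moreover have "m0 \<le> M0" "0 \<le> M1"
    using m0(2)[of 0] M[of 0] \<open>T = \<infinity>\<close> by auto
  ultimately show ?thesis using m0 M by force
qed

section \<open>Contact geometry\<close>

text \<open>Rectangles on which a gap of size \<beta> closes at rate \<open>\<beta> / d\<close>. The
  last two conditions say that \<open>d^2 * l / \<beta>^2\<close> is at least of order
  \<open>1 / sqrt \<beta>\<close>, enough to exceed \<open>F\<close>, and that
  \<open>d^3 * l / \<beta>^3\<close> is at least of order \<open>1 / \<beta>\<close>, the damping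
  rate.\<close>

definition contact_rects :: "(real^2) set \<Rightarrow> (real^2 \<Rightarrow> real) \<Rightarrow> (real^2 \<Rightarrow> real^2) \<Rightarrow> bool" where
  "contact_rects \<Omega> h0 D \<longleftrightarrow> (\<exists>b>0. \<exists>e>0. \<exists>\<kappa>>0. \<exists>C\<ge>0. \<forall>\<beta>. 0 < \<beta> \<longrightarrow> \<beta> \<le> b \<longrightarrow>
     (\<exists>c d l. 0 < d \<and> d \<le> l \<and> rect c d l \<subseteq> \<Omega> \<and>
       (\<forall>x\<in>rect c d l. h0 x \<le> C * \<beta> \<and> D x $ 1 \<le> - \<kappa> * (\<beta> / d) \<and> norm (D x) \<le> C * (\<beta> / d)) \<and>
       e * (\<beta> * sqrt \<beta>) \<le> d^2 * l \<and> e * \<beta>^2 \<le> d^3 * l))"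

text \<open>Dividing the bump estimate by \<open>\<beta>^3 / d^2\<close> leaves a static part
  \<open>\<kappa> * d^2 * l / \<beta>^2\<close> and a damping part
  \<open>\<bar>\<gamma>\<bar> * d^3 * l / \<beta>^3\<close>.\<close>

lemma (in gap_domain) I_near_zero:
  assumes D: "\<And>x. x \<in> \<Omega> \<Longrightarrow> (h0 has_derivative (\<lambda>v. D x \<bullet> v)) (at x)" "continuous_on \<Omega> D"
    and rects: "contact_rects \<Omega> h0 D" and "0 < F"
  shows "\<exists>b>0. \<exists>c>0. \<forall>\<beta> \<gamma>. 0 < \<beta> \<longrightarrow> \<beta> \<le> b \<longrightarrow> \<gamma> \<le> 0 \<longrightarrow> 0 < I \<beta> \<gamma> - F \<and> c * \<bar>\<gamma>\<bar> / \<beta> \<le> I \<beta> \<gamma> - F"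
proof -
  obtain b e \<kappa> C where *: "0 < b" "0 < e" "0 < \<kappa>" "0 \<le> C"
    and box: "\<And>\<beta>. 0 < \<beta> \<Longrightarrow> \<beta> \<le> b \<Longrightarrow>
     \<exists>c d l. 0 < d \<and> d \<le> l \<and> rect c d l \<subseteq> \<Omega> \<and>
       (\<forall>x\<in>rect c d l. h0 x \<le> C * \<beta> \<and> D x $ 1 \<le> - \<kappa> * (\<beta> / d) \<and> norm (D x) \<le> C * (\<beta> / d)) \<and>
       e * (\<beta> * sqrt \<beta>) \<le> d^2 * l \<and> e * \<beta>^2 \<le> d^3 * l"
    using rects unfolding contact_rects_def by blast
  define k where "k = (27/64)^2 / (96 * (C + 1)^3)"
  have "0 < k" using * by (simp add: k_def)
  \<comment> \<open>The square is chosen so that the static part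
    \<open>k * \<kappa> * e / sqrt \<beta>\<close> is at least \<open>F + 1\<close>; the surplus 1
    gives strict positivity.\<close>
  define b' where "b' = min b ((k * \<kappa> * e / (F + 1))^2)"
  have "0 < b'" using * \<open>0 < k\<close> \<open>0 < F\<close> by (simp add: b'_def)
  have est: "F + 1 + k * e * \<bar>\<gamma>\<bar> / \<beta> \<le> I \<beta> \<gamma>" if \<beta>: "0 < \<beta>" "\<beta> \<le> b'" and \<gamma>: "\<gamma> \<le> 0" for \<beta> \<gamma>
  proof -
    have "\<beta> \<le> b" using \<beta> by (simp add: b'_def)
    from box[OF \<beta>(1) this] obtain c d l where r: "0 < d" "d \<le> l" "rect c d l \<subseteq> \<Omega>"
       "\<forall>x\<in>rect c d l. h0 x \<le> C * \<beta> \<and> D x $ 1 \<le> - \<kappa> * (\<beta> / d) \<and> norm (D x) \<le> C * (\<beta> / d)"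
       "e * (\<beta> * sqrt \<beta>) \<le> d^2 * l" "e * \<beta>^2 \<le> d^3 * l" by blast
    have "(27/64)^2 * (d * l) * (\<kappa> * (\<beta> / d) + \<bar>\<gamma>\<bar>) \<le> 96 * (C + 1)^3 * (\<beta>^3 / d^2) * I \<beta> \<gamma>"
      by (rule I_lower_bound[OF D \<beta>(1) \<gamma> r(1,2) *(4) r(3)]) (use r(4) *(3) in auto)
    then have "(27/64)^2 / (96 * (C + 1)^3) * ((d * l) * (\<kappa> * (\<beta> / d) + \<bar>\<gamma>\<bar>) * (d^2 / \<beta>^3)) \<le> I \<beta> \<gamma>"
      using \<beta>(1) r(1) *(4) by (simp add: field_simps)
    then have "k * ((d * l) * (\<kappa> * (\<beta> / d) + \<bar>\<gamma>\<bar>) * (d^2 / \<beta>^3)) \<le> I \<beta> \<gamma>" by (simp add: k_def)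
    moreover have "(d * l) * (\<kappa> * (\<beta> / d) + \<bar>\<gamma>\<bar>) * (d^2 / \<beta>^3) = \<kappa> * ((d^2 * l) / \<beta>^2) + \<bar>\<gamma>\<bar> * ((d^3 * l) / \<beta>^3)"
      using \<beta>(1) r(1) by (simp add: field_simps power2_eq_square power3_eq_cube)
    moreover have "e / sqrt \<beta> \<le> (d^2 * l) / \<beta>^2"
    proof -
      have "e / sqrt \<beta> = e * (\<beta> * sqrt \<beta>) / \<beta>^2"
        using \<beta>(1) real_sqrt_mult_self[of \<beta>] by (simp add: field_simps power2_eq_square)
      then show ?thesis using r(5) by (simp add: divide_right_mono)
    qed
    moreover have "e / \<beta> \<le> (d^3 * l) / \<beta>^3"
    proof -
      have "e / \<beta> = e * \<beta>^2 / \<beta>^3" using \<beta>(1) by (simp add: field_simps power2_eq_square power3_eq_cube)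
      then show ?thesis using r(6) \<beta>(1) by (simp add: divide_right_mono)
    qed
    ultimately have I_ge: "k * (\<kappa> * (e / sqrt \<beta>) + \<bar>\<gamma>\<bar> * (e / \<beta>)) \<le> I \<beta> \<gamma>"
      using * \<open>0 < k\<close> by (smt (verit) add_mono mult_left_mono abs_ge_zero)
    have "sqrt \<beta> \<le> k * \<kappa> * e / (F + 1)"
      using \<beta>(2) * \<open>0 < k\<close> \<open>0 < F\<close> by (intro real_le_lsqrt) (auto simp: b'_def)
    then have "F + 1 \<le> k * \<kappa> * e / sqrt \<beta>" using \<beta>(1) \<open>0 < F\<close> by (simp add: field_simps)
    then show ?thesis using I_ge by (simp add: algebra_simps)
  qed
  have "0 < I \<beta> \<gamma> - F \<and> (k * e) * \<bar>\<gamma>\<bar> / \<beta> \<le> I \<beta> \<gamma> - F" if "0 < \<beta>" "\<beta> \<le> b'" "\<gamma> \<le> 0" for \<beta> \<gamma>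
  proof -
    have "0 \<le> k * e * \<bar>\<gamma>\<bar> / \<beta>" 
      using that * \<open>0 < k\<close> by (intro divide_nonneg_pos mult_nonneg_nonneg) auto
    then show ?thesis using est[OF that] by linarith
  qed
  then show ?thesis using \<open>0 < b'\<close> \<open>0 < k\<close> *(2) by (intro exI[of _ b'] conjI exI[of _ "k * e"]) auto
qed

lemma inner_right_inject:
  fixes a b :: "'a::real_inner"
  assumes "(\<lambda>v. a \<bullet> v) = (\<lambda>v. b \<bullet> v)"
  shows "a = b"
proof -
  have "(a - b) \<bullet> (a - b) = 0"
    using fun_cong[OF assms, of "a - b"] by (simp add: inner_diff_left)
  then show ?thesis by simp
qed

text \<open>Both contact models have the form \<open>h0 = N\<^sup>\<alpha> h1\<close> to the left of the origin, with \<open>N x = - x\<^sub>1\<close> or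
  \<open>N x = |x|\<close>.\<close>

lemma contact_estimates:
  fixes \<nu> D D1 :: "real^2"
  assumes N: "(N has_derivative (\<lambda>v. \<nu> \<bullet> v)) (at x)" "norm \<nu> \<le> 1" "\<nu> $ 1 \<le> - 1/4" "d \<le> N x" "N x \<le> 4 * d"
    and d: "0 < d" "d \<le> 1" "4 powr \<alpha> * C2 * d \<le> c1 / 8" and \<alpha>: "1 \<le> \<alpha>"
    and h1: "(h1 has_derivative (\<lambda>v. D1 \<bullet> v)) (at x)" "0 < c1" "c1 \<le> h1 x" "h1 x \<le> C1" "norm D1 \<le> C2"
    and h0: "(h0 has_derivative (\<lambda>v. D \<bullet> v)) (at x)" "open U" "x \<in> U" "\<And>y. y \<in> U \<Longrightarrow> h0 y = N y powr \<alpha> * h1 y"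
  shows "h0 x \<le> 4 powr \<alpha> * (\<alpha> * C1 + C2) * d powr \<alpha>"
    "D $ 1 \<le> - (c1 / 8) * (d powr \<alpha> / d)"
    "norm D \<le> 4 powr \<alpha> * (\<alpha> * C1 + C2) * (d powr \<alpha> / d)"
proof -
  have "0 < N x" using N(4) d(1) by linarith
  have C: "0 < C1" "0 \<le> C2" using h1 norm_ge_zero[of D1] by linarith+
  have "((\<lambda>y. N y powr \<alpha>) has_derivative (\<lambda>v. (\<alpha> * N x powr (\<alpha> - 1)) * (\<nu> \<bullet> v))) (at x)"
    using has_derivative_compose[OF N(1) has_real_derivative_powr[OF \<open>0 < N x\<close>, unfolded has_field_derivative_def]] .
  from has_derivative_mult[OF this h1(1)]
  have "((\<lambda>y. N y powr \<alpha> * h1 y) has_derivative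
     (\<lambda>v. ((\<alpha> * N x powr (\<alpha> - 1) * h1 x) *\<^sub>R \<nu> + (N x powr \<alpha>) *\<^sub>R D1) \<bullet> v)) (at x)"
    by (rule has_derivative_eq_rhs) (auto simp: inner_add_left algebra_simps)
  then have "(h0 has_derivative (\<lambda>v. ((\<alpha> * N x powr (\<alpha> - 1) * h1 x) *\<^sub>R \<nu> + (N x powr \<alpha>) *\<^sub>R D1) \<bullet> v)) (at x)"
    by (rule has_derivative_transform_within_open[OF _ h0(2,3)]) (simp add: h0(4))
  from has_derivative_unique[OF h0(1) this]
  have D: "D = (\<alpha> * N x powr (\<alpha> - 1) * h1 x) *\<^sub>R \<nu> + (N x powr \<alpha>) *\<^sub>R D1"
    by (rule inner_right_inject)
  have a1: "d powr (\<alpha> - 1) \<le> N x powr (\<alpha> - 1)" using N d \<alpha> by (intro powr_mono2) auto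
  have "N x powr (\<alpha> - 1) \<le> (4 * d) powr (\<alpha> - 1)" using N \<open>0 < N x\<close> \<alpha> by (intro powr_mono2) auto
  also have "\<dots> \<le> 4 powr \<alpha> * d powr (\<alpha> - 1)"
    unfolding powr_mult[of 4 d "\<alpha> - 1"] by (intro mult_right_mono powr_mono) auto
  finally have a2: "N x powr (\<alpha> - 1) \<le> 4 powr \<alpha> * d powr (\<alpha> - 1)" .
  have "N x powr \<alpha> \<le> (4 * d) powr \<alpha>" using N \<open>0 < N x\<close> \<alpha> by (intro powr_mono2) auto
  then have a3: "N x powr \<alpha> \<le> 4 powr \<alpha> * d powr \<alpha>" by (simp add: powr_mult)
  have d_eq: "d powr \<alpha> / d = d powr (\<alpha> - 1)" "d powr \<alpha> = d * d powr (\<alpha> - 1)"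
    using d(1) by (auto simp: powr_diff)
  have a4: "N x powr \<alpha> \<le> 4 powr \<alpha> * d powr (\<alpha> - 1)"
  proof -
    have "d * d powr (\<alpha> - 1) \<le> 1 * d powr (\<alpha> - 1)" using d by (intro mult_right_mono) auto
    then have "4 powr \<alpha> * d powr \<alpha> \<le> 4 powr \<alpha> * d powr (\<alpha> - 1)" unfolding d_eq by simp
    then show ?thesis using a3 by linarith
  qed
  have "h0 x \<le> (4 powr \<alpha> * d powr \<alpha>) * C1"
    unfolding h0(4)[OF h0(3)] using a3 h1 by (intro mult_mono) auto
  also have "\<dots> \<le> (4 powr \<alpha> * d powr \<alpha>) * (\<alpha> * C1 + C2)"
  proof (rule mult_left_mono)
    show "C1 \<le> \<alpha> * C1 + C2" using mult_right_mono[OF \<alpha>, of C1] C by linarith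
  qed simp
  finally show "h0 x \<le> 4 powr \<alpha> * (\<alpha> * C1 + C2) * d powr \<alpha>" by (simp add: mult_ac)
  have c: "\<alpha> * N x powr (\<alpha> - 1) * h1 x \<le> \<alpha> * (4 powr \<alpha> * d powr (\<alpha> - 1)) * C1"
    by (rule mult_mono[OF mult_left_mono[OF a2]]) (use h1 \<alpha> in auto)
  have nonneg: "0 \<le> \<alpha> * N x powr (\<alpha> - 1) * h1 x" using h1 \<alpha> by simp
  have "norm D \<le> \<bar>\<alpha> * N x powr (\<alpha> - 1) * h1 x\<bar> * norm \<nu> + \<bar>N x powr \<alpha>\<bar> * norm D1"
    unfolding D by (rule order_trans[OF norm_triangle_ineq]) simp
  also have "\<dots> \<le> (\<alpha> * (4 powr \<alpha> * d powr (\<alpha> - 1)) * C1) * 1 + (4 powr \<alpha> * d powr (\<alpha> - 1)) * C2"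
  proof (rule add_mono)
    show "\<bar>\<alpha> * N x powr (\<alpha> - 1) * h1 x\<bar> * norm \<nu> \<le> (\<alpha> * (4 powr \<alpha> * d powr (\<alpha> - 1)) * C1) * 1"
      unfolding abs_of_nonneg[OF nonneg] by (rule mult_mono[OF c N(2)]) (use \<alpha> C in auto)
    show "\<bar>N x powr \<alpha>\<bar> * norm D1 \<le> (4 powr \<alpha> * d powr (\<alpha> - 1)) * C2"
      by (rule mult_mono) (use a4 h1 in auto)
  qed
  finally show "norm D \<le> 4 powr \<alpha> * (\<alpha> * C1 + C2) * (d powr \<alpha> / d)"
    unfolding d_eq(1) by (simp add: algebra_simps)
  \<comment> \<open>The term from differentiating \<open>N\<close> is at most
    \<open>- (c1 / 4) * d powr (\<alpha> - 1)\<close>. The gradient of \<open>h1\<close> contributes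
    at most half of that with the opposite sign, by the smallness of \<open>d\<close>, which leaves
    \<open>c1 / 8\<close>.\<close>
  have "(\<alpha> * N x powr (\<alpha> - 1) * h1 x) * \<nu> $ 1 \<le> (\<alpha> * N x powr (\<alpha> - 1) * h1 x) * (- 1/4)"
    using \<alpha> h1 N(3) by (intro mult_left_mono) auto
  moreover have "1 * d powr (\<alpha> - 1) * c1 \<le> \<alpha> * N x powr (\<alpha> - 1) * h1 x"
    using \<alpha> a1 h1 by (intro mult_mono) auto
  moreover have "N x powr \<alpha> * D1 $ 1 \<le> (c1 / 8) * d powr (\<alpha> - 1)"
  proof -
    have "N x powr \<alpha> * D1 $ 1 \<le> N x powr \<alpha> * C2"
      using h1(5) component_le_norm_cart[of D1 1] by (intro mult_left_mono) auto
    also have "\<dots> \<le> (4 powr \<alpha> * d powr \<alpha>) * C2" using a3 C by (intro mult_right_mono) auto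
    also have "\<dots> = (4 powr \<alpha> * C2 * d) * d powr (\<alpha> - 1)" unfolding d_eq by simp
    also have "\<dots> \<le> (c1 / 8) * d powr (\<alpha> - 1)" using d(3) by (intro mult_right_mono) auto
    finally show ?thesis .
  qed
  ultimately show "D $ 1 \<le> - (c1 / 8) * (d powr \<alpha> / d)"
    unfolding D d_eq(1) by (simp add: algebra_simps)
qed

section \<open>Rectangles for the two contact models\<close>

lemma regular_pos_local_bounds:
  assumes "open \<Omega>" "0 \<in> \<Omega>" "open W" "0 \<in> W" "regular_pos W h1"
  shows "\<exists>r c1 C1 C2 D1. 0 < r \<and> cball 0 r \<subseteq> \<Omega> \<inter> W \<and> 0 < c1 \<and> 0 \<le> C1 \<and> 0 \<le> C2 \<and>
    (\<forall>x. x \<in> cball 0 r \<longrightarrow> c1 \<le> h1 x \<and> h1 x \<le> C1 \<and> norm (D1 x) \<le> C2 \<and> (h1 has_derivative (\<lambda>v. D1 x \<bullet> v)) (at x))"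
proof -
  obtain r where r: "0 < r" "cball 0 r \<subseteq> \<Omega> \<inter> W"
    using open_contains_cball[of "\<Omega> \<inter> W"] assms by (metis IntI open_Int)
  then have rW: "cball 0 r \<subseteq> closure W" using closure_subset by blast
  obtain D1 where h1: "continuous_on (closure W) h1" "\<And>x. x \<in> closure W \<Longrightarrow> 0 < h1 x" "continuous_on (closure W) D1"
    "\<And>x. x \<in> W \<Longrightarrow> (h1 has_derivative (\<lambda>v. D1 x \<bullet> v)) (at x)"
    using assms(5) unfolding regular_pos_def C1_closure_def by blast
  have ne: "cball 0 r \<noteq> {}" using r(1) by auto
  have ch: "continuous_on (cball 0 r) h1" by (rule continuous_on_subset[OF h1(1) rW])
  obtain xm where xm: "xm \<in> cball 0 r" "\<forall>y\<in>cball 0 r. h1 xm \<le> h1 y"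
    using continuous_attains_inf[OF compact_cball ne ch] by blast
  obtain xM where xM: "\<forall>y\<in>cball 0 r. h1 y \<le> h1 xM"
    using continuous_attains_sup[OF compact_cball ne ch] by blast
  obtain xD where xD: "\<forall>y\<in>cball 0 r. norm (D1 y) \<le> norm (D1 xD)"
    using continuous_attains_sup[OF compact_cball ne continuous_on_norm[OF continuous_on_subset[OF h1(3) rW]]] by blast
  have pos: "0 < h1 xm" using h1(2) xm(1) rW by blast
  then have "0 \<le> h1 xM" using bspec[OF xM xm(1)] by linarith
  have "h1 xm \<le> h1 x \<and> h1 x \<le> h1 xM \<and> norm (D1 x) \<le> norm (D1 xD) \<and> (h1 has_derivative (\<lambda>v. D1 x \<bullet> v)) (at x)"
    if "x \<in> cball 0 r" for x
    using bspec[OF xm(2) that] bspec[OF xM that] bspec[OF xD that] h1(4)[of x] r(2) that by blast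
  then show ?thesis using r pos \<open>0 \<le> h1 xM\<close> norm_ge_zero[of "D1 xD"] by metis
qed

text \<open>The rectangles have width \<open>d = \<beta>\<^bsup>1/\<alpha>\<^esup>\<close>, the scale on which \<open>h0\<close> is comparable to \<open>\<beta>\<close>; their height is
  fixed for a line contact and \<open>d\<close> for a point contact.\<close>

lemma contact_rects_of_profile:
  fixes N :: "real^2 \<Rightarrow> real" and l :: "real \<Rightarrow> real"
  assumes open_sets: "open \<Omega>" "open W" and "1 \<le> \<alpha>"
    and D: "\<And>x. x \<in> \<Omega> \<Longrightarrow> (h0 has_derivative (\<lambda>v. D x \<bullet> v)) (at x)"
    and r: "cball 0 r \<subseteq> \<Omega> \<inter> W" "0 < c1" "0 \<le> C1" "0 \<le> C2"
    and h1: "\<And>x. x \<in> cball 0 r \<Longrightarrow> c1 \<le> h1 x \<and> h1 x \<le> C1 \<and> norm (D1 x) \<le> C2 \<and> (h1 has_derivative (\<lambda>v. D1 x \<bullet> v)) (at x)"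
    and h0: "\<And>x. x \<in> \<Omega> \<Longrightarrow> x \<in> W \<Longrightarrow> x $ 1 < 0 \<Longrightarrow> h0 x = N x powr \<alpha> * h1 x"
    and N: "\<And>x. x $ 1 < 0 \<Longrightarrow> (N has_derivative (\<lambda>v. \<nu> x \<bullet> v)) (at x)"
    and "0 < \<rho>" and rect_N: "\<And>d x. 0 < d \<Longrightarrow> d \<le> \<rho> \<Longrightarrow> x \<in> rect (vector [- 2 * d, 0]) d (l d) \<Longrightarrow>
        x \<in> cball 0 r \<and> d \<le> N x \<and> N x \<le> 4 * d \<and> norm (\<nu> x) \<le> 1 \<and> \<nu> x $ 1 \<le> - 1/4"
    and l: "\<And>d. 0 < d \<Longrightarrow> d \<le> \<rho> \<Longrightarrow> d \<le> l d" and "0 < e"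
    and scale: "\<And>\<beta>. 0 < \<beta> \<Longrightarrow> \<beta> \<le> 1 \<Longrightarrow> e * (\<beta> * sqrt \<beta>) \<le> (\<beta> powr (1/\<alpha>))^2 * l (\<beta> powr (1/\<alpha>))"
      "\<And>\<beta>. 0 < \<beta> \<Longrightarrow> \<beta> \<le> 1 \<Longrightarrow> e * \<beta>^2 \<le> (\<beta> powr (1/\<alpha>))^3 * l (\<beta> powr (1/\<alpha>))"
  shows "contact_rects \<Omega> h0 D"
proof -
  \<comment> \<open>The caps provide \<open>d \<le> 1\<close>, the range in which the rectangle is
    controlled, and the dominance of the profile over the variation of \<open>h1\<close>. The
    summand 1 avoids a zero denominator if \<open>C2 = 0\<close>.\<close>
  define d0 where "d0 = min 1 (min \<rho> (c1 / (8 * (4 powr \<alpha> * C2 + 1))))"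
  have den: "0 < 8 * (4 powr \<alpha> * C2 + 1)" using r(4) by (simp add: add_nonneg_pos)
  then have d0: "0 < d0" using r \<open>0 < \<rho>\<close> by (simp add: d0_def)
  define C where "C = 4 powr \<alpha> * (\<alpha> * C1 + C2)"
  have C: "0 \<le> C" using \<open>1 \<le> \<alpha>\<close> r by (simp add: C_def)
  define b where "b = d0 powr \<alpha>"
  have b: "0 < b" using d0 by (simp add: b_def)
  have "\<exists>c d l. 0 < d \<and> d \<le> l \<and> rect c d l \<subseteq> \<Omega> \<and>
       (\<forall>x\<in>rect c d l. h0 x \<le> C * \<beta> \<and> D x $ 1 \<le> - (c1 / 8) * (\<beta> / d) \<and> norm (D x) \<le> C * (\<beta> / d)) \<and>
       e * (\<beta> * sqrt \<beta>) \<le> d^2 * l \<and> e * \<beta>^2 \<le> d^3 * l"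
    if \<beta>: "0 < \<beta>" "\<beta> \<le> b" for \<beta>
  proof -
    define d where "d = \<beta> powr (1 / \<alpha>)"
    have "0 < d" using \<beta> by (simp add: d_def)
    have \<beta>_eq: "d powr \<alpha> = \<beta>" using \<beta> \<open>1 \<le> \<alpha>\<close> by (simp add: d_def powr_powr)
    have "d \<le> (d0 powr \<alpha>) powr (1 / \<alpha>)" unfolding d_def using \<beta> \<open>1 \<le> \<alpha>\<close> by (intro powr_mono2) (auto simp: b_def)
    also have "\<dots> = d0" using d0 \<open>1 \<le> \<alpha>\<close> by (simp add: powr_powr)
    finally have d_le: "d \<le> 1" "d \<le> \<rho>" "d \<le> c1 / (8 * (4 powr \<alpha> * C2 + 1))" by (auto simp: d0_def)
    have small: "4 powr \<alpha> * C2 * d \<le> c1 / 8"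
    proof -
      have "8 * (4 powr \<alpha> * C2 + 1) * d \<le> c1" using d_le(3) den by (simp add: pos_le_divide_eq mult.commute)
      then show ?thesis using \<open>0 < d\<close> by (simp add: algebra_simps)
    qed
    have "\<beta> \<le> 1" using d_le(1) \<open>0 < d\<close> \<open>1 \<le> \<alpha>\<close> powr_mono2[of \<alpha> d 1] \<beta>_eq by simp
    define c :: "real^2" where "c = vector [- 2 * d, 0]"
    let ?Q = "rect c d (l d)"
    note Q = rect_N[OF \<open>0 < d\<close> d_le(2), folded c_def]
    have bounds: "h0 x \<le> C * \<beta> \<and> D x $ 1 \<le> - (c1 / 8) * (\<beta> / d) \<and> norm (D x) \<le> C * (\<beta> / d)" if x: "x \<in> ?Q" for x
    proof -
      let ?U = "\<Omega> \<inter> W \<inter> {x. x $ 1 < 0}"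
      have "x $ 1 < 0" using x \<open>0 < d\<close> by (auto simp: rect_def c_def)
      then have xr: "x \<in> cball 0 r" "x \<in> \<Omega>" "x \<in> ?U" using Q[OF x] r(1) by auto
      have U: "open ?U"
        using open_sets by (intro open_Int open_halfspace_component_lt_cart)
      have hU: "h0 y = N y powr \<alpha> * h1 y" if "y \<in> ?U" for y
        using that by (intro h0) auto
      have n: "norm (\<nu> x) \<le> 1" "\<nu> x $ 1 \<le> - 1/4" "d \<le> N x" "N x \<le> 4 * d" using Q[OF x] by auto
      have h: "(h1 has_derivative (\<lambda>v. D1 x \<bullet> v)) (at x)" "c1 \<le> h1 x" "h1 x \<le> C1" "norm (D1 x) \<le> C2"
        using h1[OF xr(1)] by auto
      note est = contact_estimates[OF N[OF \<open>x $ 1 < 0\<close>] n \<open>0 < d\<close> d_le(1) small \<open>1 \<le> \<alpha>\<close> h(1) r(2) h(2-4) D[OF xr(2)] U xr(3) hU]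
      show ?thesis using est unfolding C_def \<beta>_eq by blast
    qed
    show ?thesis
    proof (rule exI[of _ c], rule exI[of _ d], rule exI[of _ "l d"], intro conjI)
      show "?Q \<subseteq> \<Omega>" using Q r(1) by blast
      show "\<forall>x\<in>?Q. h0 x \<le> C * \<beta> \<and> D x $ 1 \<le> - (c1 / 8) * (\<beta> / d) \<and> norm (D x) \<le> C * (\<beta> / d)"
        using bounds by blast
      show "e * (\<beta> * sqrt \<beta>) \<le> d^2 * l d" "e * \<beta>^2 \<le> d^3 * l d"
        using scale[OF \<beta>(1) \<open>\<beta> \<le> 1\<close>] by (simp_all add: d_def)
    qed (use l[OF \<open>0 < d\<close> d_le(2)] \<open>0 < d\<close> in auto)
  qed
  moreover have "0 < c1 / 8" using r(2) by simp
  ultimately show ?thesis unfolding contact_rects_def using b C \<open>0 < e\<close> by blast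
qed

text \<open>For \<open>\<beta> \<le> 1\<close> a smaller exponent gives a larger power. With fixed
  height the cases \<open>n = 2\<close> and \<open>n = 3\<close> are needed, and
  \<open>3 / \<alpha> \<le> 2\<close> is \<open>3/2 \<le> \<alpha>\<close>. With height
  \<open>d\<close> they become \<open>n = 3\<close> and \<open>n = 4\<close>, and both conditions
  are \<open>2 \<le> \<alpha>\<close>.\<close>

lemma powr_scale:
  fixes \<beta> \<alpha> :: real
  assumes "0 < \<beta>" "\<beta> \<le> 1" "0 < \<alpha>"
  shows "real n / \<alpha> \<le> 3/2 \<Longrightarrow> \<beta> * sqrt \<beta> \<le> (\<beta> powr (1/\<alpha>))^n"
    "real n / \<alpha> \<le> 2 \<Longrightarrow> \<beta>^2 \<le> (\<beta> powr (1/\<alpha>))^n"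
proof -
  have pw: "(\<beta> powr (1/\<alpha>))^n = \<beta> powr (real n / \<alpha>)"
    using assms(1) by (simp add: powr_powr flip: powr_realpow)
  have "\<beta> * sqrt \<beta> = \<beta> powr 1 * \<beta> powr (1/2)" using assms(1) by (simp add: powr_half_sqrt)
  also have "\<dots> = \<beta> powr (3/2)" using powr_add[of \<beta> 1 "1/2"] by simp
  finally show "\<beta> * sqrt \<beta> \<le> (\<beta> powr (1/\<alpha>))^n" if "real n / \<alpha> \<le> 3/2"
    unfolding pw using that assms by (simp add: powr_mono')
  have "\<beta>^2 = \<beta> powr 2" using assms(1) by simp
  then show "\<beta>^2 \<le> (\<beta> powr (1/\<alpha>))^n" if "real n / \<alpha> \<le> 2"
    unfolding pw using that assms by (simp add: powr_mono' del: powr_numeral)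
qed

lemma line_contact_rects:
  assumes \<Omega>: "open \<Omega>" "0 \<in> \<Omega>" and "3/2 \<le> \<alpha>" and lc: "line_contact \<Omega> h0 \<alpha>"
    and D: "\<And>x. x \<in> \<Omega> \<Longrightarrow> (h0 has_derivative (\<lambda>v. D x \<bullet> v)) (at x)"
  shows "contact_rects \<Omega> h0 D"
proof -
  obtain W h1 where W: "open W" "0 \<in> W" "regular_pos W h1" "\<forall>x \<in> W \<inter> closure \<Omega>. h0 x = \<bar>x $ 1\<bar> powr \<alpha> * h1 x"
    using lc unfolding line_contact_def by blast
  obtain r c1 C1 C2 D1 where r: "0 < r" "cball 0 r \<subseteq> \<Omega> \<inter> W" "0 < c1" "0 \<le> C1" "0 \<le> C2"
    and h1: "\<And>x. x \<in> cball 0 r \<Longrightarrow> c1 \<le> h1 x \<and> h1 x \<le> C1 \<and> norm (D1 x) \<le> C2 \<and> (h1 has_derivative (\<lambda>v. D1 x \<bullet> v)) (at x)"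
    using regular_pos_local_bounds[OF \<Omega> W(1-3)] by metis
  show ?thesis
  \<comment> \<open>The first coordinate ranges over \<open>[-3 * d, -d]\<close>, and
    \<open>d \<le> r / 6\<close> gives \<open>3 * d + r / 2 \<le> r\<close>, so the rectangle stays
    in the ball.\<close>
  proof (rule contact_rects_of_profile[OF \<Omega>(1) W(1) _ D r(2-5) h1, where N = "\<lambda>x. - x $ 1" and \<nu> = "\<lambda>_. - axis 1 1"
        and \<rho> = "r / 6" and l = "\<lambda>_. r / 2" and e = "r / 2"])
    show "h0 x = (- x $ 1) powr \<alpha> * h1 x" if "x \<in> \<Omega>" "x \<in> W" "x $ 1 < 0" for x
      using W(4) that closure_subset[of \<Omega>] by auto
    show "((\<lambda>x::real^2. - x $ 1) has_derivative (\<lambda>v. (- axis 1 1) \<bullet> v)) (at x)" for x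
      by (rule has_derivative_eq_rhs[OF has_derivative_minus[OF bounded_linear_imp_has_derivative[OF bounded_linear_vec_nth]]])
         (auto simp: inner_axis')
    show "x \<in> cball 0 r \<and> d \<le> - x $ 1 \<and> - x $ 1 \<le> 4 * d \<and> norm (- axis 1 1 :: real^2) \<le> 1 \<and> (- axis 1 1 :: real^2) $ 1 \<le> - 1/4"
      if "0 < d" "d \<le> r / 6" "x \<in> rect (vector [- 2 * d, 0]) d (r / 2)" for x d
    proof -
      have x: "\<bar>x $ 1 + 2 * d\<bar> \<le> d" "\<bar>x $ 2\<bar> \<le> r / 2" using that by (auto simp: rect_def)
      have "norm x \<le> \<bar>x $ 1\<bar> + \<bar>x $ 2\<bar>" using norm_le_l1_cart[of x] by (simp add: sum_2)
      then have "norm x \<le> r" using x that by linarith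
      moreover have "d \<le> - x $ 1" "- x $ 1 \<le> 4 * d" using x that(1) by linarith+
      ultimately show ?thesis by (simp add: norm_axis_1)
    qed
    show "r / 2 * (\<beta> * sqrt \<beta>) \<le> (\<beta> powr (1/\<alpha>))^2 * (r / 2)" if "0 < \<beta>" "\<beta> \<le> 1" for \<beta>
      using powr_scale(1)[of \<beta> \<alpha> 2] that r(1) assms(3) by (simp add: field_simps mult_right_mono)
    show "r / 2 * \<beta>^2 \<le> (\<beta> powr (1/\<alpha>))^3 * (r / 2)" if "0 < \<beta>" "\<beta> \<le> 1" for \<beta>
      using powr_scale(2)[of \<beta> \<alpha> 3] that r(1) assms(3) by (simp add: field_simps mult_right_mono)
  qed (use r(1) assms(3) in auto)
qed

lemma point_contact_rects:
  assumes \<Omega>: "open \<Omega>" "0 \<in> \<Omega>" and "2 \<le> \<alpha>" and lc: "point_contact \<Omega> h0 \<alpha>"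
    and D: "\<And>x. x \<in> \<Omega> \<Longrightarrow> (h0 has_derivative (\<lambda>v. D x \<bullet> v)) (at x)"
  shows "contact_rects \<Omega> h0 D"
proof -
  obtain W h1 where W: "open W" "0 \<in> W" "regular_pos W h1" "\<forall>x \<in> W \<inter> closure \<Omega>. h0 x = norm x powr \<alpha> * h1 x"
    using lc unfolding point_contact_def by blast
  obtain r c1 C1 C2 D1 where r: "0 < r" "cball 0 r \<subseteq> \<Omega> \<inter> W" "0 < c1" "0 \<le> C1" "0 \<le> C2"
    and h1: "\<And>x. x \<in> cball 0 r \<Longrightarrow> c1 \<le> h1 x \<and> h1 x \<le> C1 \<and> norm (D1 x) \<le> C2 \<and> (h1 has_derivative (\<lambda>v. D1 x \<bullet> v)) (at x)"
    using regular_pos_local_bounds[OF \<Omega> W(1-3)] by metis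
  show ?thesis
  \<comment> \<open>Here the first coordinate lies in \<open>[-3 * d, -d]\<close> and the second in
    \<open>[-d, d]\<close>, hence \<open>d \<le> norm x \<le> 4 * d\<close>. The first component of
    the unit vector \<open>sgn x\<close> is then at most \<open>-1/4\<close>, and
    \<open>\<rho> = r / 4\<close> keeps the square in the ball.\<close>
  proof (rule contact_rects_of_profile[OF \<Omega>(1) W(1) _ D r(2-5) h1, where N = norm and \<nu> = sgn
        and \<rho> = "r / 4" and l = "\<lambda>d. d" and e = 1])
    show "h0 x = norm x powr \<alpha> * h1 x" if "x \<in> \<Omega>" "x \<in> W" for x
      using W(4) that closure_subset[of \<Omega>] by auto
    show "(norm has_derivative (\<lambda>v. sgn x \<bullet> v)) (at x)" if "x $ 1 < 0" for x :: "real^2"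
    proof -
      have "x \<noteq> 0" using that by auto
      then show ?thesis using has_derivative_norm[of x] by (simp add: inner_commute)
    qed
    show "x \<in> cball 0 r \<and> d \<le> norm x \<and> norm x \<le> 4 * d \<and> norm (sgn x) \<le> 1 \<and> sgn x $ 1 \<le> - 1/4"
      if "0 < d" "d \<le> r / 4" "x \<in> rect (vector [- 2 * d, 0]) d d" for x d
    proof -
      have x: "\<bar>x $ 1 + 2 * d\<bar> \<le> d" "\<bar>x $ 2\<bar> \<le> d" using that by (auto simp: rect_def)
      have "norm x \<le> \<bar>x $ 1\<bar> + \<bar>x $ 2\<bar>" using norm_le_l1_cart[of x] by (simp add: sum_2)
      then have le: "norm x \<le> 4 * d" using x by linarith
      have ge: "d \<le> norm x" using component_le_norm_cart[of x 1] x by linarith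
      have "x $ 1 \<le> - (1/4) * norm x" using le x by linarith
      moreover have n: "0 < norm x" using ge that(1) by linarith
      ultimately have "x $ 1 / norm x \<le> - 1/4" by (subst pos_divide_le_eq[OF n]) simp
      moreover have "sgn x $ 1 = x $ 1 / norm x" by (simp add: sgn_div_norm divide_inverse_commute)
      moreover have "norm (sgn x) \<le> 1" by (simp add: norm_sgn)
      moreover have "x \<in> cball 0 r" using le that(2) by simp
      ultimately show ?thesis using le ge by simp
    qed
    show "1 * (\<beta> * sqrt \<beta>) \<le> (\<beta> powr (1/\<alpha>))^2 * \<beta> powr (1/\<alpha>)" if "0 < \<beta>" "\<beta> \<le> 1" for \<beta>
      using powr_scale(1)[of \<beta> \<alpha> 3] that assms(3) by (simp add: field_simps power3_eq_cube power2_eq_square)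
    show "1 * \<beta>^2 \<le> (\<beta> powr (1/\<alpha>))^3 * \<beta> powr (1/\<alpha>)" if "0 < \<beta>" "\<beta> \<le> 1" for \<beta>
      using powr_scale(2)[of \<beta> \<alpha> 4] that assms(3) by (simp add: field_simps power3_eq_cube power4_eq_xxxx)
  qed (use r(1) assms(3) in auto)
qed

theorem theorem2p3:
  fixes \<Omega> :: "(real^2) set" and h0 :: "real^2 \<Rightarrow> real"
    and F \<eta>0 \<eta>1 :: real and T :: ereal and \<eta> \<eta>' :: "real \<Rightarrow> real"
  assumes "bounded \<Omega>" and "open \<Omega>" and "smooth_boundary \<Omega>" and "0 \<in> \<Omega>"
    and "C1_closure \<Omega> h0" and "\<forall>x\<in>closure \<Omega>. h0 x \<ge> 0" and "h0 0 = 0"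
    and "F > 0"
    and "(\<exists>\<alpha>. \<alpha> \<ge> 3/2 \<and> line_contact \<Omega> h0 \<alpha>) \<or> (\<exists>\<alpha>. \<alpha> \<ge> 2 \<and> point_contact \<Omega> h0 \<alpha>)"
    and "\<eta>0 > 0"
    and "ode_sol (G \<Omega> h0 F) \<eta>0 \<eta>1 T \<eta> \<eta>'"
    and "\<not> (\<exists>T' \<zeta> \<zeta>'. T' > T \<and> ode_sol (G \<Omega> h0 F) \<eta>0 \<eta>1 T' \<zeta> \<zeta>' \<and>
              (\<forall>t. 0 \<le> t \<and> ereal t < T \<longrightarrow> \<zeta> t = \<eta> t \<and> \<zeta>' t = \<eta>' t))"
  shows "T = \<infinity> \<and> (\<exists>m0 M0 M1. 0 < m0 \<and> m0 \<le> M0 \<and> 0 \<le> M1 \<and>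
           (\<forall>t\<ge>0. m0 \<le> \<eta> t \<and> \<eta> t \<le> M0 \<and> \<bar>\<eta>' t\<bar> \<le> M1))"
proof -
  have h0_cont: "continuous_on (closure \<Omega>) h0" using assms(5) by (simp add: C1_closure_def)
  obtain D where D: "\<And>x. x \<in> \<Omega> \<Longrightarrow> (h0 has_derivative (\<lambda>v. D x \<bullet> v)) (at x)" and "continuous_on (closure \<Omega>) D"
    using assms(5) unfolding C1_closure_def by blast
  then have D_cont: "continuous_on \<Omega> D" using closure_subset continuous_on_subset by blast
  have "closure \<Omega> \<noteq> {}" using assms(4) by auto
  then obtain xM where xM: "xM \<in> closure \<Omega>" "\<forall>y\<in>closure \<Omega>. h0 y \<le> h0 xM"
    using continuous_attains_sup[OF _ _ h0_cont] assms(1) by (meson compact_closure)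
  interpret gap_domain \<Omega> "lebesgue_on \<Omega>" h0 "h0 xM"
  proof unfold_locales
    show "h0 \<in> borel_measurable (lebesgue_on \<Omega>)"
      using assms(2) continuous_on_subset[OF h0_cont closure_subset]
      by (intro continuous_imp_measurable_on_sets_lebesgue) auto
    show "h0 x \<le> h0 xM" "0 \<le> h0 x" if "x \<in> \<Omega>" for x
      using that xM(2) assms(6) closure_subset by blast+
  qed (use assms xM in auto)
  have G_eq: "G \<Omega> h0 F \<beta> \<gamma> = I \<beta> \<gamma> - F" for \<beta> \<gamma> by (simp add: G_def I_def)
  have "contact_rects \<Omega> h0 D"
    using assms(9) line_contact_rects[OF assms(2,4) _ _ D] point_contact_rects[OF assms(2,4) _ _ D] by blast
  from I_near_zero[OF D D_cont this assms(8)]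
  obtain b c where near: "0 < b" "0 < c"
    "\<And>x y. 0 < x \<Longrightarrow> x \<le> b \<Longrightarrow> y \<le> 0 \<Longrightarrow> 0 < G \<Omega> h0 F x y"
    "\<And>x y. 0 < x \<Longrightarrow> x \<le> b \<Longrightarrow> y \<le> 0 \<Longrightarrow> c * \<bar>y\<bar> / x \<le> G \<Omega> h0 F x y"
    unfolding G_eq by blast
  define K where "K = one_norm * load_norm 0"
  have "0 \<le> K" by (simp add: K_def one_norm_nonneg load_norm_nonneg)
  \<comment> \<open>From \<open>x \<ge> 1\<close> follows
    \<open>x^3 \<ge> x \<ge> 2 * K / F\<close>, so the pressure term \<open>K / x^3\<close> uses up
    at most half of \<open>F\<close>.\<close>
  have far: "G \<Omega> h0 F x 0 \<le> - (F / 2)" if "max 1 (2 * K / F) \<le> x" for x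
  proof -
    have x: "1 \<le> x" "2 * K / F \<le> x" using that by auto
    have "x ^ 1 \<le> x ^ 3" using x(1) by (intro power_increasing) auto
    then have "2 * K / F \<le> x^3" using x by simp
    then have "K / x^3 \<le> F / 2" using x(1) assms(8) by (simp add: field_simps)
    moreover have "I x 0 \<le> K / x^3" using I_le[of x 0] x(1) by (simp add: K_def)
    ultimately show ?thesis unfolding G_eq by linarith
  qed
  show ?thesis
  proof (rule maximal_ode_sol_bounded[OF _ _ _ far near assms(11,12)])
    show "locally_lipschitz_pos (G \<Omega> h0 F)"
      unfolding locally_lipschitz_pos_def G_eq using I_locally_lipschitz by simp
    show "G \<Omega> h0 F x z \<le> G \<Omega> h0 F x y" if "0 < x" "y \<le> z" for x y z
      unfolding G_eq using I_antimono[OF that] by simp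
  qed (use assms(8) in simp)
qed

end
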